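(* In the causal inference setting of the context (with unconfoundedness and the Basic Assumption for $m_0,\mu_0$), let $N\to\infty$, $\bar\pi_N\to0$ and $N\bar\pi_N\to\infty$. Suppose for all $x\in\mathcal X$, $c\bar\pi_N<\pi_N(x),e_N(x)<C\bar\pi_N$ for some constants $c,C>0$. Let $\varepsilon=Y-Rm_1(X)-(1-R)m_0(X)$ and assume $\|\varepsilon\|_{2,\mathbb P}<\infty$, $\|m_0(\cdot)-\mu_0(\cdot)\|_{2,\mathbb P_X}<C<\infty$, $\mathrm{Var}\{m_0(X)\}<\infty$, and (for each cross-fitted estimator) $$\|\hat m_0(\cdot)-\mu_0(\cdot)\|_{2,\mathbb P_X}=O_p(r_{\mu,0,N}),\qquad \sup_{x\in\mathcal X}\Big|\frac{\hat\pi_N(x)-e_N(x)}{\bar\pi_N}\Big|=O_p(r_{e,N}),$$ for sequences of positive numbers $r_{\mu,0,N}=o(1)$, $r_{e,N}=o(1)$. Then $$\hat\theta^0-\theta^0=N^{-1}\sum_{i=1}^N\psi_0(Z_i)+O_p\big(N^{-1/2}\bar\pi_N^{1/2}r_{\mu,0,N}+N^{-1/2}\bar\pi_Nr_{e,N}+\bar\pi_Nr_{e,N}r_{\mu,0,N}\big)$$ $$\qquad+\mathbf 1\{m_0(\cdot)\ne\mu_0(\cdot)\}O_p(\bar\pi_Nr_{e,N})+\mathbf 1\{e_N(\cdot)\ne\pi_N(\cdot)\}O_p(\bar\pi_Nr_{\mu,0,N}),$$ where $$\psi_0(Z)=\mu_0(X)-\theta^0+\frac{1-R}{1-e_N(X)}\{Y-\mu_0(X)\}=\frac{e_N(X)-R}{1-e_N(X)}\{m_0(X)-\mu_0(X)\}+m_0(X)-\theta^0+\frac{\varepsilon(1-R)}{1-e_N(X)},$$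 with $\mathbb E\{\psi_0(Z)\}=\mathbf 1\{e_N(\cdot)\ne\pi_N(\cdot),\ \mu_0(\cdot)\ne m_0(\cdot)\}\,O(\bar\pi_N)$ and $\mathrm{Var}\{\psi_0(Z)\}=O(1)$ (so that $\mathrm{Var}\{N^{-1}\sum_{i=1}^N\psi_0(Z_i)\}=O(N^{-1})$). Hence $$\hat\theta^0-\theta^0=N^{-1}\sum_{i=1}^N\psi_0(Z_i)+o_p(N^{-1/2}),\qquad\mathbb E\{\psi_0(Z)\}=0,$$ once $\bar\pi_Nr_{e,N}r_{\mu,0,N}=o(N^{-1/2})$; $\bar\pi_Nr_{e,N}=o(N^{-1/2})$ if $m_0$ is misspecified ($\mu_0\ne m_0$); $\bar\pi_Nr_{\mu,0,N}=o(N^{-1/2})$ if $\pi_N$ is misspecified ($e_N\ne\pi_N$); and at least one of $m_0(\cdot)$ and $\pi_N(\cdot)$ is correctly specified. If both $m_0(\cdot)$ and $\pi_N(\cdot)$ are misspecified, then $\hat\theta^0-\theta^0=O_p(\bar\pi_N+N^{-1/2})$.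
   Context: Setting. For each $N$, $\mathbb S=\{Z_i=(R_i,Y_i,X_i)\}_{i=1}^N$ are i.i.d. copies of $Z=(R,Y,X)$, where $R\in\{0,1\}$ is a treatment indicator whose law may depend on $N$, $X\in\mathbb R^p$ has law $\mathbb P_X$ and support $\mathcal X$, and $Y=R\,\mathrm Y(1)+(1-R)\mathrm Y(0)$ with potential outcomes $\mathrm Y(0),\mathrm Y(1)\in\mathbb R$. Unconfoundedness: $\{\mathrm Y(0),\mathrm Y(1)\}\perp\!\!\!\perp R\mid X$. $\theta^0=\mathbb E\{\mathrm Y(0)\}$, $m_r(x)=\mathbb E(Y\mid R=r,X=x)=\mathbb E\{\mathrm Y(r)\mid X=x\}$, $\pi_N(x)=\mathbb P(R=1\mid X=x)$, $\bar\pi_N=\mathbb P(R=1)$. Basic Assumption for $(m_0,\mu_0)$: $Z$ (and $\mathrm Y(0)$) has finite second moments, $\mathrm{Var}(X)$ is positive definite, and there are constants $0<\sigma_{\zeta,1}^2,\sigma_{\zeta,2}^2<\infty$ independent of $N$ with $\mathbb E[\{\mathrm Y(0)-m_0(X)\}^2\mid X=x]\ge\sigma_{\zeta,1}^2$ and $\mathbb E[\{\mathrm Y(0)-\mu_0(X)\}^2\mid X=x]\le\sigma_{\zeta,2}^2$ for all $x\in\mathcal X$, and $\mathrm{Var}\{\mathrm Y(0)\}\le\sigma_{\zeta,2}^2$. Estimator. For a fixed integer $\mathbb K\ge2$, $\{\mathcal I_k\}_{k=1}^{\mathbb K}$ is a random partition of $\{1,\dots,N\}$ (independent of the data); $\mathbb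 S_{-k}=\{Z_i:i\notin\mathcal I_k\}$; $\hat m_0(\cdot)=\hat m_0(\cdot;\mathbb S_{-k})$ and $\hat\pi_N(\cdot)=\hat\pi_N(\cdot;\mathbb S_{-k})$ are estimators of $m_0$ and $\pi_N$ built from $\mathbb S_{-k}$, evaluated at $X_i$ with the $k$ such that $i\in\mathcal I_k$; and $$\hat\theta^0=N^{-1}\sum_{i=1}^N\Big[\hat m_0(X_i)+\frac{1-R_i}{1-\hat\pi_N(X_i)}\{Y_i-\hat m_0(X_i)\}\Big].$$ $\mu_0(\cdot)$ and $e_N(\cdot)$ are nonrandom functions (possibly misspecified limits of $\hat m_0$ and $\hat\pi_N$). $\|f\|_{2,\mathbb P_X}$ is the $L_2$ norm over an independent copy of $X$ with estimators held fixed; moment bounds are uniform in $N$. *)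

theory Defs
  imports "HOL-Probability.Probability" "HOL-Library.Landau_Symbols"
begin

section \<open>Conditioning and independence\<close>

definition sigma_of :: "'a measure \<Rightarrow> ('a \<Rightarrow> 'b::topological_space) \<Rightarrow> 'a measure" where
  "sigma_of P X = vimage_algebra (space P) X borel"

text \<open>\<open>regression_fun P X V g\<close>: the function \<open>g\<close> is a version of \<open>x \<mapsto> E(V | X = x)\<close>.
  Integrability of \<open>V\<close> is part of the notion because \<open>real_cond_exp\<close> takes junk values
  (e.g. 0 in place of infinity) on non-integrable functions.\<close>

definition regression_fun ::
  "'a measure \<Rightarrow> ('a \<Rightarrow> 'b::topological_space) \<Rightarrow> ('a \<Rightarrow> real) \<Rightarrow> ('b \<Rightarrow> real) \<Rightarrow> bool" where
  "regression_fun P X V g \<longleftrightarrow>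
     integrable P V \<and> g \<in> borel_measurable borel \<and>
     (AE \<omega> in P. real_cond_exp P (sigma_of P X) V \<omega> = g (X \<omega>))"

definition cond_indep_given ::
  "'a measure \<Rightarrow> ('a \<Rightarrow> 'b::topological_space) \<Rightarrow> ('a \<Rightarrow> 'c::topological_space)
     \<Rightarrow> ('a \<Rightarrow> 'd::topological_space) \<Rightarrow> bool" where
  "cond_indep_given P X U V \<longleftrightarrow>
     (\<forall>A\<in>sets borel. \<forall>B\<in>sets borel. AE \<omega> in P.
        real_cond_exp P (sigma_of P X) (\<lambda>\<omega>. of_bool (U \<omega> \<in> A \<and> V \<omega> \<in> B)) \<omega> =
        real_cond_exp P (sigma_of P X) (\<lambda>\<omega>. of_bool (U \<omega> \<in> A)) \<omega> *
        real_cond_exp P (sigma_of P X) (\<lambda>\<omega>. of_bool (V \<omega> \<in> B)) \<omega>)"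

text \<open>The library's \<open>indep_var\<close> only covers random elements with a common type of values.\<close>

definition indep_elements ::
  "'a measure \<Rightarrow> 'b measure \<Rightarrow> ('a \<Rightarrow> 'b) \<Rightarrow> 'c measure \<Rightarrow> ('a \<Rightarrow> 'c) \<Rightarrow> bool" where
  "indep_elements Q MU U MV V \<longleftrightarrow>
     U \<in> measurable Q MU \<and> V \<in> measurable Q MV \<and>
     prob_space.indep_set Q (sets (vimage_algebra (space Q) U MU))
       (sets (vimage_algebra (space Q) V MV))"


section \<open>Supports, norms and covariance matrices\<close>

definition measure_support :: "'a::topological_space measure \<Rightarrow> 'a set" where
  "measure_support Q = {x. \<forall>U. open U \<and> x \<in> U \<longrightarrow> emeasure Q U > 0}"

text \<open>The \<open>L\<^sub>2\<close> norm is extended-valued, so that it is infinite (and not 0) for functions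
  that are not square integrable.\<close>

definition L2_norm :: "'a measure \<Rightarrow> ('a \<Rightarrow> real) \<Rightarrow> ennreal" where
  "L2_norm Q f =
     (let v = (\<integral>\<^sup>+ x. ennreal ((f x)\<^sup>2) \<partial>Q) in if v = \<top> then \<top> else ennreal (sqrt (enn2real v)))"

definition square_integrable :: "'a measure \<Rightarrow> ('a \<Rightarrow> real) \<Rightarrow> bool" where
  "square_integrable Q f \<longleftrightarrow> f \<in> borel_measurable Q \<and> integrable Q (\<lambda>x. (f x)\<^sup>2)"

definition cov_matrix :: "'a measure \<Rightarrow> ('a \<Rightarrow> real ^ 'p) \<Rightarrow> real ^ 'p ^ 'p" where
  "cov_matrix P X =
     (\<chi> j k. \<integral>\<omega>. (X \<omega> $ j - (\<integral>\<omega>'. X \<omega>' $ j \<partial>P)) * (X \<omega> $ k - (\<integral>\<omega>'. X \<omega>' $ k \<partial>P)) \<partial>P)"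

definition pos_definite :: "real ^ 'p ^ 'p \<Rightarrow> bool" where
  "pos_definite A \<longleftrightarrow> transpose A = A \<and> (\<forall>v. v \<noteq> 0 \<longrightarrow> v \<bullet> (A *v v) > 0)"

text \<open>Regression functions are only determined up to null sets of the law of the covariates, so
  the (mis)specification statements \<open>m = \<mu>\<close>, \<open>e = \<pi>\<close> are read almost everywhere.\<close>

definition same_fun :: "'a measure \<Rightarrow> ('a \<Rightarrow> real) \<Rightarrow> ('a \<Rightarrow> real) \<Rightarrow> bool" where
  "same_fun Q f g \<longleftrightarrow> (AE x in Q. f x = g x)"


section \<open>Stochastic order symbols\<close>

text \<open>Each sample size \<open>N\<close> has its own probability space \<open>M N\<close>.  Outer probabilities are used
  because suprema over uncountable sets need not be measurable; for measurable quantities they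
  are the usual probabilities.\<close>

definition enn_Op :: "(nat \<Rightarrow> 'w measure) \<Rightarrow> (nat \<Rightarrow> 'w \<Rightarrow> ennreal) \<Rightarrow> (nat \<Rightarrow> real) \<Rightarrow> bool" where
  "enn_Op M V a \<longleftrightarrow>
     (\<forall>\<epsilon>>0. \<exists>T>0. \<forall>\<^sub>F N in sequentially.
        outer_measure_of (M N) {\<omega> \<in> space (M N). V N \<omega> > ennreal (T * a N)} \<le> ennreal \<epsilon>)"

definition Op :: "(nat \<Rightarrow> 'w measure) \<Rightarrow> (nat \<Rightarrow> 'w \<Rightarrow> real) \<Rightarrow> (nat \<Rightarrow> real) \<Rightarrow> bool" where
  "Op M V a \<longleftrightarrow> enn_Op M (\<lambda>N \<omega>. ennreal \<bar>V N \<omega>\<bar>) a"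

definition op_small :: "(nat \<Rightarrow> 'w measure) \<Rightarrow> (nat \<Rightarrow> 'w \<Rightarrow> real) \<Rightarrow> (nat \<Rightarrow> real) \<Rightarrow> bool" where
  "op_small M V a \<longleftrightarrow>
     (\<forall>\<delta>>0. (\<lambda>N. outer_measure_of (M N) {\<omega> \<in> space (M N). \<bar>V N \<omega>\<bar> > \<delta> * a N}) \<longlonglongrightarrow> 0)"


section \<open>Observations and the cross-fitted doubly robust estimator\<close>

text \<open>An observation is a triple (treatment indicator, outcome, covariates).\<close>

type_synonym 'p obs = "real \<times> real \<times> (real ^ 'p)"

definition obs_outcome :: "('a \<Rightarrow> real) \<Rightarrow> ('a \<Rightarrow> real) \<Rightarrow> ('a \<Rightarrow> real) \<Rightarrow> 'a \<Rightarrow> real" where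
  "obs_outcome R Y0 Y1 \<omega> = R \<omega> * Y1 \<omega> + (1 - R \<omega>) * Y0 \<omega>"

definition observation ::
  "('a \<Rightarrow> real) \<Rightarrow> ('a \<Rightarrow> real) \<Rightarrow> ('a \<Rightarrow> real) \<Rightarrow> ('a \<Rightarrow> real ^ 'p) \<Rightarrow> 'a \<Rightarrow> 'p obs" where
  "observation R Y0 Y1 X \<omega> = (R \<omega>, obs_outcome R Y0 Y1 \<omega>, X \<omega>)"

definition treat_prob :: "'a measure \<Rightarrow> ('a \<Rightarrow> real) \<Rightarrow> real" where
  "treat_prob P R = measure P {\<omega> \<in> space P. R \<omega> = 1}"

definition residual ::
  "(real ^ 'p \<Rightarrow> real) \<Rightarrow> (real ^ 'p \<Rightarrow> real) \<Rightarrow> 'p obs \<Rightarrow> real" where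
  "residual m0 m1 = (\<lambda>(r, y, x). y - r * m1 x - (1 - r) * m0 x)"

definition psi0 ::
  "(real ^ 'p \<Rightarrow> real) \<Rightarrow> (real ^ 'p \<Rightarrow> real) \<Rightarrow> real \<Rightarrow> 'p obs \<Rightarrow> real" where
  "psi0 \<mu>0 e \<theta>0 = (\<lambda>(r, y, x). \<mu>0 x - \<theta>0 + (1 - r) / (1 - e x) * (y - \<mu>0 x))"

text \<open>A learner \<open>f\<close> turns, for sample size \<open>N\<close>, a training sample, given by its index set \<open>J\<close> and
  the family of observations indexed by \<open>J\<close>, into a function of the covariates.\<close>

type_synonym 'p learner = "nat \<Rightarrow> nat set \<Rightarrow> (nat \<Rightarrow> 'p obs) \<Rightarrow> real ^ 'p \<Rightarrow> real"

definition measurable_learner :: "'p::finite learner \<Rightarrow> bool" where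
  "measurable_learner f \<longleftrightarrow>
     (\<forall>N. \<forall>J\<subseteq>{1..N}.
        (\<lambda>(z, x). f N J z x) \<in> borel_measurable (PiM J (\<lambda>_. borel) \<Otimes>\<^sub>M borel))"

definition crossfit ::
  "'p::finite learner \<Rightarrow> nat \<Rightarrow> (nat \<Rightarrow> nat set) \<Rightarrow> (nat \<Rightarrow> 'p obs) \<Rightarrow> nat \<Rightarrow> real ^ 'p \<Rightarrow> real" where
  "crossfit f N I z k = f N ({1..N} - I k) (restrict z ({1..N} - I k))"

text \<open>Folds may be empty.\<close>

definition folds :: "nat \<Rightarrow> nat \<Rightarrow> (nat \<Rightarrow> nat set) \<Rightarrow> bool" where
  "folds K N I \<longleftrightarrow> disjoint_family_on I {1..K} \<and> (\<Union>k\<in>{1..K}. I k) = {1..N}"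

definition fold_index :: "nat \<Rightarrow> (nat \<Rightarrow> nat set) \<Rightarrow> nat \<Rightarrow> nat" where
  "fold_index K I i = (THE k. k \<in> {1..K} \<and> i \<in> I k)"

definition dr_estimator ::
  "nat \<Rightarrow> 'p::finite learner \<Rightarrow> 'p learner \<Rightarrow> nat \<Rightarrow> (nat \<Rightarrow> nat set) \<Rightarrow> (nat \<Rightarrow> 'p obs) \<Rightarrow> real" where
  "dr_estimator K mhat pihat N I z =
     (1 / real N) * (\<Sum>i=1..N.
        (case z i of (r, y, x) \<Rightarrow>
          let k = fold_index K I i; m = crossfit mhat N I z k x; p = crossfit pihat N I z k x
          in m + (1 - r) / (1 - p) * (y - m)))"

definition sample_mean :: "nat \<Rightarrow> ('z \<Rightarrow> real) \<Rightarrow> (nat \<Rightarrow> 'z) \<Rightarrow> real" where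
  "sample_mean N f z = (1 / real N) * (\<Sum>i=1..N. f (z i))"

end

theory Submission
  imports Defs
begin

text \<open>With \<open>\<delta>\<close> the error of the outcome regression and \<open>\<eta>\<close> the error of the inverse weight
  \<open>1 / (1 - e)\<close>, the difference between the cross-fitted score and \<open>\<psi>\<close> at an observation
  \<open>(r, y, x)\<close> is
  \<open>\<delta> (r - \<pi>) / (1 - e) + (1 - r) \<eta> (y - m0) - (1 - r) \<eta> \<delta> + (1 - r) \<eta> (m0 - \<mu>0) + \<delta> (\<pi> - e) / (1 - e)\<close>.
  Given the training part the first two terms are centred, so their averages are controlled by second
  moments; the other three are controlled by first moments.  The fourth vanishes if \<open>m0 = \<mu>0\<close> and the
  fifth if \<open>e = \<pi>\<close>.  No conditioning on the estimators is needed: \<open>\<delta>\<close> and \<open>\<eta>\<close> are replaced by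
  truncations that satisfy the assumed error bounds for every training sample, which turns the
  conditional moment bounds into unconditional ones and changes the estimator only on an event of
  small outer probability.\<close>

section \<open>Supports, regression functions and conditional independence\<close>

text \<open>The obstacle is a mismatch of quantifiers: the hypotheses control the estimators only
  off an event that may fail to be measurable, with a level that depends on the tolerated
  probability, whereas Fubini on the product law wants a bound for every training sample. Random
  folds are handled without conditioning as well: they take finitely many values and are independent
  of the data, so a bound for each fixed partition suffices. Folds share data, hence second moments
  are computed inside one fold and the \<open>K\<close> folds are added by the triangle inequality.
  The rates arise as follows. With \<kappa> = \<open>C * pb N\<close>, the binary treatment noise
  has variance of order \<open>pb N\<close>, which gives the factor \<open>sqrt (pb N)\<close>. The
  assumed propensity error is relative to \<open>pb N\<close>, so \<eta> is of order
  \<open>pb N * re N\<close>; this produces every other factor \<open>pb N\<close> that accompanies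
  \<open>re N\<close>. In the fifth term the factor is the size of \<pi> - e. The bounds on \<pi>
  and e hold only on the support of the covariates, so weights are set to 0 off it. The requirement
  \<kappa> \<le> 1/4, true for large \<open>N\<close>, keeps all denominators away from 0.\<close>

lemma closed_measure_support: "closed (measure_support Q)"
proof -
  have "- measure_support Q = \<Union>{U. open U \<and> emeasure Q U = 0}"
    by (auto simp: measure_support_def)
  then show ?thesis
    unfolding closed_def by (auto intro!: open_Union)
qed

text \<open>The complement of the support is a possibly uncountable union of null open sets; a
  countable basis covers it by countably many null ones.\<close>

lemma AE_in_measure_support:
  fixes Q :: "'a::second_countable_topology measure"
  assumes "sets Q = sets borel"
  shows "AE x in Q. x \<in> measure_support Q"
proof -
  obtain B :: "'a set set" where B: "countable B" "topological_basis B"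
    using ex_countable_basis by blast
  have "AE x in Q. \<forall>U\<in>{U\<in>B. emeasure Q U = 0}. x \<notin> U"
  proof (rule AE_ball_countable')
    fix U assume "U \<in> {U\<in>B. emeasure Q U = 0}"
    then show "AE x in Q. x \<notin> U"
      using topological_basis_open[OF B(2)] assms
      by (intro AE_not_in) (auto simp: null_sets_def)
  qed (use B in auto)
  then show ?thesis
  proof (rule AE_mp, intro AE_I2 impI)
    fix x assume x: "\<forall>U\<in>{U\<in>B. emeasure Q U = 0}. x \<notin> U"
    show "x \<in> measure_support Q"
      unfolding measure_support_def
    proof (intro CollectI allI impI)
      fix U assume "open U \<and> x \<in> U"
      then obtain V where V: "V \<in> B" "x \<in> V" "V \<subseteq> U"
        using topological_basisE[OF B(2)] by metis
      then have "emeasure Q V > 0"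
        using x by (auto simp: zero_less_iff_neq_zero)
      also have "emeasure Q V \<le> emeasure Q U"
        using V \<open>open U \<and> x \<in> U\<close> assms by (intro emeasure_mono) auto
      finally show "emeasure Q U > 0" .
    qed
  qed
qed

lemma (in prob_space) sigma_finite_subalgebra_sigma_of:
  assumes "X \<in> borel_measurable M"
  shows "sigma_finite_subalgebra M (sigma_of M X)"
proof (rule finite_measure_subalgebra_is_sigma_finite)
  show "finite_measure_subalgebra M (sigma_of M X)"
    using assms unfolding finite_measure_subalgebra_def finite_measure_subalgebra_axioms_def
      subalgebra_def sigma_of_def
    by (auto intro: finite_measure_axioms measurable_sets simp: sets_vimage_algebra2)
qed

lemma measurable_comp_sigma_of:
  assumes "f \<in> measurable borel N"
  shows "(\<lambda>\<omega>. f (X \<omega>)) \<in> measurable (sigma_of P X) N"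
  unfolding sigma_of_def
  by (rule measurable_compose[OF measurable_vimage_algebra1 assms]) simp

context prob_space
begin

text \<open>Integrated form of the regression property. Only the product with \<open>V\<close> has
  to be integrable, so \<open>f\<close> may be unbounded, as it is in
  \<open>integral_treatment\<close>.\<close>

lemma regression_fun_integral:
  assumes g: "regression_fun M X V g" and X: "X \<in> borel_measurable M"
    and f: "f \<in> borel_measurable borel" and int: "integrable M (\<lambda>\<omega>. f (X \<omega>) * V \<omega>)"
  shows "integrable M (\<lambda>\<omega>. f (X \<omega>) * g (X \<omega>))"
    and "(\<integral>\<omega>. f (X \<omega>) * g (X \<omega>) \<partial>M) = (\<integral>\<omega>. f (X \<omega>) * V \<omega> \<partial>M)"
proof -
  interpret F: sigma_finite_subalgebra M "sigma_of M X"
    using X by (rule sigma_finite_subalgebra_sigma_of)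
  have V: "V \<in> borel_measurable M" and ae: "AE \<omega> in M. real_cond_exp M (sigma_of M X) V \<omega> = g (X \<omega>)"
    and gm: "g \<in> borel_measurable borel"
    using g by (auto simp: regression_fun_def)
  have fm: "(\<lambda>\<omega>. f (X \<omega>)) \<in> borel_measurable (sigma_of M X)"
    using f by (rule measurable_comp_sigma_of)
  note * = F.real_cond_exp_intg[OF int fm V]
  have m: "(\<lambda>\<omega>. f (X \<omega>) * g (X \<omega>)) \<in> borel_measurable M"
    using X f gm by measurable
  have m': "(\<lambda>\<omega>. f (X \<omega>) * real_cond_exp M (sigma_of M X) V \<omega>) \<in> borel_measurable M"
    using *(1) by auto
  show "integrable M (\<lambda>\<omega>. f (X \<omega>) * g (X \<omega>))"
    using ae by (intro integrable_cong_AE_imp[OF *(1) m]) auto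
  show "(\<integral>\<omega>. f (X \<omega>) * g (X \<omega>) \<partial>M) = (\<integral>\<omega>. f (X \<omega>) * V \<omega> \<partial>M)"
    unfolding *(2)[symmetric] using ae by (intro integral_cong_AE[OF m m']) auto
qed

lemma cond_indep_given_fst:
  fixes U1 U2 :: "'a \<Rightarrow> real" and V :: "'a \<Rightarrow> 'c::topological_space"
  assumes "cond_indep_given M X (\<lambda>\<omega>. (U1 \<omega>, U2 \<omega>)) V"
  shows "cond_indep_given M X U1 V"
  unfolding cond_indep_given_def
proof (intro ballI)
  fix A :: "real set" and B :: "'c set" assume A: "A \<in> sets borel" and B: "B \<in> sets borel"
  have "(fst :: real \<times> real \<Rightarrow> real) \<in> borel_measurable borel"
    by (intro borel_measurable_continuous_onI continuous_on_fst continuous_on_id)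
  then have "fst -` A \<inter> space (borel :: (real \<times> real) measure) \<in> sets borel"
    using A by (rule measurable_sets)
  then have "fst -` A \<in> sets (borel :: (real \<times> real) measure)" by simp
  from bspec[OF bspec[OF assms[unfolded cond_indep_given_def] this] B] show "AE \<omega> in M.
      real_cond_exp M (sigma_of M X) (\<lambda>\<omega>. of_bool (U1 \<omega> \<in> A \<and> V \<omega> \<in> B)) \<omega> =
      real_cond_exp M (sigma_of M X) (\<lambda>\<omega>. of_bool (U1 \<omega> \<in> A)) \<omega> *
      real_cond_exp M (sigma_of M X) (\<lambda>\<omega>. of_bool (V \<omega> \<in> B)) \<omega>"
    by simp
qed

lemma regression_fun_of_bool_bounds:
  assumes "regression_fun M X (\<lambda>\<omega>. of_bool (Q \<omega>)) p" and X: "X \<in> borel_measurable M"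
  shows "AE \<omega> in M. 0 \<le> p (X \<omega>) \<and> p (X \<omega>) \<le> 1"
proof -
  interpret F: sigma_finite_subalgebra M "sigma_of M X"
    using X by (rule sigma_finite_subalgebra_sigma_of)
  have int: "integrable M (\<lambda>\<omega>. of_bool (Q \<omega>) :: real)"
    and ae: "AE \<omega> in M. real_cond_exp M (sigma_of M X) (\<lambda>\<omega>. of_bool (Q \<omega>)) \<omega> = p (X \<omega>)"
    using assms(1) by (auto simp: regression_fun_def)
  have "AE \<omega> in M. real_cond_exp M (sigma_of M X) (\<lambda>\<omega>. of_bool (Q \<omega>)) \<omega> \<ge> 0"
    by (intro F.real_cond_exp_ge_c[OF int]) auto
  moreover have "AE \<omega> in M. real_cond_exp M (sigma_of M X) (\<lambda>\<omega>. of_bool (Q \<omega>)) \<omega> \<le> 1"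
    by (intro F.real_cond_exp_le_c[OF int]) auto
  ultimately show ?thesis using ae by eventually_elim auto
qed

text \<open>Conditional independence says that the measures with densities \<open>1(R = 1) g(X)\<close> and
  \<open>p(X) g(X)\<close> have the same image under \<open>U\<close>.\<close>

lemma cond_indep_given_integral:
  fixes U :: "'a \<Rightarrow> real" and R :: "'a \<Rightarrow> real"
  assumes ci: "cond_indep_given M X U R" and p: "regression_fun M X (\<lambda>\<omega>. of_bool (R \<omega> = 1)) p"
    and [measurable]: "X \<in> borel_measurable M" "U \<in> borel_measurable M" "R \<in> borel_measurable M"
    and g [measurable]: "g \<in> borel_measurable borel" and g0: "\<And>x. 0 \<le> g x" and gb: "\<And>x. g x \<le> b"
  shows "(\<integral>\<omega>. (of_bool (R \<omega> = 1) * g (X \<omega>)) * U \<omega> \<partial>M) = (\<integral>\<omega>. (p (X \<omega>) * g (X \<omega>)) * U \<omega> \<partial>M)"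
proof -
  interpret F: sigma_finite_subalgebra M "sigma_of M X"
    by (rule sigma_finite_subalgebra_sigma_of) fact
  let ?E = "real_cond_exp M (sigma_of M X)"
  have [measurable]: "p \<in> borel_measurable borel"
    using p by (simp add: regression_fun_def)
  have pp: "AE \<omega> in M. ?E (\<lambda>\<omega>. of_bool (R \<omega> = 1)) \<omega> = p (X \<omega>)"
    using p by (simp add: regression_fun_def)
  have pb: "AE \<omega> in M. 0 \<le> p (X \<omega>) \<and> p (X \<omega>) \<le> 1"
    using p by (rule regression_fun_of_bool_bounds) fact
  have b0: "0 \<le> b" using g0 gb order_trans by blast
  have tb: "t * g x \<le> b" if "0 \<le> t" "t \<le> 1" for t x
    using mult_mono[OF that(2) gb, of x] g0 by simp
  let ?nu = "\<lambda>d. distr (density M (\<lambda>\<omega>. ennreal (d \<omega> * g (X \<omega>)))) borel U"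
  have eq: "?nu (\<lambda>\<omega>. of_bool (R \<omega> = 1)) = ?nu (\<lambda>\<omega>. p (X \<omega>))"
  proof (rule measure_eqI)
    fix A assume "A \<in> sets (?nu (\<lambda>\<omega>. of_bool (R \<omega> = 1)))"
    then have A [measurable]: "A \<in> sets borel" by simp
    have em: "emeasure (?nu d) A = ennreal (\<integral>\<omega>. (d \<omega> * g (X \<omega>)) * of_bool (U \<omega> \<in> A) \<partial>M)"
      if [measurable]: "d \<in> borel_measurable M" and d: "AE \<omega> in M. 0 \<le> d \<omega> \<and> d \<omega> \<le> 1" for d
    proof -
      have "emeasure (?nu d) A = (\<integral>\<^sup>+\<omega>. ennreal (d \<omega> * g (X \<omega>)) * indicator (U -` A \<inter> space M) \<omega> \<partial>M)"
        by (simp add: emeasure_distr emeasure_density)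
      also have "\<dots> = (\<integral>\<^sup>+\<omega>. ennreal ((d \<omega> * g (X \<omega>)) * of_bool (U \<omega> \<in> A)) \<partial>M)"
        by (intro nn_integral_cong) (auto simp: indicator_def)
      also have "\<dots> = ennreal (\<integral>\<omega>. (d \<omega> * g (X \<omega>)) * of_bool (U \<omega> \<in> A) \<partial>M)"
      proof (rule nn_integral_eq_integral)
        have "AE \<omega> in M. norm ((d \<omega> * g (X \<omega>)) * of_bool (U \<omega> \<in> A)) \<le> b"
          using d by eventually_elim
            (use g0 b0 tb in \<open>auto simp: abs_mult\<close>)
        then show "integrable M (\<lambda>\<omega>. (d \<omega> * g (X \<omega>)) * of_bool (U \<omega> \<in> A))"
          by (intro integrable_const_bound) auto
        show "AE \<omega> in M. 0 \<le> (d \<omega> * g (X \<omega>)) * of_bool (U \<omega> \<in> A)"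
          using d by eventually_elim (use g0 in auto)
      qed
      finally show ?thesis .
    qed
    have gX: "(\<lambda>\<omega>. g (X \<omega>)) \<in> borel_measurable (sigma_of M X)"
      by (rule measurable_comp_sigma_of) fact
    have pgX: "(\<lambda>\<omega>. p (X \<omega>) * g (X \<omega>)) \<in> borel_measurable (sigma_of M X)"
      by (rule measurable_comp_sigma_of[where f="\<lambda>x. p x * g x"]) measurable
    have i1: "integrable M (\<lambda>\<omega>. g (X \<omega>) * of_bool (U \<omega> \<in> A \<and> R \<omega> \<in> {1}))"
      by (rule integrable_const_bound[where B=b]) (use g0 gb b0 in auto)
    have "AE \<omega> in M. norm ((p (X \<omega>) * g (X \<omega>)) * of_bool (U \<omega> \<in> A)) \<le> b"
      using pb by eventually_elim (use g0 b0 tb in \<open>auto simp: abs_mult\<close>)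
    then have i2: "integrable M (\<lambda>\<omega>. (p (X \<omega>) * g (X \<omega>)) * of_bool (U \<omega> \<in> A))"
      by (intro integrable_const_bound) auto
    have "(\<integral>\<omega>. (of_bool (R \<omega> = 1) * g (X \<omega>)) * of_bool (U \<omega> \<in> A) \<partial>M)
        = (\<integral>\<omega>. g (X \<omega>) * of_bool (U \<omega> \<in> A \<and> R \<omega> \<in> {1}) \<partial>M)"
      by (intro Bochner_Integration.integral_cong) auto
    \<comment> \<open>Condition on \<open>X\<close>, factor the conditional probability by
      independence, and absorb \<open>p(X)\<close> into the weight before the conditioning is
      undone.\<close>
    also have "\<dots> = (\<integral>\<omega>. g (X \<omega>) * ?E (\<lambda>\<omega>. of_bool (U \<omega> \<in> A \<and> R \<omega> \<in> {1})) \<omega> \<partial>M)"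
      by (rule F.real_cond_exp_intg(2)[OF i1 gX, symmetric]) measurable
    also have "\<dots> = (\<integral>\<omega>. (p (X \<omega>) * g (X \<omega>)) * ?E (\<lambda>\<omega>. of_bool (U \<omega> \<in> A)) \<omega> \<partial>M)"
    proof (rule integral_cong_AE)
      have "AE \<omega> in M. ?E (\<lambda>\<omega>. of_bool (U \<omega> \<in> A \<and> R \<omega> \<in> {1})) \<omega> =
          ?E (\<lambda>\<omega>. of_bool (U \<omega> \<in> A)) \<omega> * ?E (\<lambda>\<omega>. of_bool (R \<omega> \<in> {1})) \<omega>"
        by (rule ci[unfolded cond_indep_given_def, THEN bspec, THEN bspec]) (use A in auto)
      with pp show "AE \<omega> in M. g (X \<omega>) * ?E (\<lambda>\<omega>. of_bool (U \<omega> \<in> A \<and> R \<omega> \<in> {1})) \<omega> =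
          (p (X \<omega>) * g (X \<omega>)) * ?E (\<lambda>\<omega>. of_bool (U \<omega> \<in> A)) \<omega>"
        by eventually_elim (simp add: mult_ac)
    qed measurable
    also have "\<dots> = (\<integral>\<omega>. (p (X \<omega>) * g (X \<omega>)) * of_bool (U \<omega> \<in> A) \<partial>M)"
      by (rule F.real_cond_exp_intg(2)[OF i2 pgX]) measurable
    finally have I: "(\<integral>\<omega>. (of_bool (R \<omega> = 1) * g (X \<omega>)) * of_bool (U \<omega> \<in> A) \<partial>M)
        = (\<integral>\<omega>. (p (X \<omega>) * g (X \<omega>)) * of_bool (U \<omega> \<in> A) \<partial>M)" .
    show "emeasure (?nu (\<lambda>\<omega>. of_bool (R \<omega> = 1))) A = emeasure (?nu (\<lambda>\<omega>. p (X \<omega>))) A"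
      by (subst (1 2) em) (use pb I in auto)
  qed simp
  \<comment> \<open>Equal image measures have equal integrals of the identity, default values
    included, so the argument makes no use of integrability of \<open>U\<close>.\<close>
  have int: "(\<integral>u. u \<partial>?nu d) = (\<integral>\<omega>. (d \<omega> * g (X \<omega>)) * U \<omega> \<partial>M)"
    if [measurable]: "d \<in> borel_measurable M" and d: "AE \<omega> in M. 0 \<le> d \<omega> \<and> d \<omega> \<le> 1" for d
  proof -
    have "(\<integral>u. u \<partial>?nu d) = (\<integral>\<omega>. U \<omega> \<partial>density M (\<lambda>\<omega>. ennreal (d \<omega> * g (X \<omega>))))"
      by (rule integral_distr) auto
    also have "\<dots> = (\<integral>\<omega>. (d \<omega> * g (X \<omega>)) *\<^sub>R U \<omega> \<partial>M)"
      by (rule integral_density) (use d g0 in auto)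
    finally show ?thesis by simp
  qed
  show ?thesis
    using eq int[of "\<lambda>\<omega>. of_bool (R \<omega> = 1)"] int[of "\<lambda>\<omega>. p (X \<omega>)"] pb by auto
qed

end

section \<open>Moments of functions of a training sample and a test point\<close>

abbreviation iid :: "'i set \<Rightarrow> 'a measure \<Rightarrow> ('i \<Rightarrow> 'a) measure" where
  "iid L Q \<equiv> PiM L (\<lambda>_. Q)"

lemma measurable_train_test:
  assumes "J \<subseteq> L" "i \<in> L"
  shows "(\<lambda>z. (restrict z J, z i)) \<in> measurable (iid L Q) (iid J Q \<Otimes>\<^sub>M Q)"
  using assms by (intro measurable_Pair measurable_restrict_subset measurable_component_singleton)

text \<open>Coordinates outside \<open>insert i J\<close> are integrated out by
  \<open>distr_restrict\<close>, and inserting \<open>i\<close> into \<open>J\<close> splits what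
  remains into a product. This independence of training part and test point stands in for
  conditioning on the training sample throughout.\<close>

lemma distr_train_test:
  fixes Q :: "'b measure" and L :: "'a set"
  assumes Q: "prob_space Q" and L: "finite L" "J \<subseteq> L" "i \<in> L" "i \<notin> J"
  shows "distr (iid L Q) (iid J Q \<Otimes>\<^sub>M Q) (\<lambda>z. (restrict z J, z i))
    = iid J Q \<Otimes>\<^sub>M Q"
proof (rule measure_eqI)
  interpret Q: prob_space Q by fact
  interpret product_prob_space "\<lambda>_. Q"
    by (intro product_prob_spaceI Q)
  have J: "finite J" using L finite_subset by auto
  fix A assume "A \<in> sets (distr (iid L Q) (iid J Q \<Otimes>\<^sub>M Q) (\<lambda>z. (restrict z J, z i)))"
  then have A [measurable]: "A \<in> sets (iid J Q \<Otimes>\<^sub>M Q)" by simp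
  let ?g = "\<lambda>z. indicator A (restrict z J, z i) :: ennreal"
  have sub: "insert i J \<subseteq> L" using L by auto
  have m1: "(\<lambda>z. (restrict z J, z i)) \<in> measurable (iid L Q) (iid J Q \<Otimes>\<^sub>M Q)"
    using L by (intro measurable_train_test)
  have m2: "(\<lambda>z. (restrict z J, z i)) \<in> measurable (iid (insert i J) Q) (iid J Q \<Otimes>\<^sub>M Q)"
    by (intro measurable_train_test) auto
  have g2: "?g \<in> borel_measurable (iid (insert i J) Q)"
    using measurable_compose[OF m2 borel_measurable_indicator[OF A]] .
  have g1: "?g \<in> borel_measurable (iid L Q)"
    using measurable_compose[OF m1 borel_measurable_indicator[OF A]] .
  have "emeasure (distr (iid L Q) (iid J Q \<Otimes>\<^sub>M Q) (\<lambda>z. (restrict z J, z i))) A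
      = (\<integral>\<^sup>+ z. indicator A z \<partial>distr (iid L Q) (iid J Q \<Otimes>\<^sub>M Q) (\<lambda>z. (restrict z J, z i)))"
    by simp
  also have "\<dots> = (\<integral>\<^sup>+ z. ?g z \<partial>iid L Q)"
    by (rule nn_integral_distr[OF m1]) measurable
  also have "\<dots> = (\<integral>\<^sup>+ z. ?g (restrict z (insert i J)) \<partial>iid L Q)"
  proof (rule nn_integral_cong)
    fix z :: "'a \<Rightarrow> 'b"
    have "restrict (restrict z (insert i J)) J = restrict z J" by (auto simp: restrict_def)
    then show "?g z = ?g (restrict z (insert i J))" by simp
  qed
  also have "\<dots> = (\<integral>\<^sup>+ z. ?g z \<partial>distr (iid L Q) (iid (insert i J) Q) (\<lambda>z. restrict z (insert i J)))"
    by (rule nn_integral_distr[symmetric, OF measurable_restrict_subset[OF sub]]) (use g2 in simp)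
  also have "\<dots> = (\<integral>\<^sup>+ z. ?g z \<partial>iid (insert i J) Q)"
    unfolding distr_restrict[OF sub L(1), symmetric] ..
  also have "\<dots> = (\<integral>\<^sup>+ x. \<integral>\<^sup>+ y. ?g (x(i := y)) \<partial>Q \<partial>iid J Q)"
    by (rule product_nn_integral_insert[OF J L(4) g2])
  also have "\<dots> = (\<integral>\<^sup>+ x. \<integral>\<^sup>+ y. indicator A (x, y) \<partial>Q \<partial>iid J Q)"
  proof (intro nn_integral_cong)
    fix x y assume "x \<in> space (iid J Q)"
    then have "restrict (x(i := y)) J = x"
      using L(4) by (auto simp: space_PiM PiE_def extensional_def restrict_def fun_eq_iff)
    then show "?g (x(i := y)) = indicator A (x, y)" by simp
  qed
  also have "\<dots> = emeasure (iid J Q \<Otimes>\<^sub>M Q) A"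
    by (rule Q.emeasure_pair_measure[OF A, symmetric])
  finally show "emeasure (distr (iid L Q) (iid J Q \<Otimes>\<^sub>M Q) (\<lambda>z. (restrict z J, z i))) A
      = emeasure (iid J Q \<Otimes>\<^sub>M Q) A" .
qed simp

lemma nn_integral_train_test:
  assumes Q: "prob_space Q" and L: "finite L" "J \<subseteq> L" "i \<in> L" "i \<notin> J"
    and F: "F \<in> borel_measurable (iid J Q \<Otimes>\<^sub>M Q)"
  shows "(\<integral>\<^sup>+ z. F (restrict z J, z i) \<partial>iid L Q) = (\<integral>\<^sup>+ t. \<integral>\<^sup>+ y. F (t, y) \<partial>Q \<partial>iid J Q)"
proof -
  interpret Q: prob_space Q by fact
  have "(\<integral>\<^sup>+ z. F (restrict z J, z i) \<partial>iid L Q) = (\<integral>\<^sup>+ z. F z \<partial>(iid J Q \<Otimes>\<^sub>M Q))"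
    by (subst distr_train_test[OF Q L, symmetric])
       (rule nn_integral_distr[symmetric, OF measurable_train_test], use L F in auto)
  then show ?thesis
    using Q.nn_integral_fst[OF F] by simp
qed

lemma nn_integral_train_test_le:
  assumes Q: "prob_space Q" and L: "finite L" "J \<subseteq> L" "i \<in> L" "i \<notin> J"
    and F: "F \<in> borel_measurable (iid J Q \<Otimes>\<^sub>M Q)"
    and b: "\<And>t. t \<in> space (iid J Q) \<Longrightarrow> (\<integral>\<^sup>+ y. F (t, y) \<partial>Q) \<le> b"
  shows "(\<integral>\<^sup>+ z. F (restrict z J, z i) \<partial>iid L Q) \<le> b"
proof -
  interpret PJ: prob_space "iid J Q"
    by (rule prob_space_PiM, rule Q)
  have "(\<integral>\<^sup>+ t. \<integral>\<^sup>+ y. F (t, y) \<partial>Q \<partial>iid J Q) \<le> (\<integral>\<^sup>+ t. b \<partial>iid J Q)"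
    by (intro nn_integral_mono b)
  then show ?thesis
    using nn_integral_train_test[OF Q L F] by (simp add: PJ.emeasure_space_1)
qed

lemma integral_train_test:
  fixes F :: "_ \<Rightarrow> real"
  assumes Q: "prob_space Q" and L: "finite L" "J \<subseteq> L" "i \<in> L" "i \<notin> J"
    and F: "F \<in> borel_measurable (iid J Q \<Otimes>\<^sub>M Q)"
    and int: "integrable (iid L Q) (\<lambda>z. F (restrict z J, z i))"
  shows "(\<integral> z. F (restrict z J, z i) \<partial>iid L Q) = (\<integral> t. \<integral> y. F (t, y) \<partial>Q \<partial>iid J Q)"
proof -
  interpret Q: prob_space Q by fact
  interpret PJ: prob_space "iid J Q"
    by (rule prob_space_PiM, rule Q)
  interpret pair_sigma_finite "iid J Q" Q ..
  have m: "(\<lambda>z. (restrict z J, z i)) \<in> measurable (iid L Q) (iid J Q \<Otimes>\<^sub>M Q)"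
    using L by (intro measurable_train_test)
  have "integrable (distr (iid L Q) (iid J Q \<Otimes>\<^sub>M Q) (\<lambda>z. (restrict z J, z i))) F"
    using integrable_distr_eq[OF m F] int by simp
  then have "integrable (iid J Q \<Otimes>\<^sub>M Q) F"
    unfolding distr_train_test[OF Q L] .
  moreover have "(\<integral> z. F (restrict z J, z i) \<partial>iid L Q) = (\<integral> z. F z \<partial>(iid J Q \<Otimes>\<^sub>M Q))"
    by (subst distr_train_test[OF Q L, symmetric]) (rule integral_distr[symmetric, OF m F])
  ultimately show ?thesis
    using integral_fst'[of F] by simp
qed

text \<open>Given the training part, the summands are uncorrelated, so only the diagonal of the squared
  sum survives.\<close>

lemma second_moment_train_test:
  fixes Q :: "'b measure" and L :: "'a set" and h :: "_ \<Rightarrow> real"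
  assumes Q: "prob_space Q" and L: "finite L" "J \<subseteq> L" "A \<subseteq> L" "A \<inter> J = {}"
    and h: "h \<in> borel_measurable (iid J Q \<Otimes>\<^sub>M Q)"
    and mean: "\<And>t. t \<in> space (iid J Q) \<Longrightarrow> (\<integral> y. h (t, y) \<partial>Q) = 0"
    and v: "\<And>t. t \<in> space (iid J Q) \<Longrightarrow> (\<integral>\<^sup>+ y. ennreal ((h (t, y))\<^sup>2) \<partial>Q) \<le> ennreal v"
    and "0 \<le> v"
  shows "integrable (iid L Q) (\<lambda>z. (\<Sum>i\<in>A. h (restrict z J, z i))\<^sup>2)"
    and "(\<integral> z. (\<Sum>i\<in>A. h (restrict z J, z i))\<^sup>2 \<partial>iid L Q) \<le> real (card A) * v"
proof -
  let ?P = "iid L Q"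
  let ?a = "\<lambda>i z. h (restrict z J, z i)"
  have am [measurable]: "?a i \<in> borel_measurable ?P" if "i \<in> A" for i
    using measurable_compose[OF measurable_train_test h] that L by blast
  have a2: "(\<integral>\<^sup>+ z. ennreal ((?a i z)\<^sup>2) \<partial>?P) \<le> ennreal v" if "i \<in> A" for i
    by (rule nn_integral_train_test_le[OF Q L(1,2), where F="\<lambda>x. ennreal ((h x)\<^sup>2)"])
       (use that L h v in auto)
  have int2: "integrable ?P (\<lambda>z. (?a i z)\<^sup>2)" if "i \<in> A" for i
    using am[OF that] a2[OF that] by (intro integrableI_bounded) (auto simp: le_less_trans)
  have le: "(\<integral> z. (?a i z)\<^sup>2 \<partial>?P) \<le> v" if "i \<in> A" for i
  proof -
    have "ennreal (\<integral> z. (?a i z)\<^sup>2 \<partial>?P) \<le> ennreal v"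
      using a2[OF that] nn_integral_eq_integral[OF int2[OF that]] by simp
    then show ?thesis using \<open>0 \<le> v\<close> by simp
  qed
  have intp: "integrable ?P (\<lambda>z. ?a i z * ?a j z)" if "i \<in> A" "j \<in> A" for i j
  proof (rule Bochner_Integration.integrable_bound)
    show "integrable ?P (\<lambda>z. (?a i z)\<^sup>2 + (?a j z)\<^sup>2)"
      using int2 that by auto
    show "(\<lambda>z. ?a i z * ?a j z) \<in> borel_measurable ?P"
      using am that by (intro borel_measurable_times)
    have "\<bar>x * y\<bar> \<le> x\<^sup>2 + y\<^sup>2" for x y :: real
    proof -
      have "0 \<le> (\<bar>x\<bar> - \<bar>y\<bar>)\<^sup>2" by simp
      then have "2 * \<bar>x * y\<bar> \<le> x\<^sup>2 + y\<^sup>2" by (simp add: power2_diff abs_mult)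
      then show ?thesis using abs_ge_zero[of "x * y"] by linarith
    qed
    then show "AE z in ?P. norm (?a i z * ?a j z) \<le> norm ((?a i z)\<^sup>2 + (?a j z)\<^sup>2)" by simp
  qed
  have off: "(\<integral> z. ?a i z * ?a j z \<partial>?P) = 0" if ij: "i \<in> A" "j \<in> A" "i \<noteq> j" for i j
  proof -
    \<comment> \<open>Count \<open>i\<close> as part of an enlarged training sample: given it, the
      factor at \<open>i\<close> is constant and the centred factor at \<open>j\<close> integrates
      to 0.\<close>
    let ?J = "insert i J"
    let ?F = "\<lambda>(t, y). h (restrict t J, t i) * h (restrict t J, y)"
    have r: "restrict (restrict z ?J) J = restrict z J" for z :: "'a \<Rightarrow> 'b"
      by (auto simp: restrict_def)
    have m1: "(\<lambda>(t, y). (restrict t J, t i)) \<in> measurable (iid ?J Q \<Otimes>\<^sub>M Q) (iid J Q \<Otimes>\<^sub>M Q)"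
      unfolding split_beta' by (intro measurable_compose[OF measurable_fst measurable_train_test]) auto
    have m2: "(\<lambda>(t, y). (restrict t J, y)) \<in> measurable (iid ?J Q \<Otimes>\<^sub>M Q) (iid J Q \<Otimes>\<^sub>M Q)"
      unfolding split_beta'
      by (intro measurable_Pair measurable_compose[OF measurable_fst measurable_restrict_subset]) auto
    have F: "?F \<in> borel_measurable (iid ?J Q \<Otimes>\<^sub>M Q)"
      using borel_measurable_times[OF measurable_compose[OF m1 h] measurable_compose[OF m2 h]]
      by (simp add: split_beta')
    have "(\<integral> z. ?a i z * ?a j z \<partial>?P) = (\<integral> z. ?F (restrict z ?J, z j) \<partial>?P)"
      using r by simp
    also have "\<dots> = (\<integral> t. \<integral> y. ?F (t, y) \<partial>Q \<partial>iid ?J Q)"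
      by (rule integral_train_test[OF Q L(1) _ _ _ F]) (use ij L r intp in auto)
    also have "\<dots> = (\<integral> t. 0 \<partial>iid ?J Q)"
    proof (rule Bochner_Integration.integral_cong)
      fix t assume "t \<in> space (iid ?J Q)"
      then have "restrict t J \<in> space (iid J Q)"
        by (auto simp: space_PiM)
      then show "(\<integral> y. ?F (t, y) \<partial>Q) = 0"
        using mean by simp
    qed simp
    finally show ?thesis by simp
  qed
  have sq: "(\<Sum>i\<in>A. ?a i z)\<^sup>2 = (\<Sum>i\<in>A. \<Sum>j\<in>A. ?a i z * ?a j z)" for z
    by (simp add: power2_eq_square sum_product)
  show "integrable ?P (\<lambda>z. (\<Sum>i\<in>A. ?a i z)\<^sup>2)"
    unfolding sq using intp by (intro Bochner_Integration.integrable_sum)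
  have "(\<integral> z. (\<Sum>i\<in>A. ?a i z)\<^sup>2 \<partial>?P) = (\<Sum>i\<in>A. \<Sum>j\<in>A. \<integral> z. ?a i z * ?a j z \<partial>?P)"
    unfolding sq using intp
    by (subst Bochner_Integration.integral_sum, intro Bochner_Integration.integrable_sum, simp)
       (intro sum.cong refl Bochner_Integration.integral_sum, simp)
  also have "\<dots> \<le> (\<Sum>i\<in>A. v)"
  proof (rule sum_mono)
    fix i assume i: "i \<in> A"
    have fin: "finite A" using L(3,1) by (rule finite_subset)
    have "(\<Sum>j\<in>A. \<integral> z. ?a i z * ?a j z \<partial>?P) = (\<Sum>j\<in>A. if j = i then \<integral> z. (?a i z)\<^sup>2 \<partial>?P else 0)"
      using off i by (intro sum.cong) (auto simp: power2_eq_square)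
    then show "(\<Sum>j\<in>A. \<integral> z. ?a i z * ?a j z \<partial>?P) \<le> v"
      using le[OF i] i fin by simp
  qed
  finally show "(\<integral> z. (\<Sum>i\<in>A. ?a i z)\<^sup>2 \<partial>?P) \<le> real (card A) * v" by simp
qed

section \<open>Cross-fitted means over random folds\<close>

text \<open>Restricting \<open>M\<close> to an event of \<open>V\<close> only rescales the law of
  \<open>U\<close>. Comparing these two measures extends independence from sets to all nonnegative
  functions at once.\<close>

lemma nn_integral_indicator_mult_indep:
  assumes M: "prob_space M" and ind: "indep_elements M MU U MV V"
    and A: "A \<in> sets MV" and G [measurable]: "G \<in> borel_measurable MU"
  shows "(\<integral>\<^sup>+ \<omega>. indicator (V -` A \<inter> space M) \<omega> * G (U \<omega>) \<partial>M)
    = emeasure M (V -` A \<inter> space M) * (\<integral>\<^sup>+ u. G u \<partial>distr M MU U)"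
proof -
  interpret prob_space M by fact
  have U [measurable]: "U \<in> measurable M MU" and V [measurable]: "V \<in> measurable M MV"
    and iset: "indep_set (sets (vimage_algebra (space M) U MU)) (sets (vimage_algebra (space M) V MV))"
    using ind by (auto simp: indep_elements_def)
  let ?B = "V -` A \<inter> space M"
  have B [measurable]: "?B \<in> sets M" using V A by (rule measurable_sets)
  have "distr (density M (indicator ?B)) MU U = scale_measure (emeasure M ?B) (distr M MU U)"
  proof (rule measure_eqI)
    fix C assume "C \<in> sets (distr (density M (indicator ?B)) MU U)"
    then have C [measurable]: "C \<in> sets MU" by simp
    let ?C = "U -` C \<inter> space M"
    have [measurable]: "?C \<in> sets M" using U C by (rule measurable_sets)
    have "emeasure (distr (density M (indicator ?B)) MU U) C = (\<integral>\<^sup>+ \<omega>. indicator ?B \<omega> * indicator ?C \<omega> \<partial>M)"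
      by (simp add: emeasure_distr emeasure_density)
    also have "\<dots> = (\<integral>\<^sup>+ \<omega>. indicator (?C \<inter> ?B) \<omega> \<partial>M)"
      by (intro nn_integral_cong) (auto simp: indicator_def)
    also have "\<dots> = emeasure M (?C \<inter> ?B)"
      by (rule nn_integral_indicator) measurable
    also have "\<dots> = emeasure M ?C * emeasure M ?B"
      using indep_setD[OF iset in_vimage_algebra[OF C] in_vimage_algebra[OF A]]
      by (simp add: emeasure_eq_measure ennreal_mult)
    also have "\<dots> = emeasure (scale_measure (emeasure M ?B) (distr M MU U)) C"
      by (simp add: emeasure_distr mult.commute)
    finally show "emeasure (distr (density M (indicator ?B)) MU U) C
        = emeasure (scale_measure (emeasure M ?B) (distr M MU U)) C" .
  qed simp
  moreover have "(\<integral>\<^sup>+ \<omega>. indicator ?B \<omega> * G (U \<omega>) \<partial>M)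
      = (\<integral>\<^sup>+ u. G u \<partial>distr (density M (indicator ?B)) MU U)"
    by (subst nn_integral_distr) (auto simp: nn_integral_density)
  ultimately show ?thesis
    by (simp add: nn_integral_scale_measure)
qed

text \<open>Splitting over the values of \<open>V\<close> makes the integral a combination of the
  integrals for fixed \<open>v\<close>, with weights of total mass at most 1. It will carry bounds
  for fixed folds over to random folds.\<close>

lemma nn_integral_indep_finite_le:
  assumes M: "prob_space M" and ind: "indep_elements M MU U (count_space UNIV) V"
    and fin: "finite (V ` space M)"
    and G: "\<And>v. v \<in> V ` space M \<Longrightarrow> G v \<in> borel_measurable MU"
    and b: "\<And>v. v \<in> V ` space M \<Longrightarrow> (\<integral>\<^sup>+ u. G v u \<partial>distr M MU U) \<le> b"
  shows "(\<lambda>\<omega>. G (V \<omega>) (U \<omega>)) \<in> borel_measurable M"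
    and "(\<integral>\<^sup>+ \<omega>. G (V \<omega>) (U \<omega>) \<partial>M) \<le> b"
proof -
  interpret prob_space M by fact
  have U [measurable]: "U \<in> measurable M MU" and V [measurable]: "V \<in> measurable M (count_space UNIV)"
    using ind by (auto simp: indep_elements_def)
  let ?F = "V ` space M" and ?B = "\<lambda>v. V -` {v} \<inter> space M"
  have B: "?B v \<in> sets M" for v using V by (rule measurable_sets) simp
  have eq: "G (V \<omega>) (U \<omega>) = (\<Sum>v\<in>?F. indicator (?B v) \<omega> * G v (U \<omega>))" if "\<omega> \<in> space M" for \<omega>
  proof -
    have "(\<Sum>v\<in>?F. indicator (?B v) \<omega> * G v (U \<omega>)) = (\<Sum>v\<in>?F. if v = V \<omega> then G v (U \<omega>) else 0)"
      using that by (intro sum.cong) (auto simp: indicator_def)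
    then show ?thesis using fin that by simp
  qed
  have m: "(\<lambda>\<omega>. indicator (?B v) \<omega> * G v (U \<omega>)) \<in> borel_measurable M" if "v \<in> ?F" for v
    by (intro borel_measurable_times_ennreal borel_measurable_indicator B measurable_compose[OF U G[OF that]])
  then have "(\<lambda>\<omega>. \<Sum>v\<in>?F. indicator (?B v) \<omega> * G v (U \<omega>)) \<in> borel_measurable M"
    by (rule borel_measurable_sum)
  then show "(\<lambda>\<omega>. G (V \<omega>) (U \<omega>)) \<in> borel_measurable M"
    by (rule measurable_cong[THEN iffD2, rotated]) (rule eq)
  have "(\<integral>\<^sup>+ \<omega>. G (V \<omega>) (U \<omega>) \<partial>M) = (\<integral>\<^sup>+ \<omega>. (\<Sum>v\<in>?F. indicator (?B v) \<omega> * G v (U \<omega>)) \<partial>M)"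
    by (rule nn_integral_cong) (rule eq)
  also have "\<dots> = (\<Sum>v\<in>?F. \<integral>\<^sup>+ \<omega>. indicator (?B v) \<omega> * G v (U \<omega>) \<partial>M)"
    using m by (rule nn_integral_sum)
  also have "\<dots> = (\<Sum>v\<in>?F. emeasure M (?B v) * (\<integral>\<^sup>+ u. G v u \<partial>distr M MU U))"
    by (intro sum.cong refl nn_integral_indicator_mult_indep[OF M ind] G) auto
  also have "\<dots> \<le> (\<Sum>v\<in>?F. emeasure M (?B v) * b)"
    using b by (intro sum_mono mult_left_mono) auto
  also have "\<dots> = (\<Sum>v\<in>?F. emeasure M (?B v)) * b"
    by (rule sum_distrib_right[symmetric])
  also have "(\<Sum>v\<in>?F. emeasure M (?B v)) = emeasure M (\<Union>v\<in>?F. ?B v)"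
    using B fin by (intro sum_emeasure) (auto simp: disjoint_family_on_def)
  also have "\<dots> \<le> 1" by (rule measure_le_1)
  finally show "(\<integral>\<^sup>+ \<omega>. G (V \<omega>) (U \<omega>) \<partial>M) \<le> b"
    by (simp add: mult_right_mono)
qed

text \<open>Jensen's inequality, read off from nonnegativity of the variance of the absolute value
  of \<open>f\<close>.\<close>

lemma (in prob_space) nn_integral_abs_le_sqrt:
  assumes "integrable M (\<lambda>x. (f x)\<^sup>2)" and f: "f \<in> borel_measurable M"
    and "(\<integral> x. (f x)\<^sup>2 \<partial>M) \<le> v"
  shows "(\<integral>\<^sup>+ x. ennreal \<bar>f x :: real\<bar> \<partial>M) \<le> ennreal (sqrt v)"
proof -
  have i: "integrable M f"
    using f assms(1) by (rule square_integrable_imp_integrable)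
  have "0 \<le> variance (\<lambda>x. \<bar>f x\<bar>)" by (rule variance_positive)
  also have "\<dots> = expectation (\<lambda>x. \<bar>f x\<bar>\<^sup>2) - (expectation (\<lambda>x. \<bar>f x\<bar>))\<^sup>2"
    using i assms(1) by (intro variance_eq) auto
  finally have "(expectation (\<lambda>x. \<bar>f x\<bar>))\<^sup>2 \<le> v" using assms(3) by simp
  then have "expectation (\<lambda>x. \<bar>f x\<bar>) \<le> sqrt v" by (rule real_le_rsqrt)
  moreover have "(\<integral>\<^sup>+ x. ennreal \<bar>f x\<bar> \<partial>M) = ennreal (expectation (\<lambda>x. \<bar>f x\<bar>))"
    using i by (intro nn_integral_eq_integral) auto
  ultimately show ?thesis by (simp add: ennreal_leI)
qed

text \<open>The summand \<open>h\<close> receives the training index set as well as the training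
  data, because a learner may depend on both. One operator thus covers the estimator, all its error
  terms and, for \<open>h\<close> ignoring the training part, the plain sample mean.\<close>

definition crossfit_mean ::
  "nat \<Rightarrow> nat \<Rightarrow> (nat \<Rightarrow> nat set) \<Rightarrow> (nat \<Rightarrow> 'z) \<Rightarrow> (nat set \<Rightarrow> (nat \<Rightarrow> 'z) \<Rightarrow> 'z \<Rightarrow> real) \<Rightarrow> real" where
  "crossfit_mean N K I z h = (1 / real N) * (\<Sum>i=1..N.
     h ({1..N} - I (fold_index K I i)) (restrict z ({1..N} - I (fold_index K I i))) (z i))"

lemma fold_index_eq:
  assumes "folds K N I" "k \<in> {1..K}" "i \<in> I k"
  shows "fold_index K I i = k"
  unfolding fold_index_def
proof (rule the_equality)
  fix k' assume k': "k' \<in> {1..K} \<and> i \<in> I k'"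
  show "k' = k"
  proof (rule ccontr)
    assume "k' \<noteq> k"
    then have "I k' \<inter> I k = {}"
      using assms(1,2) k' by (auto simp: folds_def dest: disjoint_family_onD)
    then show False using assms(3) k' by auto
  qed
qed (use assms in auto)

lemma fold_index:
  assumes "folds K N I" "i \<in> {1..N}"
  shows "fold_index K I i \<in> {1..K}" and "i \<in> I (fold_index K I i)"
proof -
  have "i \<in> (\<Union>k\<in>{1..K}. I k)" using assms by (simp add: folds_def)
  then obtain k where k: "k \<in> {1..K}" "i \<in> I k" by blast
  with fold_index_eq[OF assms(1) k] show "fold_index K I i \<in> {1..K}" "i \<in> I (fold_index K I i)"
    by auto
qed

lemma folds_subset: "folds K N I \<Longrightarrow> k \<in> {1..K} \<Longrightarrow> I k \<subseteq> {1..N}"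
  unfolding folds_def by blast

lemma folds_restrict: "folds K N I \<Longrightarrow> folds K N (restrict I {1..K})"
  by (simp add: folds_def disjoint_family_on_def)

text \<open>Independence is assumed for the restricted sample and the restricted fold map, so the
  mean has to be recognised as a function of these two.\<close>

lemma crossfit_mean_restrict:
  assumes I: "folds K N I"
  shows "crossfit_mean N K (restrict I {1..K}) (restrict z {1..N}) h = crossfit_mean N K I z h"
  unfolding crossfit_mean_def
proof (intro arg_cong2[where f="(*)"] refl sum.cong)
  fix i assume i: "i \<in> {1..N}"
  note k = fold_index[OF I i]
  have *: "fold_index K (restrict I {1..K}) i = fold_index K I i"
    by (rule fold_index_eq[OF folds_restrict[OF I]]) (use k in auto)
  have "restrict (restrict z {1..N}) ({1..N} - A) = restrict z ({1..N} - A)" for A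
    by (auto simp: restrict_def)
  then show "h ({1..N} - restrict I {1..K} (fold_index K (restrict I {1..K}) i))
     (restrict (restrict z {1..N}) ({1..N} - restrict I {1..K} (fold_index K (restrict I {1..K}) i)))
     (restrict z {1..N} i) =
    h ({1..N} - I (fold_index K I i)) (restrict z ({1..N} - I (fold_index K I i))) (z i)"
    using i k unfolding * by simp
qed

text \<open>All summands of one fold share one training set that is disjoint from the fold, which is
  the situation of \<open>second_moment_train_test\<close>.\<close>

lemma crossfit_mean_folds:
  assumes I: "folds K N I"
  shows "crossfit_mean N K I z h
    = (\<Sum>k=1..K. (1 / real N) * (\<Sum>i\<in>I k. h ({1..N} - I k) (restrict z ({1..N} - I k)) (z i)))"
proof -
  have U: "(\<Union>k\<in>{1..K}. I k) = {1..N}" using I by (simp add: folds_def)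
  have fin: "finite (I k)" if "k \<in> {1..K}" for k
    using folds_subset[OF I that] by (rule finite_subset) simp
  let ?f = "\<lambda>i. h ({1..N} - I (fold_index K I i)) (restrict z ({1..N} - I (fold_index K I i))) (z i)"
  have "(\<Sum>i=1..N. ?f i) = (\<Sum>k=1..K. \<Sum>i\<in>I k. ?f i)"
    unfolding U[symmetric]
    by (rule sum.UNION_disjoint)
       (use fin I in \<open>auto simp: folds_def disjoint_family_on_def\<close>)
  also have "\<dots> = (\<Sum>k=1..K. \<Sum>i\<in>I k. h ({1..N} - I k) (restrict z ({1..N} - I k)) (z i))"
    using fold_index_eq[OF I] by (intro sum.cong) auto
  finally show ?thesis unfolding crossfit_mean_def by (simp add: sum_distrib_left)
qed

lemma crossfit_mean_measurable:
  assumes I: "folds K N I"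
    and h: "\<And>J. J \<subseteq> {1..N} \<Longrightarrow> (\<lambda>(t, y). h J t y) \<in> borel_measurable (iid J Q \<Otimes>\<^sub>M Q)"
  shows "(\<lambda>z. crossfit_mean N K I z h) \<in> borel_measurable (iid {1..N} Q)"
  unfolding crossfit_mean_def
proof (intro borel_measurable_times borel_measurable_const borel_measurable_sum)
  fix i assume i: "i \<in> {1..N}"
  let ?J = "{1..N} - I (fold_index K I i)"
  have "(\<lambda>z. (\<lambda>(t, y). h ?J t y) (restrict z ?J, z i)) \<in> borel_measurable (iid {1..N} Q)"
    by (rule measurable_compose[OF measurable_train_test h]) (use i in auto)
  then show "(\<lambda>z. h ?J (restrict z ?J) (z i)) \<in> borel_measurable (iid {1..N} Q)"
    by simp
qed

lemma crossfit_mean_first_moment: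
  assumes Q: "prob_space Q" and I: "folds K N I"
    and h: "\<And>J. J \<subseteq> {1..N} \<Longrightarrow> (\<lambda>(t, y). h J t y) \<in> borel_measurable (iid J Q \<Otimes>\<^sub>M Q)"
    and b: "\<And>J t. J \<subseteq> {1..N} \<Longrightarrow> t \<in> space (iid J Q) \<Longrightarrow> (\<integral>\<^sup>+ y. ennreal \<bar>h J t y\<bar> \<partial>Q) \<le> b"
  shows "(\<integral>\<^sup>+ z. ennreal \<bar>crossfit_mean N K I z h\<bar> \<partial>iid {1..N} Q) \<le> b"
proof -
  let ?J = "\<lambda>i. {1..N} - I (fold_index K I i)"
  let ?g = "\<lambda>i z. h (?J i) (restrict z (?J i)) (z i)"
  have m: "?g i \<in> borel_measurable (iid {1..N} Q)" if i: "i \<in> {1..N}" for i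
  proof -
    have "(\<lambda>z. (\<lambda>(t, y). h (?J i) t y) (restrict z (?J i), z i)) \<in> borel_measurable (iid {1..N} Q)"
      by (rule measurable_compose[OF measurable_train_test h]) (use i in auto)
    then show ?thesis by simp
  qed
  have le: "(\<integral>\<^sup>+ z. ennreal \<bar>?g i z\<bar> \<partial>iid {1..N} Q) \<le> b" if i: "i \<in> {1..N}" for i
  proof -
    have h': "(\<lambda>x. ennreal \<bar>case x of (t, y) \<Rightarrow> h (?J i) t y\<bar>) \<in> borel_measurable (iid (?J i) Q \<Otimes>\<^sub>M Q)"
      using h[of "?J i"] by measurable
    show ?thesis
      using nn_integral_train_test_le[OF Q _ _ i _ h', of b] b[of "?J i"] fold_index[OF I i] by simp
  qed
  have "(\<integral>\<^sup>+ z. ennreal \<bar>crossfit_mean N K I z h\<bar> \<partial>iid {1..N} Q)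
      \<le> (\<integral>\<^sup>+ z. (\<Sum>i=1..N. ennreal (1 / real N) * ennreal \<bar>?g i z\<bar>) \<partial>iid {1..N} Q)"
  proof (rule nn_integral_mono)
    fix z
    have "\<bar>crossfit_mean N K I z h\<bar> \<le> (\<Sum>i=1..N. (1 / real N) * \<bar>?g i z\<bar>)"
      unfolding crossfit_mean_def abs_mult sum_distrib_left[symmetric]
      by (intro mult_mono sum_abs) auto
    then have "ennreal \<bar>crossfit_mean N K I z h\<bar> \<le> ennreal (\<Sum>i=1..N. (1 / real N) * \<bar>?g i z\<bar>)"
      by (rule ennreal_leI)
    also have "\<dots> = (\<Sum>i=1..N. ennreal (1 / real N) * ennreal \<bar>?g i z\<bar>)"
      by (subst sum_ennreal[symmetric]) (auto intro!: sum.cong ennreal_mult simp del: sum_ennreal times_divide_eq_left mult_1 mult_1_left)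
    finally show "ennreal \<bar>crossfit_mean N K I z h\<bar> \<le> (\<Sum>i=1..N. ennreal (1 / real N) * ennreal \<bar>?g i z\<bar>)" .
  qed
  also have "\<dots> = (\<Sum>i=1..N. \<integral>\<^sup>+ z. ennreal (1 / real N) * ennreal \<bar>?g i z\<bar> \<partial>iid {1..N} Q)"
    using m by (intro nn_integral_sum) auto
  also have "\<dots> = (\<Sum>i=1..N. ennreal (1 / real N) * (\<integral>\<^sup>+ z. ennreal \<bar>?g i z\<bar> \<partial>iid {1..N} Q))"
    using m by (intro sum.cong refl nn_integral_cmult) auto
  also have "\<dots> \<le> (\<Sum>i=1..N. ennreal (1 / real N) * b)"
    using le by (intro sum_mono mult_left_mono) auto
  also have "\<dots> = (ennreal (real N) * ennreal (1 / real N)) * b"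
    by (simp add: mult.assoc ennreal_of_nat_eq_real_of_nat)
  \<comment> \<open>Only an inequality, since the product of \<open>N\<close> and
    \<open>1 / N\<close> is 0 at \<open>N = 0\<close>.\<close>
  also have "\<dots> \<le> 1 * b"
    by (intro mult_right_mono) (auto simp: ennreal_mult[symmetric])
  finally show ?thesis by simp
qed

text \<open>The sums over different folds have overlapping data and need not be uncorrelated. The
  triangle inequality over folds costs just the factor \<open>K\<close>; inside a fold the second
  moment is at most \<open>N * v\<close>.\<close>

lemma crossfit_mean_second_moment:
  assumes Q: "prob_space Q" and I: "folds K N I"
    and h: "\<And>J. J \<subseteq> {1..N} \<Longrightarrow> (\<lambda>(t, y). h J t y) \<in> borel_measurable (iid J Q \<Otimes>\<^sub>M Q)"
    and mean: "\<And>J t. J \<subseteq> {1..N} \<Longrightarrow> t \<in> space (iid J Q) \<Longrightarrow> (\<integral> y. h J t y \<partial>Q) = 0"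
    and v: "\<And>J t. J \<subseteq> {1..N} \<Longrightarrow> t \<in> space (iid J Q) \<Longrightarrow> (\<integral>\<^sup>+ y. ennreal ((h J t y)\<^sup>2) \<partial>Q) \<le> ennreal v"
    and v0: "0 \<le> v" and N: "0 < N"
  shows "(\<integral>\<^sup>+ z. ennreal \<bar>crossfit_mean N K I z h\<bar> \<partial>iid {1..N} Q) \<le> ennreal (real K * sqrt (v / real N))"
proof -
  let ?P = "iid {1..N} Q"
  interpret P: prob_space ?P
    by (rule prob_space_PiM, rule Q)
  let ?J = "\<lambda>k. {1..N} - I k"
  let ?s = "\<lambda>k z. \<Sum>i\<in>I k. h (?J k) (restrict z (?J k)) (z i)"
  have m: "?s k \<in> borel_measurable ?P" if k: "k \<in> {1..K}" for k
  proof (rule borel_measurable_sum)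
    fix i assume i: "i \<in> I k"
    have "(\<lambda>z. (\<lambda>(t, y). h (?J k) t y) (restrict z (?J k), z i)) \<in> borel_measurable ?P"
      by (rule measurable_compose[OF measurable_train_test h]) (use i folds_subset[OF I k] in auto)
    then show "(\<lambda>z. h (?J k) (restrict z (?J k)) (z i)) \<in> borel_measurable ?P" by simp
  qed
  have le: "(\<integral>\<^sup>+ z. ennreal \<bar>?s k z\<bar> \<partial>?P) \<le> ennreal (sqrt (real N * v))" if k: "k \<in> {1..K}" for k
  proof -
    note * = second_moment_train_test[OF Q finite_atLeastAtMost[of 1 N], of "?J k" "I k" "\<lambda>(t, y). h (?J k) t y" v]
    have int: "integrable ?P (\<lambda>z. (?s k z)\<^sup>2)"
      and "(\<integral> z. (?s k z)\<^sup>2 \<partial>?P) \<le> real (card (I k)) * v"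
      using *(1) *(2) h[of "?J k"] mean[of "?J k"] v[of "?J k"] v0 folds_subset[OF I k] by auto
    moreover have "real (card (I k)) * v \<le> real N * v"
      using card_mono[OF _ folds_subset[OF I k]] v0 by (intro mult_right_mono) auto
    ultimately show ?thesis
      using m[OF k] by (intro P.nn_integral_abs_le_sqrt) auto
  qed
  have "(\<integral>\<^sup>+ z. ennreal \<bar>crossfit_mean N K I z h\<bar> \<partial>?P)
      \<le> (\<integral>\<^sup>+ z. (\<Sum>k=1..K. ennreal (1 / real N) * ennreal \<bar>?s k z\<bar>) \<partial>?P)"
  proof (rule nn_integral_mono)
    fix z
    have "\<bar>crossfit_mean N K I z h\<bar> \<le> (\<Sum>k=1..K. \<bar>(1 / real N) * ?s k z\<bar>)"
      unfolding crossfit_mean_folds[OF I] by (rule sum_abs)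
    then have "ennreal \<bar>crossfit_mean N K I z h\<bar> \<le> ennreal (\<Sum>k=1..K. (1 / real N) * \<bar>?s k z\<bar>)"
      by (intro ennreal_leI) (simp add: abs_mult)
    also have "\<dots> = (\<Sum>k=1..K. ennreal (1 / real N) * ennreal \<bar>?s k z\<bar>)"
      by (subst sum_ennreal[symmetric]) (auto intro!: sum.cong ennreal_mult simp del: sum_ennreal times_divide_eq_left mult_1 mult_1_left)
    finally show "ennreal \<bar>crossfit_mean N K I z h\<bar> \<le> (\<Sum>k=1..K. ennreal (1 / real N) * ennreal \<bar>?s k z\<bar>)" .
  qed
  also have "\<dots> = (\<Sum>k=1..K. \<integral>\<^sup>+ z. ennreal (1 / real N) * ennreal \<bar>?s k z\<bar> \<partial>?P)"
    using m by (intro nn_integral_sum) auto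
  also have "\<dots> = (\<Sum>k=1..K. ennreal (1 / real N) * (\<integral>\<^sup>+ z. ennreal \<bar>?s k z\<bar> \<partial>?P))"
    using m by (intro sum.cong refl nn_integral_cmult) auto
  also have "\<dots> \<le> (\<Sum>k=1..K. ennreal (1 / real N) * ennreal (sqrt (real N * v)))"
    using le by (intro sum_mono mult_left_mono) auto
  also have "\<dots> = ennreal (real K * (1 / real N * sqrt (real N * v)))"
    using v0 by (simp add: ennreal_mult[symmetric] ennreal_of_nat_eq_real_of_nat)
  also have "1 / real N * sqrt (real N * v) = sqrt (v / real N)"
    using N v0 by (simp add: real_sqrt_mult real_sqrt_divide field_simps real_sqrt_mult_self)
  finally show ?thesis .
qed

section \<open>Stochastic order symbols\<close>

text \<open>Each set has a measurable cover of the same outer measure, which reduces the claim to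
  subadditivity on measurable sets.\<close>

lemma outer_measure_of_Un_le:
  assumes "A \<subseteq> space M" "B \<subseteq> space M"
  shows "outer_measure_of M (A \<union> B) \<le> outer_measure_of M A + outer_measure_of M B"
proof -
  obtain A' where A': "A' \<in> sets M" "A \<subseteq> A'" "outer_measure_of M A = emeasure M A'"
    using outer_measure_of_attain[OF assms(1)] by auto
  obtain B' where B': "B' \<in> sets M" "B \<subseteq> B'" "outer_measure_of M B = emeasure M B'"
    using outer_measure_of_attain[OF assms(2)] by auto
  have "outer_measure_of M (A \<union> B) \<le> outer_measure_of M (A' \<union> B')"
    using A' B' by (intro outer_measure_of_mono) auto
  also have "\<dots> = emeasure M (A' \<union> B')" using A' B' by simp
  also have "\<dots> \<le> emeasure M A' + emeasure M B'" using A' B' by (intro emeasure_subadditive)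
  finally show ?thesis using A' B' by simp
qed

lemma outer_measure_of_UN_le:
  assumes "finite I" "\<And>i. i \<in> I \<Longrightarrow> A i \<subseteq> space M"
  shows "outer_measure_of M (\<Union>i\<in>I. A i) \<le> (\<Sum>i\<in>I. outer_measure_of M (A i))"
  using assms
proof (induction I rule: finite_induct)
  case (insert i I)
  then have "outer_measure_of M (A i \<union> (\<Union>i\<in>I. A i)) \<le> outer_measure_of M (A i) + outer_measure_of M (\<Union>i\<in>I. A i)"
    by (intro outer_measure_of_Un_le) auto
  also have "\<dots> \<le> outer_measure_of M (A i) + (\<Sum>i\<in>I. outer_measure_of M (A i))"
    using insert by (intro add_left_mono) auto
  finally show ?case using insert by simp
qed simp

abbreviation exceed :: "'w measure \<Rightarrow> ('w \<Rightarrow> real) \<Rightarrow> real \<Rightarrow> 'w set" where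
  "exceed M V t \<equiv> {\<omega> \<in> space M. ennreal \<bar>V \<omega>\<bar> > ennreal t}"

lemma Op_iff:
  "Op M V a \<longleftrightarrow> (\<forall>\<epsilon>>0. \<exists>T>0. \<forall>\<^sub>F N in sequentially.
     outer_measure_of (M N) (exceed (M N) (V N) (T * a N)) \<le> ennreal \<epsilon>)"
  by (simp add: Op_def enn_Op_def)

text \<open>A shape of bound to which Markov's inequality applies although neither \<open>V\<close>
  nor \<open>E\<close> is required to be measurable: only the majorant \<open>W\<close> is
  integrated.\<close>

definition dominated_off :: "'w measure \<Rightarrow> ('w \<Rightarrow> real) \<Rightarrow> real \<Rightarrow> real \<Rightarrow> bool" where
  "dominated_off M V \<epsilon> b \<longleftrightarrow> (\<exists>E W. E \<subseteq> space M \<and> outer_measure_of M E \<le> ennreal \<epsilon>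
     \<and> W \<in> borel_measurable M \<and> (\<integral>\<^sup>+\<omega>. W \<omega> \<partial>M) \<le> ennreal b
     \<and> (\<forall>\<omega>\<in>space M - E. ennreal \<bar>V \<omega>\<bar> \<le> W \<omega>))"

lemma Op_first_moment:
  assumes a: "\<forall>\<^sub>F N in sequentially. 0 < a N"
    and V: "\<And>\<epsilon>. \<epsilon> > 0 \<Longrightarrow> \<exists>D\<ge>0. \<forall>\<^sub>F N in sequentially. dominated_off (M N) (V N) \<epsilon> (D * a N)"
  shows "Op M V a"
  unfolding Op_iff
proof (intro allI impI)
  fix \<epsilon> :: real assume \<epsilon>: "\<epsilon> > 0"
  then obtain D where D: "D \<ge> 0" and ev: "\<forall>\<^sub>F N in sequentially. dominated_off (M N) (V N) (\<epsilon> / 2) (D * a N)"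
    using V[of "\<epsilon> / 2"] by auto
  \<comment> \<open>Half of \<epsilon> is spent on the exceptional set, half on Markov's bound
    \<open>D / T\<close>; the \<open>+ 1\<close> keeps \<open>T\<close> positive when
    \<open>D = 0\<close>.\<close>
  define T where "T = 2 * D / \<epsilon> + 1"
  have T: "T > 0" using D \<epsilon> by (simp add: T_def add_nonneg_pos)
  have DT: "D / T \<le> \<epsilon> / 2"
    using D \<epsilon> T by (simp add: T_def field_simps)
  have "\<forall>\<^sub>F N in sequentially.
      outer_measure_of (M N) (exceed (M N) (V N) (T * a N)) \<le> ennreal \<epsilon>"
    using ev a
  proof eventually_elim
    fix N assume aN: "0 < a N" and "dominated_off (M N) (V N) (\<epsilon> / 2) (D * a N)"
    then obtain E W where E: "E \<subseteq> space (M N)" "outer_measure_of (M N) E \<le> ennreal (\<epsilon> / 2)"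
      and W [measurable]: "W \<in> borel_measurable (M N)" and Wint: "(\<integral>\<^sup>+\<omega>. W \<omega> \<partial>M N) \<le> ennreal (D * a N)"
      and VW: "\<And>\<omega>. \<omega> \<in> space (M N) - E \<Longrightarrow> ennreal \<bar>V N \<omega>\<bar> \<le> W \<omega>"
      unfolding dominated_off_def by blast
    let ?c = "ennreal (1 / (T * a N))"
    let ?G = "{\<omega> \<in> space (M N). 1 \<le> ?c * W \<omega>}"
    have Ta: "0 < T * a N" using T aN by simp
    have G: "?G \<in> sets (M N)" by measurable
    have "(exceed (M N) (V N) (T * a N)) \<subseteq> E \<union> ?G"
    proof
      fix \<omega> assume \<omega>: "\<omega> \<in> (exceed (M N) (V N) (T * a N))"
      show "\<omega> \<in> E \<union> ?G"
      proof (cases "\<omega> \<in> E")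
        case False
        with VW \<omega> have "ennreal (T * a N) \<le> W \<omega>" by (auto intro: less_imp_le order.trans)
        then have "?c * ennreal (T * a N) \<le> ?c * W \<omega>" by (intro mult_left_mono) auto
        moreover have "?c * ennreal (T * a N) = 1"
          using T aN by (simp add: ennreal_mult[symmetric])
        ultimately show ?thesis using \<omega> by simp
      qed simp
    qed
    then have "outer_measure_of (M N) (exceed (M N) (V N) (T * a N))
        \<le> outer_measure_of (M N) (E \<union> ?G)" by (rule outer_measure_of_mono)
    also have "\<dots> \<le> outer_measure_of (M N) E + outer_measure_of (M N) ?G"
      using E by (intro outer_measure_of_Un_le) auto
    also have "outer_measure_of (M N) ?G \<le> ?c * (\<integral>\<^sup>+\<omega>. W \<omega> \<partial>M N)"
    proof -
      have "emeasure (M N) ({\<omega> \<in> space (M N). 1 \<le> ?c * W \<omega>}) \<le> ?c * (\<integral>\<^sup>+ \<omega>. W \<omega> * indicator (space (M N)) \<omega> \<partial>M N)"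
        by (rule nn_integral_Markov_inequality[of W "space (M N)" "M N" ?c]) simp_all
      also have "(\<integral>\<^sup>+ \<omega>. W \<omega> * indicator (space (M N)) \<omega> \<partial>M N) = (\<integral>\<^sup>+ \<omega>. W \<omega> \<partial>M N)"
        by (intro nn_integral_cong) simp
      finally show ?thesis using G by simp
    qed
    also have "\<dots> \<le> ?c * ennreal (D * a N)"
      using Wint by (intro mult_left_mono) auto
    also have "\<dots> = ennreal (D / T)"
      using T aN D by (simp add: ennreal_mult[symmetric])
    also have "\<dots> \<le> ennreal (\<epsilon> / 2)" using DT by (rule ennreal_leI)
    also have "outer_measure_of (M N) E + ennreal (\<epsilon> / 2) \<le> ennreal (\<epsilon> / 2) + ennreal (\<epsilon> / 2)"
      using E by (intro add_right_mono)
    also have "\<dots> = ennreal \<epsilon>" using \<epsilon> by (simp add: ennreal_plus[symmetric] del: ennreal_plus)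
    finally show "outer_measure_of (M N) (exceed (M N) (V N) (T * a N)) \<le> ennreal \<epsilon>"
      by (simp add: add_left_mono)
  qed
  then show "\<exists>T>0. \<forall>\<^sub>F N in sequentially.
      outer_measure_of (M N) (exceed (M N) (V N) (T * a N)) \<le> ennreal \<epsilon>"
    using T by blast
qed

text \<open>Negative thresholds collapse to 0 under \<open>ennreal\<close>, whence the
  \<open>max\<close>.\<close>

lemma ennreal_less_abs_iff: "ennreal t < ennreal \<bar>x\<bar> \<longleftrightarrow> \<bar>x\<bar> > max t 0"
  by (auto simp: ennreal_less_iff max_def ennreal_neg)

lemma Op_add:
  assumes V: "Op M V a" and W: "Op M W a"
  shows "Op M (\<lambda>N \<omega>. V N \<omega> + W N \<omega>) a"
  unfolding Op_iff
proof (intro allI impI)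
  fix \<epsilon> :: real assume \<epsilon>: "\<epsilon> > 0"
  obtain T1 where T1: "T1 > 0" "\<forall>\<^sub>F N in sequentially.
      outer_measure_of (M N) (exceed (M N) (V N) (T1 * a N)) \<le> ennreal (\<epsilon> / 2)"
    using V \<epsilon> half_gt_zero unfolding Op_iff by blast
  obtain T2 where T2: "T2 > 0" "\<forall>\<^sub>F N in sequentially.
      outer_measure_of (M N) (exceed (M N) (W N) (T2 * a N)) \<le> ennreal (\<epsilon> / 2)"
    using W \<epsilon> half_gt_zero unfolding Op_iff by blast
  have "\<forall>\<^sub>F N in sequentially. outer_measure_of (M N)
      {\<omega> \<in> space (M N). ennreal \<bar>V N \<omega> + W N \<omega>\<bar> > ennreal ((T1 + T2) * a N)} \<le> ennreal \<epsilon>"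
    using T1(2) T2(2)
  proof eventually_elim
    case (elim N)
    let ?A = "(exceed (M N) (V N) (T1 * a N))"
    let ?B = "(exceed (M N) (W N) (T2 * a N))"
    have "{\<omega> \<in> space (M N). ennreal \<bar>V N \<omega> + W N \<omega>\<bar> > ennreal ((T1 + T2) * a N)} \<subseteq> ?A \<union> ?B"
    proof (intro subsetI)
      fix \<omega> assume \<omega>: "\<omega> \<in> {\<omega> \<in> space (M N). ennreal \<bar>V N \<omega> + W N \<omega>\<bar> > ennreal ((T1 + T2) * a N)}"
      show "\<omega> \<in> ?A \<union> ?B"
      proof (rule ccontr)
        assume "\<omega> \<notin> ?A \<union> ?B"
        with \<omega> have 1: "\<bar>V N \<omega>\<bar> \<le> max (T1 * a N) 0" "\<bar>W N \<omega>\<bar> \<le> max (T2 * a N) 0"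
            "\<bar>V N \<omega> + W N \<omega>\<bar> > max ((T1 + T2) * a N) 0"
          by (auto simp: ennreal_less_abs_iff)
        \<comment> \<open>Both thresholds have the sign of \<open>a N\<close>, so cutting them off
          at 0 is additive.\<close>
        have "max (T1 * a N) 0 + max (T2 * a N) 0 = max ((T1 + T2) * a N) 0"
          using T1(1) T2(1)
          by (cases "a N \<ge> 0") (auto simp: max_def distrib_right[symmetric] mult_le_0_iff not_le)
        with 1 show False by linarith
      qed
    qed
    then have "outer_measure_of (M N) {\<omega> \<in> space (M N). ennreal \<bar>V N \<omega> + W N \<omega>\<bar> > ennreal ((T1 + T2) * a N)}
        \<le> outer_measure_of (M N) (?A \<union> ?B)" by (rule outer_measure_of_mono)
    also have "\<dots> \<le> outer_measure_of (M N) ?A + outer_measure_of (M N) ?B"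
      by (intro outer_measure_of_Un_le) auto
    also have "\<dots> \<le> ennreal (\<epsilon> / 2) + ennreal (\<epsilon> / 2)" using elim by (rule add_mono)
    also have "\<dots> = ennreal \<epsilon>" using \<epsilon> by (simp add: ennreal_plus[symmetric] del: ennreal_plus)
    finally show ?case .
  qed
  then show "\<exists>T>0. \<forall>\<^sub>F N in sequentially. outer_measure_of (M N)
      {\<omega> \<in> space (M N). ennreal \<bar>V N \<omega> + W N \<omega>\<bar> > ennreal (T * a N)} \<le> ennreal \<epsilon>"
    using T1(1) T2(1) add_pos_pos by blast
qed

lemma Op_mono:
  assumes V: "Op M V a" and C: "C > 0"
    and ab: "\<forall>\<^sub>F N in sequentially. a N \<le> C * b N"
    and WV: "\<And>N \<omega>. \<omega> \<in> space (M N) \<Longrightarrow> \<bar>W N \<omega>\<bar> \<le> \<bar>V N \<omega>\<bar>"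
  shows "Op M W b"
  unfolding Op_iff
proof (intro allI impI)
  fix \<epsilon> :: real assume \<epsilon>: "\<epsilon> > 0"
  obtain T where T: "T > 0" "\<forall>\<^sub>F N in sequentially.
      outer_measure_of (M N) (exceed (M N) (V N) (T * a N)) \<le> ennreal \<epsilon>"
    using V \<epsilon> unfolding Op_iff by blast
  have "\<forall>\<^sub>F N in sequentially.
      outer_measure_of (M N) (exceed (M N) (W N) (T * C * b N)) \<le> ennreal \<epsilon>"
    using T(2) ab
  proof eventually_elim
    case (elim N)
    have "T * a N \<le> T * C * b N"
      using elim(2) T(1) by (simp add: mult.assoc)
    then have "ennreal (T * a N) \<le> ennreal (T * C * b N)" by (rule ennreal_leI)
    moreover have "ennreal \<bar>W N \<omega>\<bar> \<le> ennreal \<bar>V N \<omega>\<bar>" if "\<omega> \<in> space (M N)" for \<omega>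
      using WV[OF that] by (rule ennreal_leI)
    ultimately have "(exceed (M N) (W N) (T * C * b N))
        \<subseteq> (exceed (M N) (V N) (T * a N))"
      by (auto intro: le_less_trans less_le_trans)
    from outer_measure_of_mono[OF this] elim(1) show ?case by (rule order.trans)
  qed
  then show "\<exists>T>0. \<forall>\<^sub>F N in sequentially.
      outer_measure_of (M N) (exceed (M N) (W N) (T * b N)) \<le> ennreal \<epsilon>"
    using T(1) C by (intro exI[of _ "T * C"]) auto
qed

lemma Op_cmult:
  assumes V: "Op M V a"
  shows "Op M (\<lambda>N \<omega>. f N * V N \<omega>) (\<lambda>N. \<bar>f N\<bar> * a N)"
  unfolding Op_iff
proof (intro allI impI)
  fix \<epsilon> :: real assume \<epsilon>: "\<epsilon> > 0"
  obtain T where T: "T > 0" "\<forall>\<^sub>F N in sequentially.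
      outer_measure_of (M N) (exceed (M N) (V N) (T * a N)) \<le> ennreal \<epsilon>"
    using V \<epsilon> unfolding Op_iff by blast
  have "\<forall>\<^sub>F N in sequentially.
      outer_measure_of (M N) {\<omega> \<in> space (M N). ennreal \<bar>f N * V N \<omega>\<bar> > ennreal (T * (\<bar>f N\<bar> * a N))} \<le> ennreal \<epsilon>"
    using T(2)
  proof eventually_elim
    case (elim N)
    have "{\<omega> \<in> space (M N). ennreal \<bar>f N * V N \<omega>\<bar> > ennreal (T * (\<bar>f N\<bar> * a N))}
        \<subseteq> (exceed (M N) (V N) (T * a N))"
    proof safe
      fix \<omega> assume *: "ennreal (T * (\<bar>f N\<bar> * a N)) < ennreal \<bar>f N * V N \<omega>\<bar>"
      have "ennreal (T * (\<bar>f N\<bar> * a N)) = ennreal \<bar>f N\<bar> * ennreal (T * a N)"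
        by (subst ennreal_mult'[symmetric]) (simp_all add: mult_ac)
      moreover have "ennreal \<bar>f N * V N \<omega>\<bar> = ennreal \<bar>f N\<bar> * ennreal \<bar>V N \<omega>\<bar>"
        by (simp add: abs_mult ennreal_mult)
      ultimately have lt: "ennreal \<bar>f N\<bar> * ennreal (T * a N) < ennreal \<bar>f N\<bar> * ennreal \<bar>V N \<omega>\<bar>"
        using * by simp
      \<comment> \<open>The factor \<open>f N\<close> will be a 0-1 indicator and may vanish, so it
        is not divided out; monotonicity of multiplication gives the contradiction.\<close>
      show "ennreal (T * a N) < ennreal \<bar>V N \<omega>\<bar>"
      proof (rule ccontr)
        assume "\<not> ennreal (T * a N) < ennreal \<bar>V N \<omega>\<bar>"
        then have "ennreal \<bar>f N\<bar> * ennreal \<bar>V N \<omega>\<bar> \<le> ennreal \<bar>f N\<bar> * ennreal (T * a N)"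
          by (intro mult_left_mono) auto
        with lt show False by simp
      qed
    qed
    from outer_measure_of_mono[OF this] elim show ?case by (rule order.trans)
  qed
  then show "\<exists>T>0. \<forall>\<^sub>F N in sequentially.
      outer_measure_of (M N) {\<omega> \<in> space (M N). ennreal \<bar>f N * V N \<omega>\<bar> > ennreal (T * (\<bar>f N\<bar> * a N))} \<le> ennreal \<epsilon>"
    using T(1) by blast
qed

lemma Op_deterministic:
  assumes C: "C > 0" and f: "\<forall>\<^sub>F N in sequentially. \<bar>f N\<bar> \<le> C * b N"
  shows "Op M (\<lambda>N _. f N) b"
  unfolding Op_iff
proof (intro allI impI exI[of _ C] conjI C)
  fix \<epsilon> :: real
  show "\<forall>\<^sub>F N in sequentially.
      outer_measure_of (M N) {\<omega> \<in> space (M N). ennreal \<bar>f N\<bar> > ennreal (C * b N)} \<le> ennreal \<epsilon>"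
    using f
  proof eventually_elim
    case (elim N)
    then have "\<not> ennreal \<bar>f N\<bar> > ennreal (C * b N)"
      unfolding not_less by (rule ennreal_leI)
    then have e: "{\<omega> \<in> space (M N). ennreal \<bar>f N\<bar> > ennreal (C * b N)} = {}"
      by blast
    show ?case unfolding e by simp
  qed
qed

lemma op_small_add:
  assumes V: "op_small M V a" and W: "op_small M W a"
  shows "op_small M (\<lambda>N \<omega>. V N \<omega> + W N \<omega>) a"
  unfolding op_small_def
proof (intro allI impI)
  fix \<delta> :: real assume \<delta>: "\<delta> > 0"
  let ?A = "\<lambda>N. {\<omega> \<in> space (M N). \<bar>V N \<omega>\<bar> > \<delta> / 2 * a N}"
  let ?B = "\<lambda>N. {\<omega> \<in> space (M N). \<bar>W N \<omega>\<bar> > \<delta> / 2 * a N}"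
  have "(\<lambda>N. outer_measure_of (M N) (?A N)) \<longlonglongrightarrow> 0" "(\<lambda>N. outer_measure_of (M N) (?B N)) \<longlonglongrightarrow> 0"
    using V W half_gt_zero[OF \<delta>] unfolding op_small_def by blast+
  then have lim: "(\<lambda>N. outer_measure_of (M N) (?A N) + outer_measure_of (M N) (?B N)) \<longlonglongrightarrow> 0 + 0"
    by (rule tendsto_add)
  have le: "outer_measure_of (M N) {\<omega> \<in> space (M N). \<bar>V N \<omega> + W N \<omega>\<bar> > \<delta> * a N}
      \<le> outer_measure_of (M N) (?A N) + outer_measure_of (M N) (?B N)" for N
  proof -
    have "{\<omega> \<in> space (M N). \<bar>V N \<omega> + W N \<omega>\<bar> > \<delta> * a N} \<subseteq> ?A N \<union> ?B N"
    proof
      fix \<omega> assume \<omega>: "\<omega> \<in> {\<omega> \<in> space (M N). \<bar>V N \<omega> + W N \<omega>\<bar> > \<delta> * a N}"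
      have "\<delta> * a N = \<delta> / 2 * a N + \<delta> / 2 * a N" by simp
      then show "\<omega> \<in> ?A N \<union> ?B N"
        using \<omega> abs_triangle_ineq[of "V N \<omega>" "W N \<omega>"] by fastforce
    qed
    then have "outer_measure_of (M N) {\<omega> \<in> space (M N). \<bar>V N \<omega> + W N \<omega>\<bar> > \<delta> * a N}
        \<le> outer_measure_of (M N) (?A N \<union> ?B N)" by (rule outer_measure_of_mono)
    also have "\<dots> \<le> outer_measure_of (M N) (?A N) + outer_measure_of (M N) (?B N)"
      by (intro outer_measure_of_Un_le) auto
    finally show ?thesis .
  qed
  show "(\<lambda>N. outer_measure_of (M N) {\<omega> \<in> space (M N). \<bar>V N \<omega> + W N \<omega>\<bar> > \<delta> * a N}) \<longlonglongrightarrow> 0"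
    by (rule tendsto_sandwich[OF _ _ tendsto_const, where h="\<lambda>N. outer_measure_of (M N) (?A N) + outer_measure_of (M N) (?B N)"])
       (use lim le in auto)
qed

text \<open>Once \<open>T\<close> is fixed by the target probability, the small-o condition with
  constant \<open>\<delta> / T\<close> puts \<open>T * a N\<close> below
  \<open>\<delta> * b N\<close> eventually.\<close>

lemma Op_imp_op_small:
  assumes V: "Op M V a" and ab: "a \<in> o(b)" and b: "\<forall>\<^sub>F N in sequentially. 0 < b N"
  shows "op_small M V b"
  unfolding op_small_def
proof (intro allI impI)
  fix \<delta> :: real assume \<delta>: "\<delta> > 0"
  show "(\<lambda>N. outer_measure_of (M N) {\<omega> \<in> space (M N). \<bar>V N \<omega>\<bar> > \<delta> * b N}) \<longlonglongrightarrow> 0"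
  proof (rule order_tendstoI)
    fix y :: ennreal assume "0 < y"
    then obtain z where z: "0 < z" "z < y" using dense by blast
    then obtain \<epsilon> where \<epsilon>: "z = ennreal \<epsilon>" "0 < \<epsilon>"
      by (cases z) (auto simp: ennreal_less_zero_iff)
    obtain T where T: "T > 0" "\<forall>\<^sub>F N in sequentially.
        outer_measure_of (M N) (exceed (M N) (V N) (T * a N)) \<le> ennreal \<epsilon>"
      using V \<epsilon>(2) unfolding Op_iff by blast
    have "\<forall>\<^sub>F N in sequentially. norm (a N) \<le> (\<delta> / T) * norm (b N)"
      by (rule landau_o.smallD[OF ab]) (use \<delta> T(1) in simp)
    then show "\<forall>\<^sub>F N in sequentially. outer_measure_of (M N) {\<omega> \<in> space (M N). \<bar>V N \<omega>\<bar> > \<delta> * b N} < y"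
      using T(2) b
    proof eventually_elim
      case (elim N)
      have "T * a N \<le> T * \<bar>a N\<bar>"
        using T(1) by (intro mult_left_mono) auto
      also have "\<dots> \<le> \<delta> * b N"
        using elim(1,3) T(1) by (simp add: field_simps)
      finally have "T * a N \<le> \<delta> * b N" .
      moreover have "0 < \<delta> * b N" using elim(3) \<delta> by simp
      ultimately have "{\<omega> \<in> space (M N). \<bar>V N \<omega>\<bar> > \<delta> * b N} \<subseteq> (exceed (M N) (V N) (T * a N))"
        by (auto simp: ennreal_less_abs_iff intro: le_less_trans)
      from order.trans[OF outer_measure_of_mono[OF this] elim(2)] z \<epsilon>(1) show ?case by simp
    qed
  qed simp
qed

section \<open>L2 norms, and the passage from fixed to random folds\<close>

lemma L2_norm_leD:
  assumes "L2_norm Q f \<le> ennreal b" "0 \<le> b"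
  shows "(\<integral>\<^sup>+ x. ennreal ((f x)\<^sup>2) \<partial>Q) \<le> ennreal (b\<^sup>2)"
proof (cases "\<integral>\<^sup>+ x. ennreal ((f x)\<^sup>2) \<partial>Q")
  case (real v)
  then have "sqrt v \<le> b"
    using assms by (simp add: L2_norm_def)
  then have "v \<le> b\<^sup>2" by (simp add: sqrt_le_D)
  then show ?thesis using real by (simp add: ennreal_leI)
next
  case top
  then show ?thesis using assms by (simp add: L2_norm_def top_unique)
qed

lemma (in prob_space) nn_integral_abs_le:
  assumes f: "f \<in> borel_measurable M" and b: "(\<integral>\<^sup>+ x. ennreal ((f x)\<^sup>2) \<partial>M) \<le> ennreal (b\<^sup>2)" "0 \<le> b"
  shows "(\<integral>\<^sup>+ x. ennreal \<bar>f x :: real\<bar> \<partial>M) \<le> ennreal b"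
proof -
  have i: "integrable M (\<lambda>x. (f x)\<^sup>2)"
    using f b by (intro integrableI_bounded) (auto simp: le_less_trans)
  have "ennreal (\<integral>x. (f x)\<^sup>2 \<partial>M) \<le> ennreal (b\<^sup>2)"
    using nn_integral_eq_integral[OF i] b by simp
  then show ?thesis
    using nn_integral_abs_le_sqrt[OF i f, of "b\<^sup>2"] b(2) by simp
qed

text \<open>Makes it possible to truncate on the L2 error of a whole fitted function and still have
  a measurable function of the training sample.\<close>

lemma borel_measurable_L2_norm:
  assumes Q: "sigma_finite_measure Q" and f: "(\<lambda>(t, x). f t x) \<in> borel_measurable (T \<Otimes>\<^sub>M Q)"
  shows "(\<lambda>t. L2_norm Q (f t)) \<in> borel_measurable T"
proof -
  interpret sigma_finite_measure Q by fact
  have "(\<lambda>(t, x). ennreal ((f t x)\<^sup>2)) \<in> borel_measurable (T \<Otimes>\<^sub>M Q)"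
    using f by measurable
  then have [measurable]: "(\<lambda>t. \<integral>\<^sup>+ x. ennreal ((f t x)\<^sup>2) \<partial>Q) \<in> borel_measurable T"
    by (rule borel_measurable_nn_integral)
  show ?thesis unfolding L2_norm_def Let_def by measurable
qed

text \<open>The restricted fold map takes values in the finite set
  \<open>{1..K} \<rightarrow>\<^sub>E Pow {1..N}\<close>, so
  \<open>nn_integral_indep_finite_le\<close> applies to it and the sample.\<close>

lemma crossfit_mean_random_folds:
  fixes Q :: "'z::topological_space measure"
  assumes M: "prob_space M" and Q: "sets Q = sets borel"
    and I: "\<And>\<omega>. \<omega> \<in> space M \<Longrightarrow> folds K N (I \<omega>)"
    and ind: "indep_elements M (PiM {1..N} (\<lambda>_. borel)) (\<lambda>\<omega>. restrict (\<lambda>i. S i \<omega>) {1..N})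
      (count_space UNIV) (\<lambda>\<omega>. restrict (I \<omega>) {1..K})"
    and D: "distr M (PiM {1..N} (\<lambda>_. borel)) (\<lambda>\<omega>. restrict (\<lambda>i. S i \<omega>) {1..N}) = iid {1..N} Q"
    and h: "\<And>J. J \<subseteq> {1..N} \<Longrightarrow> (\<lambda>(t, y). h J t y) \<in> borel_measurable (iid J Q \<Otimes>\<^sub>M Q)"
    and b: "\<And>j. folds K N j \<Longrightarrow> (\<integral>\<^sup>+ z. ennreal \<bar>crossfit_mean N K j z h\<bar> \<partial>iid {1..N} Q) \<le> b"
  shows "(\<lambda>\<omega>. ennreal \<bar>crossfit_mean N K (I \<omega>) (\<lambda>i. S i \<omega>) h\<bar>) \<in> borel_measurable M"
    and "(\<integral>\<^sup>+ \<omega>. ennreal \<bar>crossfit_mean N K (I \<omega>) (\<lambda>i. S i \<omega>) h\<bar> \<partial>M) \<le> b"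
proof -
  let ?U = "\<lambda>\<omega>. restrict (\<lambda>i. S i \<omega>) {1..N}" and ?V = "\<lambda>\<omega>. restrict (I \<omega>) {1..K}"
  let ?G = "\<lambda>v u. ennreal \<bar>crossfit_mean N K v u h\<bar>"
  have sets: "sets (PiM {1..N} (\<lambda>_. borel)) = sets (iid {1..N} Q)"
    using Q by (intro sets_PiM_cong) auto
  have V: "folds K N v" if "v \<in> ?V ` space M" for v
    using that I folds_restrict by auto
  have fin: "finite (?V ` space M)"
  proof (rule finite_subset)
    show "?V ` space M \<subseteq> {1..K} \<rightarrow>\<^sub>E Pow {1..N}"
      using folds_subset[OF I] by fastforce
  qed (auto intro!: finite_PiE)
  have G: "?G v \<in> borel_measurable (PiM {1..N} (\<lambda>_. borel))" if "v \<in> ?V ` space M" for v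
    unfolding measurable_cong_sets[OF sets refl]
    using crossfit_mean_measurable[OF V[OF that] h] by measurable
  have b': "(\<integral>\<^sup>+ u. ?G v u \<partial>distr M (PiM {1..N} (\<lambda>_. borel)) ?U) \<le> b" if "v \<in> ?V ` space M" for v
    unfolding D by (rule b[OF V[OF that]])
  note * = nn_integral_indep_finite_le[OF M ind fin G b']
  have eq: "?G (?V \<omega>) (?U \<omega>) = ennreal \<bar>crossfit_mean N K (I \<omega>) (\<lambda>i. S i \<omega>) h\<bar>" if "\<omega> \<in> space M" for \<omega>
    using crossfit_mean_restrict[OF I[OF that], of "\<lambda>i. S i \<omega>" h] by simp
  show "(\<lambda>\<omega>. ennreal \<bar>crossfit_mean N K (I \<omega>) (\<lambda>i. S i \<omega>) h\<bar>) \<in> borel_measurable M"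
    by (rule measurable_cong[THEN iffD1, OF eq *(1)])
  show "(\<integral>\<^sup>+ \<omega>. ennreal \<bar>crossfit_mean N K (I \<omega>) (\<lambda>i. S i \<omega>) h\<bar> \<partial>M) \<le> b"
  proof -
    have "(\<integral>\<^sup>+ \<omega>. ennreal \<bar>crossfit_mean N K (I \<omega>) (\<lambda>i. S i \<omega>) h\<bar> \<partial>M) = (\<integral>\<^sup>+ \<omega>. ?G (?V \<omega>) (?U \<omega>) \<partial>M)"
      by (rule nn_integral_cong) (rule eq[symmetric])
    also have "\<dots> \<le> b" by (rule *(2))
    finally show ?thesis .
  qed
qed

section \<open>The population\<close>

text \<open>A single sample size is fixed here; \<kappa> will be instantiated with
  \<open>C * pb N\<close>. Every bound must therefore display its dependence on \<kappa>.\<close>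

locale dr_population = prob_space P
  for P :: "'a measure" +
  fixes Y0 Y1 :: "'a \<Rightarrow> real" and R :: "'a \<Rightarrow> real" and X :: "'a \<Rightarrow> real ^ 'p::finite"
    and m0 \<pi> :: "real ^ 'p \<Rightarrow> real" and \<kappa> :: real
  assumes Y0 [measurable]: "Y0 \<in> borel_measurable P" and Y1 [measurable]: "Y1 \<in> borel_measurable P"
    and X [measurable]: "X \<in> borel_measurable P" and R [measurable]: "R \<in> borel_measurable P"
    and R01: "\<And>\<omega>. \<omega> \<in> space P \<Longrightarrow> R \<omega> \<in> {0, 1}"
    and m0: "regression_fun P X Y0 m0"
    and \<pi>: "regression_fun P X (\<lambda>\<omega>. of_bool (R \<omega> = 1)) \<pi>"
    and indep: "cond_indep_given P X (\<lambda>\<omega>. (Y0 \<omega>, Y1 \<omega>)) R"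
    and residual_sq: "integrable P (\<lambda>\<omega>. (Y0 \<omega> - m0 (X \<omega>))\<^sup>2)"
    and \<pi>_le: "AE \<omega> in P. \<pi> (X \<omega>) \<le> \<kappa>"
begin

definition Z :: "'a \<Rightarrow> 'p obs" where "Z = observation R Y0 Y1 X"

definition law :: "'p obs measure" where "law = distr P borel Z"

lemma m0_measurable [measurable]: "m0 \<in> borel_measurable borel"
  using m0 by (simp add: regression_fun_def)

lemma \<pi>_measurable [measurable]: "\<pi> \<in> borel_measurable borel"
  using \<pi> by (simp add: regression_fun_def)

lemma Z_measurable [measurable]: "Z \<in> borel_measurable P"
  unfolding Z_def observation_def[abs_def] obs_outcome_def borel_prod[symmetric] by measurable

lemma sets_law [simp, measurable_cong]: "sets law = sets borel"
  by (simp add: law_def)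

lemma prob_space_law: "prob_space law"
  unfolding law_def by (rule prob_space_distr) measurable

lemma nn_integral_law:
  assumes "f \<in> borel_measurable law"
  shows "(\<integral>\<^sup>+ z. f z \<partial>law) = (\<integral>\<^sup>+ \<omega>. f (Z \<omega>) \<partial>P)"
proof -
  have "f \<in> borel_measurable (distr P borel Z)" using assms by (simp add: law_def)
  then show ?thesis unfolding law_def by (intro nn_integral_distr) auto
qed

lemma integral_law:
  fixes f :: "_ \<Rightarrow> real"
  assumes "f \<in> borel_measurable law"
  shows "(\<integral> z. f z \<partial>law) = (\<integral> \<omega>. f (Z \<omega>) \<partial>P)"
proof -
  have "f \<in> borel_measurable borel" using assms by (simp add: law_def)
  then show ?thesis unfolding law_def by (intro integral_distr) auto
qed

lemma integrable_m0: "integrable P (\<lambda>\<omega>. m0 (X \<omega>))"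
proof -
  have "integrable P Y0" using m0 by (simp add: regression_fun_def)
  then show ?thesis
    using regression_fun_integral(1)[OF m0 X, of "\<lambda>_. 1"] by simp
qed

lemma integrable_Y0: "integrable P Y0"
  using m0 by (simp add: regression_fun_def)

lemma abs_R_le: "\<omega> \<in> space P \<Longrightarrow> \<bar>R \<omega>\<bar> \<le> 1" "\<omega> \<in> space P \<Longrightarrow> \<bar>1 - R \<omega>\<bar> \<le> 1"
  using R01[of \<omega>] by auto

lemma integral_treatment:
  assumes g [measurable]: "g \<in> borel_measurable borel" and int: "integrable P (\<lambda>\<omega>. g (X \<omega>))"
  shows "integrable P (\<lambda>\<omega>. g (X \<omega>) * R \<omega>)" and "integrable P (\<lambda>\<omega>. g (X \<omega>) * \<pi> (X \<omega>))"
    and "(\<integral>\<omega>. g (X \<omega>) * R \<omega> \<partial>P) = (\<integral>\<omega>. g (X \<omega>) * \<pi> (X \<omega>) \<partial>P)"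
proof -
  have eq: "g (X \<omega>) * R \<omega> = g (X \<omega>) * of_bool (R \<omega> = 1)" if "\<omega> \<in> space P" for \<omega>
    using R01[OF that] by auto
  show i: "integrable P (\<lambda>\<omega>. g (X \<omega>) * R \<omega>)"
    by (rule Bochner_Integration.integrable_bound[OF int])
       (use abs_R_le in \<open>auto simp: abs_mult intro!: AE_I2 mult_right_le_one_le\<close>)
  then have i': "integrable P (\<lambda>\<omega>. g (X \<omega>) * of_bool (R \<omega> = 1))"
    by (subst Bochner_Integration.integrable_cong[OF refl, where g="\<lambda>\<omega>. g (X \<omega>) * R \<omega>"]) (auto simp: eq)
  show "integrable P (\<lambda>\<omega>. g (X \<omega>) * \<pi> (X \<omega>))"
    by (rule regression_fun_integral(1)[OF \<pi> X g i'])
  show "(\<integral>\<omega>. g (X \<omega>) * R \<omega> \<partial>P) = (\<integral>\<omega>. g (X \<omega>) * \<pi> (X \<omega>) \<partial>P)"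
    unfolding regression_fun_integral(2)[OF \<pi> X g i']
    by (rule Bochner_Integration.integral_cong) (auto simp: eq)
qed

lemma integrable_bounded_mult:
  assumes [measurable]: "g \<in> borel_measurable borel" and gb: "\<And>x. \<bar>g x\<bar> \<le> (b::real)" and f: "integrable P f"
  shows "integrable P (\<lambda>\<omega>. g (X \<omega>) * f \<omega>)"
proof (rule Bochner_Integration.integrable_bound)
  show "integrable P (\<lambda>\<omega>. b * f \<omega>)" using f by simp
  have "0 \<le> b" using gb abs_ge_zero order.trans by blast
  then show "AE \<omega> in P. norm (g (X \<omega>) * f \<omega>) \<le> norm (b * f \<omega>)"
    using gb by (auto simp: abs_mult intro!: AE_I2 mult_right_mono)
qed (use f in measurable)

text \<open>The place where unconfoundedness acts. In the part weighted by \<open>R\<close>,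
  conditional independence replaces \<open>R\<close> by \<pi>, the regression property replaces
  \<open>Y0\<close> by \<open>m0\<close>, and \<pi> is turned back into \<open>R\<close>. The part
  without \<open>R\<close> is the regression property alone.\<close>

lemma integral_residual_nonneg:
  assumes g [measurable]: "g \<in> borel_measurable borel" and g0: "\<And>x. 0 \<le> g x" and gb: "\<And>x. g x \<le> b"
  shows "(\<integral>\<omega>. ((1 - R \<omega>) * g (X \<omega>)) * (Y0 \<omega> - m0 (X \<omega>)) \<partial>P) = 0"
proof -
  have gb': "\<bar>g x\<bar> \<le> b" for x using g0 gb by simp
  have intgY: "integrable P (\<lambda>\<omega>. g (X \<omega>) * Y0 \<omega>)" and intgm: "integrable P (\<lambda>\<omega>. g (X \<omega>) * m0 (X \<omega>))"
    using integrable_bounded_mult[OF g gb'] integrable_Y0 integrable_m0 by auto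
  have intRgY: "integrable P (\<lambda>\<omega>. R \<omega> * (g (X \<omega>) * Y0 \<omega>))"
    by (rule Bochner_Integration.integrable_bound[OF intgY])
       (use abs_R_le in \<open>auto simp: abs_mult intro!: AE_I2 mult_left_le_one_le\<close>)
  have pb: "AE \<omega> in P. 0 \<le> \<pi> (X \<omega>) \<and> \<pi> (X \<omega>) \<le> 1"
    using \<pi> X by (rule regression_fun_of_bool_bounds)
  have intpY: "integrable P (\<lambda>\<omega>. (\<pi> (X \<omega>) * g (X \<omega>)) * Y0 \<omega>)"
  proof (rule Bochner_Integration.integrable_bound[OF intgY])
    show "AE \<omega> in P. norm ((\<pi> (X \<omega>) * g (X \<omega>)) * Y0 \<omega>) \<le> norm (g (X \<omega>) * Y0 \<omega>)"
      using pb by eventually_elim (auto simp: abs_mult mult.assoc intro!: mult_left_le_one_le)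
  qed measurable
  have "(\<lambda>x. g x * m0 x) \<in> borel_measurable borel" by measurable
  note Rgm = integral_treatment[OF this intgm]
  have "(\<integral>\<omega>. R \<omega> * (g (X \<omega>) * Y0 \<omega>) \<partial>P) = (\<integral>\<omega>. (of_bool (R \<omega> = 1) * g (X \<omega>)) * Y0 \<omega> \<partial>P)"
    using R01 by (intro Bochner_Integration.integral_cong) auto
  also have "\<dots> = (\<integral>\<omega>. (\<pi> (X \<omega>) * g (X \<omega>)) * Y0 \<omega> \<partial>P)"
    by (rule cond_indep_given_integral[OF cond_indep_given_fst[OF indep] \<pi> X Y0 R g g0 gb])
  also have "\<dots> = (\<integral>\<omega>. (\<pi> (X \<omega>) * g (X \<omega>)) * m0 (X \<omega>) \<partial>P)"
    by (rule regression_fun_integral(2)[where f="\<lambda>x. \<pi> x * g x", OF m0 X _ intpY, symmetric]) measurable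
  also have "\<dots> = (\<integral>\<omega>. g (X \<omega>) * m0 (X \<omega>) * R \<omega> \<partial>P)"
    using Rgm(3) by (simp add: mult_ac)
  finally have 1: "(\<integral>\<omega>. R \<omega> * (g (X \<omega>) * Y0 \<omega>) \<partial>P) = (\<integral>\<omega>. g (X \<omega>) * m0 (X \<omega>) * R \<omega> \<partial>P)" .
  have 2: "(\<integral>\<omega>. g (X \<omega>) * m0 (X \<omega>) \<partial>P) = (\<integral>\<omega>. g (X \<omega>) * Y0 \<omega> \<partial>P)"
    by (rule regression_fun_integral(2)[OF m0 X g intgY])
  have "(\<integral>\<omega>. ((1 - R \<omega>) * g (X \<omega>)) * (Y0 \<omega> - m0 (X \<omega>)) \<partial>P)
      = (\<integral>\<omega>. (g (X \<omega>) * Y0 \<omega> - g (X \<omega>) * m0 (X \<omega>)) - (R \<omega> * (g (X \<omega>) * Y0 \<omega>) - g (X \<omega>) * m0 (X \<omega>) * R \<omega>) \<partial>P)"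
    by (rule Bochner_Integration.integral_cong) (auto simp: algebra_simps)
  also have "\<dots> = 0"
    using 1 2 intgY intgm intRgY Rgm(1) by simp
  finally show ?thesis .
qed

text \<open>The preceding argument uses \<open>g\<close> inside a density and so needs it
  nonnegative; positive and negative parts remove this restriction.\<close>

lemma integral_residual:
  assumes g [measurable]: "g \<in> borel_measurable borel" and gb: "\<And>x. \<bar>g x\<bar> \<le> b"
  shows "integrable P (\<lambda>\<omega>. ((1 - R \<omega>) * g (X \<omega>)) * (Y0 \<omega> - m0 (X \<omega>)))"
    and "(\<integral>\<omega>. ((1 - R \<omega>) * g (X \<omega>)) * (Y0 \<omega> - m0 (X \<omega>)) \<partial>P) = 0"
proof -
  have int: "integrable P (\<lambda>\<omega>. ((1 - R \<omega>) * g (X \<omega>)) * (Y0 \<omega> - m0 (X \<omega>)))"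
    if [measurable]: "g \<in> borel_measurable borel" and gb: "\<And>x. \<bar>g x\<bar> \<le> b" for g
  proof (rule Bochner_Integration.integrable_bound)
    show "integrable P (\<lambda>\<omega>. g (X \<omega>) * (Y0 \<omega> - m0 (X \<omega>)))"
      using integrable_Y0 integrable_m0 by (intro integrable_bounded_mult[OF that]) auto
    show "AE \<omega> in P. norm (((1 - R \<omega>) * g (X \<omega>)) * (Y0 \<omega> - m0 (X \<omega>))) \<le> norm (g (X \<omega>) * (Y0 \<omega> - m0 (X \<omega>)))"
      using abs_R_le by (auto simp: abs_mult mult.assoc intro!: AE_I2 mult_left_le_one_le)
  qed measurable
  show "integrable P (\<lambda>\<omega>. ((1 - R \<omega>) * g (X \<omega>)) * (Y0 \<omega> - m0 (X \<omega>)))"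
    by (rule int[OF g gb])
  have b0: "0 \<le> b" using gb abs_ge_zero order.trans by blast
  let ?p = "\<lambda>x. max (g x) 0" and ?m = "\<lambda>x. max (- g x) 0"
  have [measurable]: "?p \<in> borel_measurable borel" "?m \<in> borel_measurable borel" by measurable
  have le: "\<bar>?p x\<bar> \<le> b" "\<bar>?m x\<bar> \<le> b" for x using gb[of x] b0 by auto
  have "(\<integral>\<omega>. ((1 - R \<omega>) * g (X \<omega>)) * (Y0 \<omega> - m0 (X \<omega>)) \<partial>P)
      = (\<integral>\<omega>. ((1 - R \<omega>) * ?p (X \<omega>)) * (Y0 \<omega> - m0 (X \<omega>)) - ((1 - R \<omega>) * ?m (X \<omega>)) * (Y0 \<omega> - m0 (X \<omega>)) \<partial>P)"
    by (rule Bochner_Integration.integral_cong) (auto simp: max_def algebra_simps)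
  also have "\<dots> = (\<integral>\<omega>. ((1 - R \<omega>) * ?p (X \<omega>)) * (Y0 \<omega> - m0 (X \<omega>)) \<partial>P) - (\<integral>\<omega>. ((1 - R \<omega>) * ?m (X \<omega>)) * (Y0 \<omega> - m0 (X \<omega>)) \<partial>P)"
    by (intro Bochner_Integration.integral_diff int le) measurable
  also have "(\<integral>\<omega>. ((1 - R \<omega>) * ?p (X \<omega>)) * (Y0 \<omega> - m0 (X \<omega>)) \<partial>P) = 0"
    by (rule integral_residual_nonneg[of _ b]) (use le in \<open>auto simp: abs_le_iff\<close>)
  also have "(\<integral>\<omega>. ((1 - R \<omega>) * ?m (X \<omega>)) * (Y0 \<omega> - m0 (X \<omega>)) \<partial>P) = 0"
    by (rule integral_residual_nonneg[of _ b]) (use le in \<open>auto simp: abs_le_iff\<close>)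
  finally show "(\<integral>\<omega>. ((1 - R \<omega>) * g (X \<omega>)) * (Y0 \<omega> - m0 (X \<omega>)) \<partial>P) = 0" by simp
qed

end

section \<open>Moments under the law of one observation\<close>

context dr_population
begin

lemma
  shows fst_law_measurable [measurable]: "fst \<in> measurable law borel"
    and outcome_law_measurable [measurable]: "(\<lambda>z. fst (snd z)) \<in> measurable law borel"
    and covariate_law_measurable [measurable]: "(\<lambda>z. snd (snd z)) \<in> measurable law borel"
  by (simp_all add: measurable_cong_sets[OF sets_law refl])
     (intro borel_measurable_continuous_onI continuous_intros)+

lemma Z_simps: "fst (Z \<omega>) = R \<omega>" "snd (snd (Z \<omega>)) = X \<omega>"
  "fst (snd (Z \<omega>)) = R \<omega> * Y1 \<omega> + (1 - R \<omega>) * Y0 \<omega>"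
  by (simp_all add: Z_def observation_def obs_outcome_def)

text \<open>Since \<open>R\<close> is binary and \<pi> lies in [0, 1], the square of
  \<open>R - \<pi>\<close> is at most \<open>R + \<pi>\<close>, and \<open>R\<close> integrates like
  \<pi> against functions of \<open>X\<close>. The resulting factor \<open>2 * \<kappa>\<close> is
  the origin of \<open>sqrt (pb N)\<close> in the first rate.\<close>

lemma propensity_moments:
  assumes g [measurable]: "g \<in> borel_measurable borel"
    and b: "(\<integral>\<^sup>+ x. ennreal ((g x)\<^sup>2) \<partial>distr P borel X) \<le> ennreal (b\<^sup>2)" and \<kappa>: "0 \<le> \<kappa>"
  shows "(\<integral> z. g (snd (snd z)) * (fst z - \<pi> (snd (snd z))) \<partial>law) = 0"
    and "(\<integral>\<^sup>+ z. ennreal ((g (snd (snd z)) * (fst z - \<pi> (snd (snd z))))\<^sup>2) \<partial>law) \<le> ennreal (2 * \<kappa> * b\<^sup>2)"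
proof -
  have b': "(\<integral>\<^sup>+ \<omega>. ennreal ((g (X \<omega>))\<^sup>2) \<partial>P) \<le> ennreal (b\<^sup>2)"
    using b by (simp add: nn_integral_distr)
  have sq: "integrable P (\<lambda>\<omega>. (g (X \<omega>))\<^sup>2)"
    using b' by (intro integrableI_bounded) (auto simp: le_less_trans)
  have sq_le: "(\<integral>\<omega>. (g (X \<omega>))\<^sup>2 \<partial>P) \<le> b\<^sup>2"
  proof -
    have "ennreal (\<integral>\<omega>. (g (X \<omega>))\<^sup>2 \<partial>P) \<le> ennreal (b\<^sup>2)"
      using nn_integral_eq_integral[OF sq] b' by simp
    then show ?thesis by simp
  qed
  have int: "integrable P (\<lambda>\<omega>. g (X \<omega>))"
    by (rule square_integrable_imp_integrable[OF _ sq]) measurable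
  have "(\<integral> z. g (snd (snd z)) * (fst z - \<pi> (snd (snd z))) \<partial>law)
      = (\<integral> \<omega>. g (X \<omega>) * R \<omega> - g (X \<omega>) * \<pi> (X \<omega>) \<partial>P)"
    by (subst integral_law) (measurable, simp add: Z_simps right_diff_distrib)
  also have "\<dots> = 0"
    using integral_treatment[OF g int] by simp
  finally show "(\<integral> z. g (snd (snd z)) * (fst z - \<pi> (snd (snd z))) \<partial>law) = 0" .
  have "(\<lambda>x. (g x)\<^sup>2) \<in> borel_measurable borel" by measurable
  note sqR = integral_treatment[OF this sq]
  have pb: "AE \<omega> in P. 0 \<le> \<pi> (X \<omega>) \<and> \<pi> (X \<omega>) \<le> 1"
    using \<pi> X by (rule regression_fun_of_bool_bounds)
  have "(\<integral>\<^sup>+ z. ennreal ((g (snd (snd z)) * (fst z - \<pi> (snd (snd z))))\<^sup>2) \<partial>law)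
      = (\<integral>\<^sup>+ \<omega>. ennreal ((g (X \<omega>) * (R \<omega> - \<pi> (X \<omega>)))\<^sup>2) \<partial>P)"
    by (subst nn_integral_law) (measurable, simp add: Z_simps)
  also have "\<dots> \<le> (\<integral>\<^sup>+ \<omega>. ennreal ((g (X \<omega>))\<^sup>2 * R \<omega> + (g (X \<omega>))\<^sup>2 * \<pi> (X \<omega>)) \<partial>P)"
  proof (rule nn_integral_mono_AE)
    have "\<forall>\<omega>\<in>space P. R \<omega> = 0 \<or> R \<omega> = 1" using R01 by blast
    then have "AE \<omega> in P. R \<omega> = 0 \<or> R \<omega> = 1" by (intro AE_I2) auto
    with pb show "AE \<omega> in P. ennreal ((g (X \<omega>) * (R \<omega> - \<pi> (X \<omega>)))\<^sup>2)
        \<le> ennreal ((g (X \<omega>))\<^sup>2 * R \<omega> + (g (X \<omega>))\<^sup>2 * \<pi> (X \<omega>))"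
    proof eventually_elim
      fix \<omega> assume p: "0 \<le> \<pi> (X \<omega>) \<and> \<pi> (X \<omega>) \<le> 1" and r: "R \<omega> = 0 \<or> R \<omega> = 1"
      have p2: "(\<pi> (X \<omega>))\<^sup>2 \<le> \<pi> (X \<omega>)"
        using p by (simp add: power2_eq_square mult_left_le)
      have "(R \<omega> - \<pi> (X \<omega>))\<^sup>2 \<le> R \<omega> + \<pi> (X \<omega>)"
        using r p2 p by (auto simp: power2_diff)
      then have "(g (X \<omega>))\<^sup>2 * (R \<omega> - \<pi> (X \<omega>))\<^sup>2 \<le> (g (X \<omega>))\<^sup>2 * (R \<omega> + \<pi> (X \<omega>))"
        by (intro mult_left_mono) auto
      then show "ennreal ((g (X \<omega>) * (R \<omega> - \<pi> (X \<omega>)))\<^sup>2)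
        \<le> ennreal ((g (X \<omega>))\<^sup>2 * R \<omega> + (g (X \<omega>))\<^sup>2 * \<pi> (X \<omega>))"
        by (intro ennreal_leI) (simp add: power_mult_distrib distrib_left)
    qed
  qed
  also have "\<dots> = ennreal (\<integral>\<omega>. (g (X \<omega>))\<^sup>2 * R \<omega> + (g (X \<omega>))\<^sup>2 * \<pi> (X \<omega>) \<partial>P)"
  proof (rule nn_integral_eq_integral)
    show "AE \<omega> in P. 0 \<le> (g (X \<omega>))\<^sup>2 * R \<omega> + (g (X \<omega>))\<^sup>2 * \<pi> (X \<omega>)"
      using pb AE_space by eventually_elim (use R01 in force)
  qed (use sqR in auto)
  also have "(\<integral>\<omega>. (g (X \<omega>))\<^sup>2 * R \<omega> + (g (X \<omega>))\<^sup>2 * \<pi> (X \<omega>) \<partial>P) = 2 * (\<integral>\<omega>. (g (X \<omega>))\<^sup>2 * \<pi> (X \<omega>) \<partial>P)"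
    using sqR by simp
  also have "(\<integral>\<omega>. (g (X \<omega>))\<^sup>2 * \<pi> (X \<omega>) \<partial>P) \<le> (\<integral>\<omega>. (g (X \<omega>))\<^sup>2 * \<kappa> \<partial>P)"
  proof (rule integral_mono_AE)
    show "AE \<omega> in P. (g (X \<omega>))\<^sup>2 * \<pi> (X \<omega>) \<le> (g (X \<omega>))\<^sup>2 * \<kappa>"
      using \<pi>_le by eventually_elim (rule mult_left_mono, auto)
  qed (use sqR sq in auto)
  also have "\<dots> = \<kappa> * (\<integral>\<omega>. (g (X \<omega>))\<^sup>2 \<partial>P)" by simp
  also have "\<dots> \<le> \<kappa> * b\<^sup>2" using sq_le \<kappa> by (rule mult_left_mono)
  finally show "(\<integral>\<^sup>+ z. ennreal ((g (snd (snd z)) * (fst z - \<pi> (snd (snd z))))\<^sup>2) \<partial>law) \<le> ennreal (2 * \<kappa> * b\<^sup>2)"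
    by (simp add: ennreal_leI mult.assoc)
qed

text \<open>The factor \<open>1 - R\<close> vanishes exactly where the observed outcome is
  \<open>Y1\<close>, so \<open>Y0\<close> can be inserted.\<close>

lemma control_outcome:
  "\<omega> \<in> space P \<Longrightarrow> (1 - fst (Z \<omega>)) * t * (fst (snd (Z \<omega>)) - s) = (1 - R \<omega>) * t * (Y0 \<omega> - s)"
  using R01[of \<omega>] by (auto simp: Z_simps)

lemma residual_moments:
  assumes g [measurable]: "g \<in> borel_measurable borel" and gb: "\<And>x. \<bar>g x\<bar> \<le> b"
  shows "(\<integral> z. (1 - fst z) * g (snd (snd z)) * (fst (snd z) - m0 (snd (snd z))) \<partial>law) = 0"
    and "(\<integral>\<^sup>+ z. ennreal (((1 - fst z) * g (snd (snd z)) * (fst (snd z) - m0 (snd (snd z))))\<^sup>2) \<partial>law)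
      \<le> ennreal (b\<^sup>2 * (\<integral>\<omega>. (Y0 \<omega> - m0 (X \<omega>))\<^sup>2 \<partial>P))"
proof -
  have "(\<integral> z. (1 - fst z) * g (snd (snd z)) * (fst (snd z) - m0 (snd (snd z))) \<partial>law)
      = (\<integral>\<omega>. (1 - fst (Z \<omega>)) * g (snd (snd (Z \<omega>))) * (fst (snd (Z \<omega>)) - m0 (snd (snd (Z \<omega>)))) \<partial>P)"
    by (rule integral_law) measurable
  also have "\<dots> = (\<integral>\<omega>. ((1 - R \<omega>) * g (X \<omega>)) * (Y0 \<omega> - m0 (X \<omega>)) \<partial>P)"
    by (rule Bochner_Integration.integral_cong) (simp_all add: control_outcome, simp add: Z_simps)
  also have "\<dots> = 0" by (rule integral_residual[OF g gb])
  finally show "(\<integral> z. (1 - fst z) * g (snd (snd z)) * (fst (snd z) - m0 (snd (snd z))) \<partial>law) = 0" .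
  have "(\<integral>\<^sup>+ z. ennreal (((1 - fst z) * g (snd (snd z)) * (fst (snd z) - m0 (snd (snd z))))\<^sup>2) \<partial>law)
      = (\<integral>\<^sup>+\<omega>. ennreal (((1 - fst (Z \<omega>)) * g (snd (snd (Z \<omega>))) * (fst (snd (Z \<omega>)) - m0 (snd (snd (Z \<omega>)))))\<^sup>2) \<partial>P)"
    by (rule nn_integral_law) measurable
  also have "\<dots> = (\<integral>\<^sup>+\<omega>. ennreal (((1 - R \<omega>) * g (X \<omega>) * (Y0 \<omega> - m0 (X \<omega>)))\<^sup>2) \<partial>P)"
    by (rule nn_integral_cong) (simp add: control_outcome, simp add: Z_simps)
  also have "\<dots> \<le> (\<integral>\<^sup>+\<omega>. ennreal (b\<^sup>2 * (Y0 \<omega> - m0 (X \<omega>))\<^sup>2) \<partial>P)"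
  proof (intro nn_integral_mono ennreal_leI)
    fix \<omega> assume "\<omega> \<in> space P"
    then have "\<bar>(1 - R \<omega>) * g (X \<omega>)\<bar> \<le> 1 * b"
      unfolding abs_mult using abs_R_le gb by (intro mult_mono) auto
    then have "((1 - R \<omega>) * g (X \<omega>))\<^sup>2 \<le> b\<^sup>2"
      using power_mono[of "\<bar>(1 - R \<omega>) * g (X \<omega>)\<bar>" b 2] by simp
    then show "((1 - R \<omega>) * g (X \<omega>) * (Y0 \<omega> - m0 (X \<omega>)))\<^sup>2 \<le> b\<^sup>2 * (Y0 \<omega> - m0 (X \<omega>))\<^sup>2"
      unfolding power_mult_distrib[of "(1 - R \<omega>) * g (X \<omega>)"] by (intro mult_right_mono) auto
  qed
  also have "\<dots> = ennreal (b\<^sup>2 * (\<integral>\<omega>. (Y0 \<omega> - m0 (X \<omega>))\<^sup>2 \<partial>P))"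
    using residual_sq by (subst nn_integral_eq_integral) auto
  finally show "(\<integral>\<^sup>+ z. ennreal (((1 - fst z) * g (snd (snd z)) * (fst (snd z) - m0 (snd (snd z))))\<^sup>2) \<partial>law)
      \<le> ennreal (b\<^sup>2 * (\<integral>\<omega>. (Y0 \<omega> - m0 (X \<omega>))\<^sup>2 \<partial>P))" .
qed

end

text \<open>The bound \<kappa> \<le> 1/4 is available for large \<open>N\<close> because
  \<open>pb\<close> tends to 0. It forces \<open>1 - e\<close> to be at least 3/4 on the
  support.\<close>

locale dr_nuisance = dr_population +
  fixes \<mu>0 e :: "real ^ 'b::finite \<Rightarrow> real" and \<D> :: real
  assumes \<mu>0 [measurable]: "\<mu>0 \<in> borel_measurable borel" and e [measurable]: "e \<in> borel_measurable borel"
    and \<pi>_bounds: "\<And>x. x \<in> measure_support (distr P borel X) \<Longrightarrow> 0 < \<pi> x \<and> \<pi> x < \<kappa>"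
    and e_bounds: "\<And>x. x \<in> measure_support (distr P borel X) \<Longrightarrow> 0 < e x \<and> e x < \<kappa>"
    and \<kappa>_pos: "0 < \<kappa>" and \<kappa>_le: "\<kappa> \<le> 1 / 4"
    and misspec: "L2_norm (distr P borel X) (\<lambda>x. m0 x - \<mu>0 x) \<le> ennreal \<D>" and \<D>_nonneg: "0 \<le> \<D>"
    and m0_sq: "integrable P (\<lambda>\<omega>. (m0 (X \<omega>))\<^sup>2)"
begin

abbreviation "PX \<equiv> distr P borel X"
abbreviation "\<X> \<equiv> measure_support PX"

text \<open>The inverse weight is cut to 0 off the support, where \<open>e\<close> is unconstrained
  and \<open>1 - e\<close> may come arbitrarily close to 0. The covariates almost surely avoid that
  region.\<close>

definition u :: "real ^ 'b \<Rightarrow> real" where "u x = (if x \<in> \<X> then 1 / (1 - e x) else 0)"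

lemma \<X>_measurable [measurable]: "\<X> \<in> sets borel"
  by (intro borel_closed closed_measure_support)

lemma u_measurable [measurable]: "u \<in> borel_measurable borel"
  unfolding u_def by measurable

lemma u_bounds: "0 \<le> u x" "u x \<le> 4 / 3"
  using e_bounds[of x] \<kappa>_le by (auto simp: u_def field_simps)

lemma abs_u_le: "\<bar>u x\<bar> \<le> 2"
  using u_bounds[of x] by simp

lemma abs_e_u_le: "\<bar>e x * u x\<bar> \<le> 1"
  using e_bounds[of x] \<kappa>_le by (auto simp: u_def abs_mult field_simps)

lemma AE_X: "AE \<omega> in P. X \<omega> \<in> \<X>"
proof -
  have "AE x in PX. x \<in> \<X>" by (rule AE_in_measure_support) simp
  then show ?thesis by (subst (asm) AE_distr_iff) auto
qed

lemma misspec_nn: "(\<integral>\<^sup>+ x. ennreal ((m0 x - \<mu>0 x)\<^sup>2) \<partial>PX) \<le> ennreal (\<D>\<^sup>2)"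
  using misspec \<D>_nonneg by (rule L2_norm_leD)

lemma misspec_sq: "integrable P (\<lambda>\<omega>. (m0 (X \<omega>) - \<mu>0 (X \<omega>))\<^sup>2)"
  and misspec_sq_le: "(\<integral>\<omega>. (m0 (X \<omega>) - \<mu>0 (X \<omega>))\<^sup>2 \<partial>P) \<le> \<D>\<^sup>2"
proof -
  have b: "(\<integral>\<^sup>+ \<omega>. ennreal ((m0 (X \<omega>) - \<mu>0 (X \<omega>))\<^sup>2) \<partial>P) \<le> ennreal (\<D>\<^sup>2)"
    using misspec_nn by (simp add: nn_integral_distr)
  show i: "integrable P (\<lambda>\<omega>. (m0 (X \<omega>) - \<mu>0 (X \<omega>))\<^sup>2)"
    using b by (intro integrableI_bounded) (auto simp: le_less_trans)
  have "ennreal (\<integral>\<omega>. (m0 (X \<omega>) - \<mu>0 (X \<omega>))\<^sup>2 \<partial>P) \<le> ennreal (\<D>\<^sup>2)"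
    using b nn_integral_eq_integral[OF i] by simp
  then show "(\<integral>\<omega>. (m0 (X \<omega>) - \<mu>0 (X \<omega>))\<^sup>2 \<partial>P) \<le> \<D>\<^sup>2" by simp
qed

lemma misspec_nn_abs: "(\<integral>\<^sup>+ x. ennreal \<bar>m0 x - \<mu>0 x\<bar> \<partial>PX) \<le> ennreal \<D>"
proof -
  interpret PX: prob_space PX by (rule prob_space_distr) measurable
  show ?thesis by (rule PX.nn_integral_abs_le[OF _ misspec_nn \<D>_nonneg]) measurable
qed

lemma misspec_int: "integrable P (\<lambda>\<omega>. m0 (X \<omega>) - \<mu>0 (X \<omega>))"
  by (rule square_integrable_imp_integrable[OF _ misspec_sq]) measurable

lemma misspec_abs_le: "(\<integral>\<omega>. \<bar>m0 (X \<omega>) - \<mu>0 (X \<omega>)\<bar> \<partial>P) \<le> \<D>"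
proof -
  have "ennreal (\<integral>\<omega>. \<bar>m0 (X \<omega>) - \<mu>0 (X \<omega>)\<bar> \<partial>P) = (\<integral>\<^sup>+ \<omega>. ennreal \<bar>m0 (X \<omega>) - \<mu>0 (X \<omega>)\<bar> \<partial>P)"
    using misspec_int by (intro nn_integral_eq_integral[symmetric]) auto
  also have "\<dots> \<le> ennreal \<D>"
    using misspec_nn_abs by (simp add: nn_integral_distr)
  finally show ?thesis using \<D>_nonneg by simp
qed

section \<open>Second moment and mean of the influence function \<psi>\<close>

definition \<theta>0 :: real where "\<theta>0 = (\<integral>\<omega>. Y0 \<omega> \<partial>P)"

abbreviation "\<psi> \<equiv> psi0 \<mu>0 e \<theta>0"

lemma \<psi>_measurable [measurable]: "\<psi> \<in> borel_measurable borel"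
  unfolding psi0_def split_beta' borel_prod[symmetric] by measurable

text \<open>Splits \<open>y - \<mu>0\<close> at \<open>m0\<close> and uses
  \<open>e * u = u - 1\<close>. Of the three groups, the last two are centred, so only the first can
  contribute to the mean.\<close>

lemma \<psi>_Z:
  assumes "X \<omega> \<in> \<X>" "\<omega> \<in> space P"
  shows "\<psi> (Z \<omega>) = (e (X \<omega>) * u (X \<omega>) * (m0 (X \<omega>) - \<mu>0 (X \<omega>)) - u (X \<omega>) * (m0 (X \<omega>) - \<mu>0 (X \<omega>)) * R \<omega>)
     + (m0 (X \<omega>) - \<theta>0) + (1 - R \<omega>) * u (X \<omega>) * (Y0 \<omega> - m0 (X \<omega>))"
proof -
  have ne: "1 - e (X \<omega>) \<noteq> 0" using e_bounds[OF assms(1)] \<kappa>_le by auto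
  have u: "1 / (1 - e (X \<omega>)) = u (X \<omega>)" using assms(1) by (simp add: u_def)
  have eu: "e (X \<omega>) * u (X \<omega>) = u (X \<omega>) - 1" unfolding u[symmetric] using ne by (simp add: field_simps)
  have "\<psi> (Z \<omega>) = \<mu>0 (X \<omega>) - \<theta>0 + (1 - R \<omega>) * (1 / (1 - e (X \<omega>))) * (Y0 \<omega> - \<mu>0 (X \<omega>))"
    using R01[OF assms(2)] by (auto simp: Z_def psi0_def observation_def obs_outcome_def)
  with R01[OF assms(2)] show ?thesis
    unfolding u eu by (auto simp: algebra_simps)
qed

lemma AE_\<psi>:
  "AE \<omega> in P. \<psi> (Z \<omega>) = (e (X \<omega>) - R \<omega>) / (1 - e (X \<omega>)) * (m0 (X \<omega>) - \<mu>0 (X \<omega>)) + m0 (X \<omega>) - \<theta>0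
     + residual m0 m1 (Z \<omega>) * (1 - R \<omega>) / (1 - e (X \<omega>))"
  using AE_X AE_space
proof eventually_elim
  case (elim \<omega>)
  have "residual m0 m1 (Z \<omega>) * (1 - R \<omega>) = (1 - R \<omega>) * (Y0 \<omega> - m0 (X \<omega>))"
    using R01[OF elim(2)] by (auto simp: Z_def residual_def observation_def obs_outcome_def)
  then have r: "residual m0 m1 (Z \<omega>) * (1 - R \<omega>) / (1 - e (X \<omega>)) = (1 - R \<omega>) * (Y0 \<omega> - m0 (X \<omega>)) / (1 - e (X \<omega>))"
    by simp
  show ?case
    using elim(1) unfolding \<psi>_Z[OF elim] r by (simp add: u_def diff_divide_distrib add_divide_distrib algebra_simps)
qed

text \<open>From \<open>(a + b + c)\<^sup>2 \<le> 3 * (a\<^sup>2 + b\<^sup>2 + c\<^sup>2)\<close>;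
  the weights in front of the misspecification and of the residual are at most 2 in absolute value,
  which turns 3 into 12. No ingredient involves \<open>R\<close> or \<open>e\<close>, so the bound
  is uniform in the sample size.\<close>

definition \<psi>_sq_bound :: real where
  "\<psi>_sq_bound = 12 * \<D>\<^sup>2 + 3 * (\<integral>\<omega>. (m0 (X \<omega>) - \<theta>0)\<^sup>2 \<partial>P) + 12 * (\<integral>\<omega>. (Y0 \<omega> - m0 (X \<omega>))\<^sup>2 \<partial>P)"

lemma \<psi>_sq_bound_nonneg: "0 \<le> \<psi>_sq_bound"
  by (simp add: \<psi>_sq_bound_def)

lemma \<psi>_sq: "integrable P (\<lambda>\<omega>. (\<psi> (Z \<omega>))\<^sup>2)"
  and \<psi>_sq_le: "(\<integral>\<omega>. (\<psi> (Z \<omega>))\<^sup>2 \<partial>P) \<le> \<psi>_sq_bound"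
proof -
  let ?B = "\<lambda>\<omega>. 12 * (m0 (X \<omega>) - \<mu>0 (X \<omega>))\<^sup>2 + 3 * (m0 (X \<omega>) - \<theta>0)\<^sup>2 + 12 * (Y0 \<omega> - m0 (X \<omega>))\<^sup>2"
  have m0c: "integrable P (\<lambda>\<omega>. (m0 (X \<omega>) - \<theta>0)\<^sup>2)"
    unfolding power2_diff using m0_sq integrable_m0 by auto
  have B: "integrable P ?B" using misspec_sq m0c residual_sq by auto
  have le: "AE \<omega> in P. (\<psi> (Z \<omega>))\<^sup>2 \<le> ?B \<omega>"
    using AE_X AE_space
  proof eventually_elim
    case (elim \<omega>)
    let ?d = "m0 (X \<omega>) - \<mu>0 (X \<omega>)"
    let ?a = "(e (X \<omega>) * u (X \<omega>) - u (X \<omega>) * R \<omega>) * ?d" and ?b = "m0 (X \<omega>) - \<theta>0"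
      and ?c = "(1 - R \<omega>) * u (X \<omega>) * (Y0 \<omega> - m0 (X \<omega>))"
    have eq: "\<psi> (Z \<omega>) = ?a + ?b + ?c"
      using \<psi>_Z[OF elim] by (simp add: algebra_simps)
    have "(?a + ?b + ?c)\<^sup>2 \<le> 3 * (?a\<^sup>2 + ?b\<^sup>2 + ?c\<^sup>2)"
    proof -
      have "0 \<le> (?a - ?b)\<^sup>2 + (?b - ?c)\<^sup>2 + (?a - ?c)\<^sup>2" by simp
      then show ?thesis by (simp add: power2_eq_square algebra_simps)
    qed
    moreover have "\<bar>e (X \<omega>) * u (X \<omega>) - u (X \<omega>) * R \<omega>\<bar> \<le> 2"
    proof -
      have "\<bar>e (X \<omega>) * u (X \<omega>)\<bar> \<le> 1" by (rule abs_e_u_le)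
      moreover have "0 \<le> e (X \<omega>) * u (X \<omega>)"
        using e_bounds[of "X \<omega>"] u_bounds[of "X \<omega>"] by (auto simp: u_def)
      moreover have "0 \<le> u (X \<omega>) * R \<omega>" "u (X \<omega>) * R \<omega> \<le> 2"
        using R01[OF elim(2)] u_bounds[of "X \<omega>"] by auto
      ultimately show ?thesis by linarith
    qed
    then have "?a\<^sup>2 \<le> 2\<^sup>2 * ?d\<^sup>2"
      unfolding power_mult_distrib using power_mono[of "\<bar>e (X \<omega>) * u (X \<omega>) - u (X \<omega>) * R \<omega>\<bar>" 2 2]
      by (intro mult_right_mono) auto
    moreover have "\<bar>(1 - R \<omega>) * u (X \<omega>)\<bar> \<le> 1 * 2"
      unfolding abs_mult using abs_R_le(2)[OF elim(2)] abs_u_le by (intro mult_mono) auto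
    then have "?c\<^sup>2 \<le> 2\<^sup>2 * (Y0 \<omega> - m0 (X \<omega>))\<^sup>2"
      unfolding power_mult_distrib[of "(1 - R \<omega>) * u (X \<omega>)"]
      using power_mono[of "\<bar>(1 - R \<omega>) * u (X \<omega>)\<bar>" 2 2]
      by (intro mult_right_mono) auto
    ultimately show ?case unfolding eq by simp
  qed
  show i: "integrable P (\<lambda>\<omega>. (\<psi> (Z \<omega>))\<^sup>2)"
  proof (rule Bochner_Integration.integrable_bound[OF B])
    show "(\<lambda>\<omega>. (\<psi> (Z \<omega>))\<^sup>2) \<in> borel_measurable P" by measurable
    show "AE \<omega> in P. norm ((\<psi> (Z \<omega>))\<^sup>2) \<le> norm (?B \<omega>)"
      using le by eventually_elim auto
  qed
  have "(\<integral>\<omega>. (\<psi> (Z \<omega>))\<^sup>2 \<partial>P) \<le> (\<integral>\<omega>. ?B \<omega> \<partial>P)"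
    by (rule integral_mono_AE[OF i B le])
  also have "\<dots> = 12 * (\<integral>\<omega>. (m0 (X \<omega>) - \<mu>0 (X \<omega>))\<^sup>2 \<partial>P) + 3 * (\<integral>\<omega>. (m0 (X \<omega>) - \<theta>0)\<^sup>2 \<partial>P)
      + 12 * (\<integral>\<omega>. (Y0 \<omega> - m0 (X \<omega>))\<^sup>2 \<partial>P)"
    using misspec_sq m0c residual_sq by simp
  also have "\<dots> \<le> \<psi>_sq_bound"
    unfolding \<psi>_sq_bound_def using misspec_sq_le by simp
  finally show "(\<integral>\<omega>. (\<psi> (Z \<omega>))\<^sup>2 \<partial>P) \<le> \<psi>_sq_bound" .
qed

lemma \<psi>_int: "integrable P (\<lambda>\<omega>. \<psi> (Z \<omega>))"
  by (rule square_integrable_imp_integrable[OF _ \<psi>_sq]) measurable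

lemma \<psi>_variance_le: "variance (\<lambda>\<omega>. \<psi> (Z \<omega>)) \<le> \<psi>_sq_bound"
  using variance_eq[OF \<psi>_int \<psi>_sq] \<psi>_sq_le by (smt (verit) zero_le_power2)

text \<open>The residual and \<open>m0 - \<theta>0\<close> integrate to 0, and \<open>R\<close> may
  be exchanged for \<pi>. What is left is a product of the two misspecification errors, which is
  double robustness.\<close>

lemma \<psi>_mean:
  "(\<integral>\<omega>. \<psi> (Z \<omega>) \<partial>P) = (\<integral>\<omega>. u (X \<omega>) * (e (X \<omega>) - \<pi> (X \<omega>)) * (m0 (X \<omega>) - \<mu>0 (X \<omega>)) \<partial>P)"
proof -
  let ?d = "\<lambda>\<omega>. m0 (X \<omega>) - \<mu>0 (X \<omega>)"
  have i1: "integrable P (\<lambda>\<omega>. e (X \<omega>) * u (X \<omega>) * ?d \<omega>)"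
    by (rule integrable_bounded_mult[where g="\<lambda>x. e x * u x", OF _ abs_e_u_le misspec_int]) measurable
  have iu: "integrable P (\<lambda>\<omega>. u (X \<omega>) * ?d \<omega>)"
    by (rule integrable_bounded_mult[OF u_measurable abs_u_le misspec_int])
  have "(\<lambda>x. u x * (m0 x - \<mu>0 x)) \<in> borel_measurable borel" by measurable
  note t = integral_treatment[OF this iu]
  note r = integral_residual[OF u_measurable abs_u_le]
  have i3: "integrable P (\<lambda>\<omega>. m0 (X \<omega>) - \<theta>0)"
    using integrable_m0 by simp
  have m0_mean: "(\<integral>\<omega>. m0 (X \<omega>) \<partial>P) = \<theta>0"
    using regression_fun_integral(2)[OF m0 X, of "\<lambda>_. 1"] integrable_Y0 by (simp add: \<theta>0_def)
  have "(\<integral>\<omega>. \<psi> (Z \<omega>) \<partial>P) = (\<integral>\<omega>. (e (X \<omega>) * u (X \<omega>) * ?d \<omega> - u (X \<omega>) * ?d \<omega> * R \<omega>)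
     + (m0 (X \<omega>) - \<theta>0) + (1 - R \<omega>) * u (X \<omega>) * (Y0 \<omega> - m0 (X \<omega>)) \<partial>P)"
  proof (rule integral_cong_AE)
    show "AE \<omega> in P. \<psi> (Z \<omega>) = (e (X \<omega>) * u (X \<omega>) * ?d \<omega> - u (X \<omega>) * ?d \<omega> * R \<omega>)
     + (m0 (X \<omega>) - \<theta>0) + (1 - R \<omega>) * u (X \<omega>) * (Y0 \<omega> - m0 (X \<omega>))"
      using AE_X AE_space by eventually_elim (rule \<psi>_Z)
  qed measurable
  also have "\<dots> = ((\<integral>\<omega>. e (X \<omega>) * u (X \<omega>) * ?d \<omega> \<partial>P) - (\<integral>\<omega>. u (X \<omega>) * ?d \<omega> * R \<omega> \<partial>P))
      + (\<integral>\<omega>. m0 (X \<omega>) - \<theta>0 \<partial>P) + (\<integral>\<omega>. (1 - R \<omega>) * u (X \<omega>) * (Y0 \<omega> - m0 (X \<omega>)) \<partial>P)"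
    using i1 t(1) i3 r(1) by (simp only: Bochner_Integration.integral_add Bochner_Integration.integral_diff
        Bochner_Integration.integrable_add Bochner_Integration.integrable_diff)
  also have "(\<integral>\<omega>. (1 - R \<omega>) * u (X \<omega>) * (Y0 \<omega> - m0 (X \<omega>)) \<partial>P) = 0" by (rule r(2))
  also have "(\<integral>\<omega>. m0 (X \<omega>) - \<theta>0 \<partial>P) = 0"
    using integrable_m0 m0_mean by (simp add: prob_space)
  also have "(\<integral>\<omega>. u (X \<omega>) * ?d \<omega> * R \<omega> \<partial>P) = (\<integral>\<omega>. u (X \<omega>) * ?d \<omega> * \<pi> (X \<omega>) \<partial>P)" by (rule t(3))
  also have "(\<integral>\<omega>. e (X \<omega>) * u (X \<omega>) * ?d \<omega> \<partial>P) - (\<integral>\<omega>. u (X \<omega>) * ?d \<omega> * \<pi> (X \<omega>) \<partial>P)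
      = (\<integral>\<omega>. e (X \<omega>) * u (X \<omega>) * ?d \<omega> - u (X \<omega>) * ?d \<omega> * \<pi> (X \<omega>) \<partial>P)"
    using i1 t(2) by (rule Bochner_Integration.integral_diff[symmetric])
  also have "\<dots> = (\<integral>\<omega>. u (X \<omega>) * (e (X \<omega>) - \<pi> (X \<omega>)) * ?d \<omega> \<partial>P)"
    by (rule Bochner_Integration.integral_cong) (auto simp: algebra_simps)
  finally show ?thesis by simp
qed

text \<open>On the support \<pi> and \<open>e\<close> both lie between 0 and \<kappa>, so they
  differ by at most \<kappa>; the 2 bounds \<open>u\<close>.\<close>

lemma abs_\<psi>_mean_le: "\<bar>\<integral>\<omega>. \<psi> (Z \<omega>) \<partial>P\<bar> \<le> 2 * \<kappa> * \<D>"
proof -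
  have le: "\<bar>u (X \<omega>) * (e (X \<omega>) - \<pi> (X \<omega>))\<bar> \<le> 2 * \<kappa>" for \<omega>
  proof (cases "X \<omega> \<in> \<X>")
    case True
    then have "\<bar>e (X \<omega>) - \<pi> (X \<omega>)\<bar> \<le> \<kappa>" using e_bounds[OF True] \<pi>_bounds[OF True] by auto
    then show ?thesis unfolding abs_mult using abs_u_le by (intro mult_mono) auto
  qed (use \<kappa>_pos in \<open>simp add: u_def\<close>)
  have "\<bar>\<integral>\<omega>. \<psi> (Z \<omega>) \<partial>P\<bar> \<le> (\<integral>\<omega>. 2 * \<kappa> * \<bar>m0 (X \<omega>) - \<mu>0 (X \<omega>)\<bar> \<partial>P)"
    unfolding \<psi>_mean
  proof (rule order.trans[OF integral_abs_bound integral_mono_AE'])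
    show "integrable P (\<lambda>\<omega>. 2 * \<kappa> * \<bar>m0 (X \<omega>) - \<mu>0 (X \<omega>)\<bar>)" using misspec_int by auto
    show "AE \<omega> in P. \<bar>u (X \<omega>) * (e (X \<omega>) - \<pi> (X \<omega>)) * (m0 (X \<omega>) - \<mu>0 (X \<omega>))\<bar> \<le> 2 * \<kappa> * \<bar>m0 (X \<omega>) - \<mu>0 (X \<omega>)\<bar>"
      using le by (intro AE_I2) (simp add: abs_mult[of "u _ * _"] mult_right_mono)
  qed (use \<kappa>_pos in simp)
  also have "\<dots> \<le> 2 * \<kappa> * \<D>"
    using misspec_abs_le \<kappa>_pos by simp
  finally show ?thesis .
qed

lemma AE_same_fun: "same_fun PX f g \<Longrightarrow> f \<in> borel_measurable borel \<Longrightarrow> g \<in> borel_measurable borel \<Longrightarrow> AE \<omega> in P. f (X \<omega>) = (g (X \<omega>) :: real)"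
  unfolding same_fun_def by (subst (asm) AE_distr_iff) auto

lemma \<psi>_mean_zero:
  assumes "same_fun PX e \<pi> \<or> same_fun PX \<mu>0 m0"
  shows "(\<integral>\<omega>. \<psi> (Z \<omega>) \<partial>P) = 0"
proof -
  have "AE \<omega> in P. u (X \<omega>) * (e (X \<omega>) - \<pi> (X \<omega>)) * (m0 (X \<omega>) - \<mu>0 (X \<omega>)) = 0"
    using assms AE_same_fun[of e \<pi>] AE_same_fun[of \<mu>0 m0] by auto
  then have "(\<integral>\<omega>. u (X \<omega>) * (e (X \<omega>) - \<pi> (X \<omega>)) * (m0 (X \<omega>) - \<mu>0 (X \<omega>)) \<partial>P) = (\<integral>\<omega>. 0 \<partial>P)"
    by (intro integral_cong_AE) auto
  then show ?thesis unfolding \<psi>_mean by simp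
qed

end

section \<open>Cross-fitted error terms\<close>

type_synonym 'p obs_learner = "nat set \<Rightarrow> (nat \<Rightarrow> 'p obs) \<Rightarrow> real ^ 'p \<Rightarrow> real"

definition dr_score :: "'p::finite obs_learner \<Rightarrow> 'p obs_learner \<Rightarrow> nat set \<Rightarrow> (nat \<Rightarrow> 'p obs) \<Rightarrow> 'p obs \<Rightarrow> real" where
  "dr_score m p J t z = m J t (snd (snd z))
     + (1 - fst z) / (1 - p J t (snd (snd z))) * (fst (snd z) - m J t (snd (snd z)))"

text \<open>Fourth term of the overview without truncation; \<open>outcome_term\<close> is the
  fifth. They become the witnesses \<open>T2\<close> and \<open>T3\<close> of the expansion, which
  must be chosen before the tolerated probability and so cannot mention truncation levels.\<close>

definition propensity_term ::
  "'p::finite obs_learner \<Rightarrow> (real ^ 'p \<Rightarrow> real) \<Rightarrow> (real ^ 'p \<Rightarrow> real) \<Rightarrow> (real ^ 'p \<Rightarrow> real) \<Rightarrow> nat set \<Rightarrow> (nat \<Rightarrow> 'p obs) \<Rightarrow> 'p obs \<Rightarrow> real" where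
  "propensity_term p e m0 \<mu>0 J t z =
     (1 - fst z) * (1 / (1 - p J t (snd (snd z))) - 1 / (1 - e (snd (snd z)))) * (m0 (snd (snd z)) - \<mu>0 (snd (snd z)))"

definition outcome_term ::
  "'p::finite obs_learner \<Rightarrow> (real ^ 'p \<Rightarrow> real) \<Rightarrow> (real ^ 'p \<Rightarrow> real) \<Rightarrow> (real ^ 'p \<Rightarrow> real) \<Rightarrow> nat set \<Rightarrow> (nat \<Rightarrow> 'p obs) \<Rightarrow> 'p obs \<Rightarrow> real" where
  "outcome_term m e \<pi> \<mu>0 J t z =
     (m J t (snd (snd z)) - \<mu>0 (snd (snd z))) * (1 / (1 - e (snd (snd z)))) * (\<pi> (snd (snd z)) - e (snd (snd z)))"

lemma dr_estimator_eq:
  "dr_estimator K mhat pihat N I z = crossfit_mean N K I z (dr_score (mhat N) (pihat N))"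
  unfolding dr_estimator_def crossfit_mean_def crossfit_def dr_score_def Let_def
  by (simp add: split_beta')

locale dr_sample = dr_nuisance P Y0 Y1 R X m0 \<pi> \<kappa> \<mu>0 e \<D>
  for P :: "'a measure" and Y0 Y1 R and X :: "'a \<Rightarrow> real ^ 'p::finite" and m0 \<pi> \<kappa> \<mu>0 e \<D> +
  fixes M :: "'w measure" and S :: "nat \<Rightarrow> 'w \<Rightarrow> 'p obs" and I :: "'w \<Rightarrow> nat \<Rightarrow> nat set"
    and N K :: nat and m p :: "'p obs_learner"
  assumes M: "prob_space M" and N: "0 < N"
    and S: "prob_space.indep_vars M (\<lambda>_. borel) S {1..N}"
    and S_distr: "\<And>i. i \<in> {1..N} \<Longrightarrow> distr M borel (S i) = law"
    and I: "\<And>\<omega>. \<omega> \<in> space M \<Longrightarrow> folds K N (I \<omega>)"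
    and SI: "indep_elements M (PiM {1..N} (\<lambda>_. borel)) (\<lambda>\<omega>. restrict (\<lambda>i. S i \<omega>) {1..N})
      (count_space UNIV) (\<lambda>\<omega>. restrict (I \<omega>) {1..K})"
    and m: "\<And>J. J \<subseteq> {1..N} \<Longrightarrow> (\<lambda>(t, x). m J t x) \<in> borel_measurable (PiM J (\<lambda>_. borel) \<Otimes>\<^sub>M borel)"
    and p: "\<And>J. J \<subseteq> {1..N} \<Longrightarrow> (\<lambda>(t, x). p J t x) \<in> borel_measurable (PiM J (\<lambda>_. borel) \<Otimes>\<^sub>M borel)"
begin

sublocale M: prob_space M by (rule M)

lemma S_measurable: "i \<in> {1..N} \<Longrightarrow> S i \<in> borel_measurable M"
  using S unfolding M.indep_vars_def2 by blast

lemma S_joint: "distr M (PiM {1..N} (\<lambda>_. borel)) (\<lambda>\<omega>. restrict (\<lambda>i. S i \<omega>) {1..N}) = iid {1..N} law"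
proof -
  have "distr M (PiM {1..N} (\<lambda>_. borel)) (\<lambda>\<omega>. restrict (\<lambda>i. S i \<omega>) {1..N}) = PiM {1..N} (\<lambda>i. distr M borel (S i))"
    using S N S_measurable by (subst (asm) M.indep_vars_iff_distr_eq_PiM') auto
  also have "\<dots> = iid {1..N} law"
    by (rule PiM_cong) (simp_all add: S_distr)
  finally show ?thesis .
qed

lemma AE_sample:
  assumes "AE z in law. G z" "{z. G z} \<in> sets borel"
  shows "AE \<omega> in M. \<forall>i\<in>{1..N}. G (S i \<omega>)"
proof (rule AE_finite_allI)
  fix i assume i: "i \<in> {1..N}"
  have "AE z in distr M borel (S i). G z" unfolding S_distr[OF i] by (rule assms(1))
  then show "AE \<omega> in M. G (S i \<omega>)"
    by (subst (asm) AE_distr_iff) (use S_measurable[OF i] assms(2) in auto)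
qed simp

lemma sets_train: "sets (iid J law \<Otimes>\<^sub>M borel) = sets (PiM J (\<lambda>_. borel) \<Otimes>\<^sub>M borel)"
  by (intro sets_pair_measure_cong sets_PiM_cong) auto

lemma learner_measurable:
  assumes "J \<subseteq> {1..N}"
  shows "(\<lambda>(t, x). m J t x) \<in> borel_measurable (iid J law \<Otimes>\<^sub>M borel)"
    and "(\<lambda>(t, x). p J t x) \<in> borel_measurable (iid J law \<Otimes>\<^sub>M borel)"
  using m[OF assms] p[OF assms] by (simp_all add: measurable_cong_sets[OF sets_train refl])

text \<open>Truncation is all or nothing in the training sample, because the hypothesis bounds only
  the norm of the fitted function and not its values.\<close>

definition \<delta> :: "real \<Rightarrow> 'p obs_learner" where
  "\<delta> tm J t x = (if L2_norm PX (\<lambda>x. m J t x - \<mu>0 x) \<le> ennreal tm then m J t x - \<mu>0 x else 0)"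

text \<open>The hypothesis on the propensity is uniform in \<open>x\<close>, so truncation can be
  done point by point; this avoids a supremum over an uncountable set and keeps the function
  measurable.\<close>

definition \<eta> :: "real \<Rightarrow> 'p obs_learner" where
  "\<eta> te J t x = (if x \<in> \<X> \<and> \<bar>p J t x - e x\<bar> \<le> te then 1 / (1 - p J t x) - 1 / (1 - e x) else 0)"

lemma \<delta>_measurable:
  assumes "J \<subseteq> {1..N}"
  shows "(\<lambda>(t, x). \<delta> tm J t x) \<in> borel_measurable (iid J law \<Otimes>\<^sub>M borel)"
proof -
  note [measurable] = learner_measurable(1)[OF assms]
  interpret PX: prob_space PX by (rule prob_space_distr) measurable
  have d [measurable]: "(\<lambda>(t, x). m J t x - \<mu>0 x) \<in> borel_measurable (iid J law \<Otimes>\<^sub>M borel)"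
    by measurable
  have s: "sets (iid J law \<Otimes>\<^sub>M PX) = sets (iid J law \<Otimes>\<^sub>M borel)"
    by (intro sets_pair_measure_cong) auto
  have [measurable]: "(\<lambda>t. L2_norm PX (\<lambda>x. m J t x - \<mu>0 x)) \<in> borel_measurable (iid J law)"
    by (rule borel_measurable_L2_norm) (use d in \<open>simp_all add: PX.sigma_finite_measure_axioms measurable_cong_sets[OF s refl]\<close>)
  show ?thesis
    unfolding \<delta>_def split_beta' by measurable
qed

lemma \<eta>_measurable:
  assumes "J \<subseteq> {1..N}"
  shows "(\<lambda>(t, x). \<eta> te J t x) \<in> borel_measurable (iid J law \<Otimes>\<^sub>M borel)"
proof -
  note [measurable] = learner_measurable(2)[OF assms]
  show ?thesis
    unfolding \<eta>_def split_beta' by measurable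
qed

lemma section_measurable:
  assumes "(\<lambda>(t, x). f t x) \<in> borel_measurable (T \<Otimes>\<^sub>M borel)" "t \<in> space T"
  shows "f t \<in> borel_measurable borel"
  using measurable_compose[OF measurable_Pair1'[OF assms(2)] assms(1)] by simp

lemma covariate_measurable:
  fixes f :: "_ \<Rightarrow> _ \<Rightarrow> real"
  assumes "(\<lambda>(t, x). f t x) \<in> borel_measurable (T \<Otimes>\<^sub>M borel)"
  shows "(\<lambda>w. f (fst w) (snd (snd (snd w)))) \<in> borel_measurable (T \<Otimes>\<^sub>M law)"
proof -
  have "(\<lambda>w. (fst w, snd (snd (snd w)))) \<in> measurable (T \<Otimes>\<^sub>M law) (T \<Otimes>\<^sub>M borel)"
    by measurable
  from measurable_compose[OF this assms] show ?thesis by simp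
qed

lemma \<delta>_sq_le:
  assumes "0 \<le> tm"
  shows "(\<integral>\<^sup>+ x. ennreal ((\<delta> tm J t x)\<^sup>2) \<partial>PX) \<le> ennreal (tm\<^sup>2)"
proof (cases "L2_norm PX (\<lambda>x. m J t x - \<mu>0 x) \<le> ennreal tm")
  case True
  with L2_norm_leD[OF this assms] show ?thesis by (simp add: \<delta>_def)
qed (simp add: \<delta>_def)

lemma \<delta>_abs_le:
  assumes tm: "0 \<le> tm" and t: "J \<subseteq> {1..N}" "t \<in> space (iid J law)"
  shows "(\<integral>\<^sup>+ x. ennreal \<bar>\<delta> tm J t x\<bar> \<partial>PX) \<le> ennreal tm"
proof -
  interpret PX: prob_space PX by (rule prob_space_distr) measurable
  have "\<delta> tm J t \<in> borel_measurable PX"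
    using section_measurable[OF \<delta>_measurable[OF t(1)] t(2)] by simp
  then show ?thesis by (rule PX.nn_integral_abs_le[OF _ \<delta>_sq_le[OF tm] tm])
qed

text \<open>Here \<open>p\<close> is at most \<open>e + te\<close>, hence at most 1/2, so the
  product of the two denominators is at least 3/8 and a fortiori 1/4.\<close>

lemma \<eta>_abs_le:
  assumes te: "0 \<le> te" "te \<le> 1 / 4"
  shows "\<bar>\<eta> te J t x\<bar> \<le> 4 * te"
proof (cases "x \<in> \<X> \<and> \<bar>p J t x - e x\<bar> \<le> te")
  case True
  then have ex: "0 < e x" "e x \<le> 1 / 4" using e_bounds[of x] \<kappa>_le by auto
  with True te have p1: "1 / 2 \<le> 1 - p J t x" and e1: "3 / 4 \<le> 1 - e x" by auto
  have "1 / (1 - p J t x) - 1 / (1 - e x) = (p J t x - e x) / ((1 - p J t x) * (1 - e x))"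
    using p1 e1 by (simp add: field_simps)
  then have "\<bar>\<eta> te J t x\<bar> = \<bar>p J t x - e x\<bar> / ((1 - p J t x) * (1 - e x))"
    using True p1 e1 by (simp add: \<eta>_def abs_mult)
  also have "\<dots> \<le> te / (1 / 4)"
  proof (rule frac_le)
    have "1 / 2 * (3 / 4) \<le> (1 - p J t x) * (1 - e x)"
      using p1 e1 by (intro mult_mono) auto
    then show "1 / 4 \<le> (1 - p J t x) * (1 - e x)" by simp
  qed (use True te in auto)
  finally show ?thesis by simp
qed (use te in \<open>auto simp: \<eta>_def\<close>)

text \<open>This and the next four definitions are the five terms of the overview, in its order,
  with truncated errors and \<open>u\<close> as the weight; the sign of the third is left to the
  decomposition.\<close>

definition treatment_noise :: "real \<Rightarrow> nat set \<Rightarrow> (nat \<Rightarrow> 'p obs) \<Rightarrow> 'p obs \<Rightarrow> real" where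
  "treatment_noise tm J t z = \<delta> tm J t (snd (snd z)) * u (snd (snd z)) * (fst z - \<pi> (snd (snd z)))"

definition residual_noise :: "real \<Rightarrow> nat set \<Rightarrow> (nat \<Rightarrow> 'p obs) \<Rightarrow> 'p obs \<Rightarrow> real" where
  "residual_noise te J t z = (1 - fst z) * \<eta> te J t (snd (snd z)) * (fst (snd z) - m0 (snd (snd z)))"

definition product_term :: "real \<Rightarrow> real \<Rightarrow> nat set \<Rightarrow> (nat \<Rightarrow> 'p obs) \<Rightarrow> 'p obs \<Rightarrow> real" where
  "product_term tm te J t z = (1 - fst z) * \<eta> te J t (snd (snd z)) * \<delta> tm J t (snd (snd z))"

definition trunc_propensity_term :: "real \<Rightarrow> nat set \<Rightarrow> (nat \<Rightarrow> 'p obs) \<Rightarrow> 'p obs \<Rightarrow> real" where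
  "trunc_propensity_term te J t z = (1 - fst z) * \<eta> te J t (snd (snd z)) * (m0 (snd (snd z)) - \<mu>0 (snd (snd z)))"

definition trunc_outcome_term :: "real \<Rightarrow> nat set \<Rightarrow> (nat \<Rightarrow> 'p obs) \<Rightarrow> 'p obs \<Rightarrow> real" where
  "trunc_outcome_term tm J t z = \<delta> tm J t (snd (snd z)) * u (snd (snd z)) * (\<pi> (snd (snd z)) - e (snd (snd z)))"

lemma
  assumes "J \<subseteq> {1..N}"
  shows treatment_noise_measurable: "(\<lambda>(t, z). treatment_noise tm J t z) \<in> borel_measurable (iid J law \<Otimes>\<^sub>M law)"
    and residual_noise_measurable: "(\<lambda>(t, z). residual_noise te J t z) \<in> borel_measurable (iid J law \<Otimes>\<^sub>M law)"
    and product_term_measurable: "(\<lambda>(t, z). product_term tm te J t z) \<in> borel_measurable (iid J law \<Otimes>\<^sub>M law)"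
    and trunc_propensity_term_measurable: "(\<lambda>(t, z). trunc_propensity_term te J t z) \<in> borel_measurable (iid J law \<Otimes>\<^sub>M law)"
    and trunc_outcome_term_measurable: "(\<lambda>(t, z). trunc_outcome_term tm J t z) \<in> borel_measurable (iid J law \<Otimes>\<^sub>M law)"
proof -
  note [measurable] = covariate_measurable[OF \<delta>_measurable[OF assms]] covariate_measurable[OF \<eta>_measurable[OF assms]]
  show "(\<lambda>(t, z). treatment_noise tm J t z) \<in> borel_measurable (iid J law \<Otimes>\<^sub>M law)"
    "(\<lambda>(t, z). residual_noise te J t z) \<in> borel_measurable (iid J law \<Otimes>\<^sub>M law)"
    "(\<lambda>(t, z). product_term tm te J t z) \<in> borel_measurable (iid J law \<Otimes>\<^sub>M law)"
    "(\<lambda>(t, z). trunc_propensity_term te J t z) \<in> borel_measurable (iid J law \<Otimes>\<^sub>M law)"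
    "(\<lambda>(t, z). trunc_outcome_term tm J t z) \<in> borel_measurable (iid J law \<Otimes>\<^sub>M law)"
    unfolding split_beta' treatment_noise_def residual_noise_def product_term_def trunc_propensity_term_def trunc_outcome_term_def by measurable
qed

abbreviation cf :: "(nat set \<Rightarrow> (nat \<Rightarrow> 'p obs) \<Rightarrow> 'p obs \<Rightarrow> real) \<Rightarrow> 'w \<Rightarrow> real" where
  "cf h \<omega> \<equiv> crossfit_mean N K (I \<omega>) (\<lambda>i. S i \<omega>) h"

lemma cf_measurable:
  assumes h: "\<And>J. J \<subseteq> {1..N} \<Longrightarrow> (\<lambda>(t, y). h J t y) \<in> borel_measurable (iid J law \<Otimes>\<^sub>M law)"
  shows "(\<lambda>\<omega>. ennreal \<bar>cf h \<omega>\<bar>) \<in> borel_measurable M"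
proof (rule crossfit_mean_random_folds(1)[OF M sets_law I SI S_joint h])
  fix j assume "folds K N j"
  \<comment> \<open>Only measurability is extracted, so the trivial bound will do.\<close>
  show "(\<integral>\<^sup>+ z. ennreal \<bar>crossfit_mean N K j z h\<bar> \<partial>iid {1..N} law) \<le> \<top>" by simp
qed

lemma cf_first_moment:
  assumes h: "\<And>J. J \<subseteq> {1..N} \<Longrightarrow> (\<lambda>(t, y). h J t y) \<in> borel_measurable (iid J law \<Otimes>\<^sub>M law)"
    and b: "\<And>J t. J \<subseteq> {1..N} \<Longrightarrow> t \<in> space (iid J law) \<Longrightarrow> (\<integral>\<^sup>+ y. ennreal \<bar>h J t y\<bar> \<partial>law) \<le> b"
  shows "(\<integral>\<^sup>+ \<omega>. ennreal \<bar>cf h \<omega>\<bar> \<partial>M) \<le> b"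
proof (rule crossfit_mean_random_folds(2)[OF M sets_law I SI S_joint h])
  fix j assume j: "folds K N j"
  show "(\<integral>\<^sup>+ z. ennreal \<bar>crossfit_mean N K j z h\<bar> \<partial>iid {1..N} law) \<le> b"
    by (rule crossfit_mean_first_moment[OF prob_space_law j h b])
qed

lemma cf_second_moment:
  assumes h: "\<And>J. J \<subseteq> {1..N} \<Longrightarrow> (\<lambda>(t, y). h J t y) \<in> borel_measurable (iid J law \<Otimes>\<^sub>M law)"
    and mean: "\<And>J t. J \<subseteq> {1..N} \<Longrightarrow> t \<in> space (iid J law) \<Longrightarrow> (\<integral> y. h J t y \<partial>law) = 0"
    and v: "\<And>J t. J \<subseteq> {1..N} \<Longrightarrow> t \<in> space (iid J law) \<Longrightarrow> (\<integral>\<^sup>+ y. ennreal ((h J t y)\<^sup>2) \<partial>law) \<le> ennreal v"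
    and "0 \<le> v"
  shows "(\<integral>\<^sup>+ \<omega>. ennreal \<bar>cf h \<omega>\<bar> \<partial>M) \<le> ennreal (real K * sqrt (v / real N))"
proof (rule crossfit_mean_random_folds(2)[OF M sets_law I SI S_joint h])
  fix j assume j: "folds K N j"
  show "(\<integral>\<^sup>+ z. ennreal \<bar>crossfit_mean N K j z h\<bar> \<partial>iid {1..N} law) \<le> ennreal (real K * sqrt (v / real N))"
    by (rule crossfit_mean_second_moment[OF prob_space_law j h mean v \<open>0 \<le> v\<close> N])
qed

lemma nn_integral_covariate_le:
  assumes [measurable]: "g \<in> borel_measurable borel" and f: "f \<in> borel_measurable law"
    and le: "\<And>\<omega>. \<omega> \<in> space P \<Longrightarrow> \<bar>f (Z \<omega>)\<bar> \<le> c * \<bar>g (X \<omega>)\<bar>" and c: "0 \<le> c"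
    and b: "(\<integral>\<^sup>+ x. ennreal \<bar>g x\<bar> \<partial>PX) \<le> ennreal b"
  shows "(\<integral>\<^sup>+ z. ennreal \<bar>f z\<bar> \<partial>law) \<le> ennreal (c * b)"
proof -
  have "(\<integral>\<^sup>+ z. ennreal \<bar>f z\<bar> \<partial>law) = (\<integral>\<^sup>+ \<omega>. ennreal \<bar>f (Z \<omega>)\<bar> \<partial>P)"
    using f by (intro nn_integral_law) auto
  also have "\<dots> \<le> (\<integral>\<^sup>+ \<omega>. ennreal c * ennreal \<bar>g (X \<omega>)\<bar> \<partial>P)"
    using le c by (intro nn_integral_mono) (simp add: ennreal_mult[symmetric] ennreal_leI)
  also have "\<dots> = ennreal c * (\<integral>\<^sup>+ \<omega>. ennreal \<bar>g (X \<omega>)\<bar> \<partial>P)"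
    by (rule nn_integral_cmult) measurable
  also have "(\<integral>\<^sup>+ \<omega>. ennreal \<bar>g (X \<omega>)\<bar> \<partial>P) = (\<integral>\<^sup>+ x. ennreal \<bar>g x\<bar> \<partial>PX)"
    by (rule nn_integral_distr[symmetric]) measurable
  also have "ennreal c * \<dots> \<le> ennreal c * ennreal b"
    using b by (rule mult_left_mono) simp
  also have "\<dots> = ennreal (c * b)" using c by (rule ennreal_mult'[symmetric])
  finally show ?thesis .
qed

text \<open>\<open>propensity_moments\<close> with the weight \<open>\<delta> * u\<close>, whose L2
  norm is at most \<open>2 * tm\<close> because \<open>u\<close> is at most 2.\<close>

lemma treatment_noise_le:
  assumes tm: "0 \<le> tm"
  shows "(\<integral>\<^sup>+ \<omega>. ennreal \<bar>cf (treatment_noise tm) \<omega>\<bar> \<partial>M) \<le> ennreal (real K * sqrt (2 * \<kappa> * (2 * tm)\<^sup>2 / real N))"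
proof (rule cf_second_moment[OF treatment_noise_measurable])
  fix J t assume J: "J \<subseteq> {1..N}" and t: "t \<in> space (iid J law)"
  have [measurable]: "\<delta> tm J t \<in> borel_measurable borel"
    using section_measurable[OF \<delta>_measurable[OF J] t] by simp
  have g: "(\<lambda>x. \<delta> tm J t x * u x) \<in> borel_measurable borel" by measurable
  have "(\<integral>\<^sup>+ x. ennreal ((\<delta> tm J t x * u x)\<^sup>2) \<partial>PX) \<le> (\<integral>\<^sup>+ x. ennreal 4 * ennreal ((\<delta> tm J t x)\<^sup>2) \<partial>PX)"
  proof (rule nn_integral_mono)
    fix x
    have "(u x)\<^sup>2 \<le> 4" using power_mono[OF abs_u_le, of x 2] by simp
    then have "(\<delta> tm J t x)\<^sup>2 * (u x)\<^sup>2 \<le> (\<delta> tm J t x)\<^sup>2 * 4" by (intro mult_left_mono) auto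
    then show "ennreal ((\<delta> tm J t x * u x)\<^sup>2) \<le> ennreal 4 * ennreal ((\<delta> tm J t x)\<^sup>2)"
      by (subst ennreal_mult[symmetric]) (auto simp: power_mult_distrib mult.commute intro!: ennreal_leI simp del: ennreal_numeral)
  qed
  also have "\<dots> = ennreal 4 * (\<integral>\<^sup>+ x. ennreal ((\<delta> tm J t x)\<^sup>2) \<partial>PX)"
    by (rule nn_integral_cmult) measurable
  also have "\<dots> \<le> ennreal 4 * ennreal (tm\<^sup>2)"
    using \<delta>_sq_le[OF tm] by (rule mult_left_mono) simp
  also have "\<dots> = ennreal ((2 * tm)\<^sup>2)" by (simp add: ennreal_mult[symmetric] power_mult_distrib del: ennreal_numeral)
  finally have b: "(\<integral>\<^sup>+ x. ennreal ((\<delta> tm J t x * u x)\<^sup>2) \<partial>PX) \<le> ennreal ((2 * tm)\<^sup>2)" .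
  have \<kappa>: "0 \<le> \<kappa>" using \<kappa>_pos by simp
  note * = propensity_moments[OF g b \<kappa>]
  show "(\<integral> z. treatment_noise tm J t z \<partial>law) = 0" unfolding treatment_noise_def by (rule *(1))
  show "(\<integral>\<^sup>+ z. ennreal ((treatment_noise tm J t z)\<^sup>2) \<partial>law) \<le> ennreal (2 * \<kappa> * (2 * tm)\<^sup>2)"
    unfolding treatment_noise_def by (rule *(2))
qed (use \<kappa>_pos in auto)

text \<open>The weight is at most \<open>4 * te\<close> pointwise and the residual variance is a
  fixed number, so after centring the size is \<open>te\<close> over the root of
  \<open>N\<close>.\<close>

lemma residual_noise_le:
  assumes te: "0 \<le> te" "te \<le> 1 / 4"
  shows "(\<integral>\<^sup>+ \<omega>. ennreal \<bar>cf (residual_noise te) \<omega>\<bar> \<partial>M)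
    \<le> ennreal (real K * sqrt ((4 * te)\<^sup>2 * (\<integral>\<omega>. (Y0 \<omega> - m0 (X \<omega>))\<^sup>2 \<partial>P) / real N))"
proof (rule cf_second_moment[OF residual_noise_measurable])
  fix J t assume J: "J \<subseteq> {1..N}" and t: "t \<in> space (iid J law)"
  have g: "\<eta> te J t \<in> borel_measurable borel"
    using section_measurable[OF \<eta>_measurable[OF J] t] by simp
  note * = residual_moments[OF g \<eta>_abs_le[OF te]]
  show "(\<integral> z. residual_noise te J t z \<partial>law) = 0" unfolding residual_noise_def by (rule *(1))
  show "(\<integral>\<^sup>+ z. ennreal ((residual_noise te J t z)\<^sup>2) \<partial>law) \<le> ennreal ((4 * te)\<^sup>2 * (\<integral>\<omega>. (Y0 \<omega> - m0 (X \<omega>))\<^sup>2 \<partial>P))"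
    unfolding residual_noise_def by (rule *(2))
qed (use te in auto)

lemma section_law_measurable:
  assumes "(\<lambda>(t, z). f t z) \<in> borel_measurable (T \<Otimes>\<^sub>M law)" "t \<in> space T"
  shows "f t \<in> borel_measurable law"
  using measurable_compose[OF measurable_Pair1'[OF assms(2)] assms(1)] by simp

text \<open>This term is not centred, so no root of \<open>N\<close> is gained: \<eta> is bounded
  pointwise, and the L1 norm of \<delta> by its L2 norm.\<close>

lemma product_term_le:
  assumes tm: "0 \<le> tm" and te: "0 \<le> te" "te \<le> 1 / 4"
  shows "(\<integral>\<^sup>+ \<omega>. ennreal \<bar>cf (product_term tm te) \<omega>\<bar> \<partial>M) \<le> ennreal (4 * te * tm)"
proof (rule cf_first_moment[OF product_term_measurable])
  fix J t assume J: "J \<subseteq> {1..N}" and t: "t \<in> space (iid J law)"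
  show "(\<integral>\<^sup>+ z. ennreal \<bar>product_term tm te J t z\<bar> \<partial>law) \<le> ennreal (4 * te * tm)"
  proof (rule nn_integral_covariate_le[OF _ _ _ _ \<delta>_abs_le[OF tm J t]])
    show "\<delta> tm J t \<in> borel_measurable borel"
      using section_measurable[OF \<delta>_measurable[OF J] t] by simp
    show "product_term tm te J t \<in> borel_measurable law"
      by (rule section_law_measurable[where f="product_term tm te J", OF product_term_measurable[OF J] t])
    fix \<omega> assume \<omega>: "\<omega> \<in> space P"
    have "\<bar>1 - R \<omega>\<bar> * \<bar>\<eta> te J t (X \<omega>)\<bar> \<le> 1 * (4 * te)"
      using abs_R_le(2)[OF \<omega>] \<eta>_abs_le[OF te] by (intro mult_mono) auto
    then show "\<bar>product_term tm te J t (Z \<omega>)\<bar> \<le> 4 * te * \<bar>\<delta> tm J t (X \<omega>)\<bar>"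
      unfolding product_term_def Z_simps abs_mult by (intro mult_right_mono) auto
  qed (use te in auto)
qed

lemma trunc_propensity_term_le:
  assumes te: "0 \<le> te" "te \<le> 1 / 4"
  shows "(\<integral>\<^sup>+ \<omega>. ennreal \<bar>cf (trunc_propensity_term te) \<omega>\<bar> \<partial>M) \<le> ennreal (4 * te * \<D>)"
proof (rule cf_first_moment[OF trunc_propensity_term_measurable])
  fix J t assume J: "J \<subseteq> {1..N}" and t: "t \<in> space (iid J law)"
  show "(\<integral>\<^sup>+ z. ennreal \<bar>trunc_propensity_term te J t z\<bar> \<partial>law) \<le> ennreal (4 * te * \<D>)"
  proof (rule nn_integral_covariate_le[OF _ _ _ _ misspec_nn_abs])
    show "trunc_propensity_term te J t \<in> borel_measurable law"
      by (rule section_law_measurable[where f="trunc_propensity_term te J", OF trunc_propensity_term_measurable[OF J] t])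
    fix \<omega> assume \<omega>: "\<omega> \<in> space P"
    have "\<bar>1 - R \<omega>\<bar> * \<bar>\<eta> te J t (X \<omega>)\<bar> \<le> 1 * (4 * te)"
      using abs_R_le(2)[OF \<omega>] \<eta>_abs_le[OF te] by (intro mult_mono) auto
    then show "\<bar>trunc_propensity_term te J t (Z \<omega>)\<bar> \<le> 4 * te * \<bar>m0 (X \<omega>) - \<mu>0 (X \<omega>)\<bar>"
      unfolding trunc_propensity_term_def Z_simps abs_mult by (intro mult_right_mono) auto
  qed (use te in auto)
qed

lemma trunc_outcome_term_le:
  assumes tm: "0 \<le> tm"
  shows "(\<integral>\<^sup>+ \<omega>. ennreal \<bar>cf (trunc_outcome_term tm) \<omega>\<bar> \<partial>M) \<le> ennreal (2 * \<kappa> * tm)"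
proof (rule cf_first_moment[OF trunc_outcome_term_measurable])
  fix J t assume J: "J \<subseteq> {1..N}" and t: "t \<in> space (iid J law)"
  show "(\<integral>\<^sup>+ z. ennreal \<bar>trunc_outcome_term tm J t z\<bar> \<partial>law) \<le> ennreal (2 * \<kappa> * tm)"
  proof (rule nn_integral_covariate_le[OF _ _ _ _ \<delta>_abs_le[OF tm J t]])
    show "\<delta> tm J t \<in> borel_measurable borel"
      using section_measurable[OF \<delta>_measurable[OF J] t] by simp
    show "trunc_outcome_term tm J t \<in> borel_measurable law"
      by (rule section_law_measurable[where f="trunc_outcome_term tm J", OF trunc_outcome_term_measurable[OF J] t])
    fix \<omega> assume \<omega>: "\<omega> \<in> space P"
    have "\<bar>u (X \<omega>) * (\<pi> (X \<omega>) - e (X \<omega>))\<bar> \<le> 2 * \<kappa>"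
    proof (cases "X \<omega> \<in> \<X>")
      case True
      then have "\<bar>\<pi> (X \<omega>) - e (X \<omega>)\<bar> \<le> \<kappa>" using e_bounds[OF True] \<pi>_bounds[OF True] by auto
      then show ?thesis unfolding abs_mult using abs_u_le by (intro mult_mono) auto
    qed (use \<kappa>_pos in \<open>simp add: u_def\<close>)
    then have "\<bar>u (X \<omega>) * (\<pi> (X \<omega>) - e (X \<omega>))\<bar> * \<bar>\<delta> tm J t (X \<omega>)\<bar> \<le> 2 * \<kappa> * \<bar>\<delta> tm J t (X \<omega>)\<bar>"
      by (rule mult_right_mono) simp
    then show "\<bar>trunc_outcome_term tm J t (Z \<omega>)\<bar> \<le> 2 * \<kappa> * \<bar>\<delta> tm J t (X \<omega>)\<bar>"
      unfolding trunc_outcome_term_def Z_simps abs_mult by (simp add: mult_ac)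
  qed (use \<kappa>_pos in auto)
qed

end

lemma outer_measure_of_AE:
  assumes "AE x in M. Q x"
  shows "outer_measure_of M {x \<in> space M. \<not> Q x} = 0"
proof -
  obtain A where A: "{x \<in> space M. \<not> Q x} \<subseteq> A" "emeasure M A = 0" "A \<in> sets M"
    using assms by (rule AE_E)
  have "outer_measure_of M {x \<in> space M. \<not> Q x} \<le> outer_measure_of M A"
    using A(1) by (rule outer_measure_of_mono)
  then show ?thesis using A by simp
qed

section \<open>Exact decomposition of the estimator and domination of its remainder\<close>

context dr_sample
begin

lemma score_decomposition:
  assumes x: "snd (snd z) \<in> \<X>" and tm: "L2_norm PX (\<lambda>x. m J t x - \<mu>0 x) \<le> ennreal tm"
    and te: "\<bar>p J t (snd (snd z)) - e (snd (snd z))\<bar> \<le> te"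
  shows "dr_score m p J t z - \<theta>0 - \<psi> z = treatment_noise tm J t z + residual_noise te J t z - product_term tm te J t z + trunc_propensity_term te J t z + trunc_outcome_term tm J t z"
    and "propensity_term p e m0 \<mu>0 J t z = trunc_propensity_term te J t z"
    and "outcome_term m e \<pi> \<mu>0 J t z = trunc_outcome_term tm J t z"
proof -
  obtain r y c where z: "z = (r, y, c)" by (cases z) auto
  have c: "c \<in> \<X>" using x by (simp add: z)
  have ne: "1 - e c \<noteq> 0" using e_bounds[OF c] \<kappa>_le by auto
  define w where "w = 1 / (1 - e c)"
  define q where "q = 1 / (1 - p J t c)"
  have ew: "e c * w = w - 1" using ne by (simp add: w_def field_simps)
  have u: "u c = w" using c by (simp add: u_def w_def)
  have \<delta>: "\<delta> tm J t c = m J t c - \<mu>0 c" using tm by (simp add: \<delta>_def)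
  have \<eta>: "\<eta> te J t c = q - w" using c te by (simp add: \<eta>_def q_def w_def z)
  have "dr_score m p J t z - \<theta>0 - \<psi> z = (m J t c + (1 - r) * q * (y - m J t c)) - (\<mu>0 c + (1 - r) * w * (y - \<mu>0 c))"
    by (simp add: dr_score_def psi0_def z q_def w_def)
  also have "\<dots> = (m J t c - \<mu>0 c) * (r * w - (w - 1)) + (1 - r) * (q - w) * (y - \<mu>0 c) - (1 - r) * (q - w) * (m J t c - \<mu>0 c)"
    by (simp add: algebra_simps)
  \<comment> \<open>By \<open>ew\<close> the factor \<open>r * w - (w - 1)\<close> is
    \<open>w * (r - e)\<close>, which is split at \<pi>; likewise \<open>y - \<mu>0\<close> is split
    at \<open>m0\<close>.\<close>
  also have "\<dots> = treatment_noise tm J t z + residual_noise te J t z - product_term tm te J t z + trunc_propensity_term te J t z + trunc_outcome_term tm J t z"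
    unfolding ew[symmetric] treatment_noise_def residual_noise_def product_term_def trunc_propensity_term_def trunc_outcome_term_def by (simp add: z u \<delta> \<eta> algebra_simps)
  finally show "dr_score m p J t z - \<theta>0 - \<psi> z = treatment_noise tm J t z + residual_noise te J t z - product_term tm te J t z + trunc_propensity_term te J t z + trunc_outcome_term tm J t z" .
  show "propensity_term p e m0 \<mu>0 J t z = trunc_propensity_term te J t z"
    unfolding propensity_term_def trunc_propensity_term_def by (simp add: z \<eta> q_def w_def)
  show "outcome_term m e \<pi> \<mu>0 J t z = trunc_outcome_term tm J t z"
    unfolding outcome_term_def trunc_outcome_term_def by (simp add: z \<delta> u w_def)
qed

text \<open>Correct specification is an almost everywhere statement, whereas the estimator evaluates
  the functions at the sample points. Almost surely all \<open>N\<close> points satisfy the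
  equalities in force.\<close>

definition good_obs :: "'p obs \<Rightarrow> bool" where
  "good_obs z \<longleftrightarrow> snd (snd z) \<in> \<X>
     \<and> (same_fun PX m0 \<mu>0 \<longrightarrow> m0 (snd (snd z)) = \<mu>0 (snd (snd z)))
     \<and> (same_fun PX e \<pi> \<longrightarrow> e (snd (snd z)) = \<pi> (snd (snd z)))"

lemma AE_good_obs: "AE \<omega> in M. \<forall>i\<in>{1..N}. good_obs (S i \<omega>)"
proof (rule AE_sample)
  have "{z \<in> space law. good_obs z} \<in> sets law" unfolding good_obs_def by measurable
  then show b: "{z. good_obs z} \<in> sets borel" by (simp add: law_def)
  have "AE \<omega> in P. same_fun PX m0 \<mu>0 \<longrightarrow> m0 (X \<omega>) = \<mu>0 (X \<omega>)"
    using AE_same_fun[of m0 \<mu>0] by (cases "same_fun PX m0 \<mu>0") auto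
  moreover have "AE \<omega> in P. same_fun PX e \<pi> \<longrightarrow> e (X \<omega>) = \<pi> (X \<omega>)"
    using AE_same_fun[of e \<pi>] by (cases "same_fun PX e \<pi>") auto
  ultimately have "AE \<omega> in P. good_obs (Z \<omega>)"
    using AE_X unfolding good_obs_def Z_simps by eventually_elim auto
  then show "AE z in law. good_obs z"
    unfolding law_def using b by (subst AE_distr_iff) auto
qed

lemma cf_cong:
  assumes \<omega>: "\<omega> \<in> space M"
    and eq: "\<And>i k. i \<in> {1..N} \<Longrightarrow> k \<in> {1..K} \<Longrightarrow>
      h ({1..N} - I \<omega> k) (restrict (\<lambda>i. S i \<omega>) ({1..N} - I \<omega> k)) (S i \<omega>)
      = h' ({1..N} - I \<omega> k) (restrict (\<lambda>i. S i \<omega>) ({1..N} - I \<omega> k)) (S i \<omega>)"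
  shows "cf h \<omega> = cf h' \<omega>"
  unfolding crossfit_mean_def
  by (intro arg_cong2[where f="(*)"] refl sum.cong eq fold_index(1)[OF I[OF \<omega>]])

lemma cf_add: "cf (\<lambda>J t z. h J t z + h' J t z) \<omega> = cf h \<omega> + cf h' \<omega>"
  by (simp add: crossfit_mean_def sum.distrib distrib_left)

lemma cf_diff: "cf (\<lambda>J t z. h J t z - h' J t z) \<omega> = cf h \<omega> - cf h' \<omega>"
  by (simp add: crossfit_mean_def sum_subtractf right_diff_distrib)

lemma cf_const: "cf (\<lambda>J t z. f z) \<omega> = sample_mean N f (\<lambda>i. S i \<omega>)"
  by (simp add: crossfit_mean_def sample_mean_def)

lemma sample_mean_const: "sample_mean N (\<lambda>_. a) z = (a :: real)"
  using N by (simp add: sample_mean_def)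

lemma estimator_decomposition:
  assumes \<omega>: "\<omega> \<in> space M" and good: "\<forall>i\<in>{1..N}. good_obs (S i \<omega>)"
    and tm: "\<And>k. k \<in> {1..K} \<Longrightarrow> L2_norm PX (\<lambda>x. m ({1..N} - I \<omega> k) (restrict (\<lambda>i. S i \<omega>) ({1..N} - I \<omega> k)) x - \<mu>0 x) \<le> ennreal tm"
    and te: "\<And>k x. k \<in> {1..K} \<Longrightarrow> x \<in> \<X> \<Longrightarrow> \<bar>p ({1..N} - I \<omega> k) (restrict (\<lambda>i. S i \<omega>) ({1..N} - I \<omega> k)) x - e x\<bar> \<le> te"
  shows "cf (dr_score m p) \<omega> - \<theta>0 - sample_mean N \<psi> (\<lambda>i. S i \<omega>)
      = cf (treatment_noise tm) \<omega> + cf (residual_noise te) \<omega> - cf (product_term tm te) \<omega>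
        + of_bool (\<not> same_fun PX m0 \<mu>0) * cf (trunc_propensity_term te) \<omega> + of_bool (\<not> same_fun PX e \<pi>) * cf (trunc_outcome_term tm) \<omega>"
    and "cf (propensity_term p e m0 \<mu>0) \<omega> = cf (trunc_propensity_term te) \<omega>"
    and "cf (outcome_term m e \<pi> \<mu>0) \<omega> = cf (trunc_outcome_term tm) \<omega>"
proof -
  have x: "snd (snd (S i \<omega>)) \<in> \<X>" if "i \<in> {1..N}" for i
    using good that by (auto simp: good_obs_def)
  note d = score_decomposition[OF x tm te]
  show "cf (propensity_term p e m0 \<mu>0) \<omega> = cf (trunc_propensity_term te) \<omega>"
    by (rule cf_cong[OF \<omega>]) (rule d(2)[OF _ _ _ x], assumption+)
  show "cf (outcome_term m e \<pi> \<mu>0) \<omega> = cf (trunc_outcome_term tm) \<omega>"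
    by (rule cf_cong[OF \<omega>]) (rule d(3)[OF _ _ _ x], assumption+)
  \<comment> \<open>If the outcome model is correct, every summand vanishes at good observations, so
    the indicator can be inserted for free; the next fact does the same for the propensity.\<close>
  have P: "cf (trunc_propensity_term te) \<omega> = of_bool (\<not> same_fun PX m0 \<mu>0) * cf (trunc_propensity_term te) \<omega>"
  proof (cases "same_fun PX m0 \<mu>0")
    case True
    have "cf (trunc_propensity_term te) \<omega> = cf (\<lambda>J t z. 0) \<omega>"
      by (rule cf_cong[OF \<omega>]) (use good True in \<open>auto simp: trunc_propensity_term_def good_obs_def\<close>)
    also have "\<dots> = 0" by (simp add: crossfit_mean_def)
    finally show ?thesis by simp
  qed simp
  have O: "cf (trunc_outcome_term tm) \<omega> = of_bool (\<not> same_fun PX e \<pi>) * cf (trunc_outcome_term tm) \<omega>"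
  proof (cases "same_fun PX e \<pi>")
    case True
    have "cf (trunc_outcome_term tm) \<omega> = cf (\<lambda>J t z. 0) \<omega>"
      by (rule cf_cong[OF \<omega>]) (use good True in \<open>auto simp: trunc_outcome_term_def good_obs_def\<close>)
    also have "\<dots> = 0" by (simp add: crossfit_mean_def)
    finally show ?thesis by simp
  qed simp
  have "cf (dr_score m p) \<omega> - \<theta>0 - sample_mean N \<psi> (\<lambda>i. S i \<omega>) = cf (\<lambda>J t z. dr_score m p J t z - \<theta>0 - \<psi> z) \<omega>"
    by (simp add: cf_diff cf_const sample_mean_const)
  also have "\<dots> = cf (\<lambda>J t z. treatment_noise tm J t z + residual_noise te J t z - product_term tm te J t z + trunc_propensity_term te J t z + trunc_outcome_term tm J t z) \<omega>"
    by (rule cf_cong[OF \<omega>]) (rule d(1)[OF _ _ _ x], assumption+)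
  also have "\<dots> = cf (treatment_noise tm) \<omega> + cf (residual_noise te) \<omega> - cf (product_term tm te) \<omega> + cf (trunc_propensity_term te) \<omega> + cf (trunc_outcome_term tm) \<omega>"
    by (simp add: cf_add cf_diff)
  finally show "cf (dr_score m p) \<omega> - \<theta>0 - sample_mean N \<psi> (\<lambda>i. S i \<omega>)
      = cf (treatment_noise tm) \<omega> + cf (residual_noise te) \<omega> - cf (product_term tm te) \<omega>
        + of_bool (\<not> same_fun PX m0 \<mu>0) * cf (trunc_propensity_term te) \<omega> + of_bool (\<not> same_fun PX e \<pi>) * cf (trunc_outcome_term tm) \<omega>"
    unfolding P[symmetric] O[symmetric] .
qed

text \<open>The exceptional set is enlarged by the null event of bad observations. Off it the
  decomposition is exact, and truncated terms serve as measurable majorants of the untruncated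
  ones.\<close>

lemma remainder_bounds:
  assumes E0: "E0 \<subseteq> space M" "outer_measure_of M E0 \<le> ennreal \<epsilon>"
    and tm0: "0 \<le> tm" and te0: "0 \<le> te" "te \<le> 1 / 4"
    and tm: "\<And>k \<omega>. \<omega> \<in> space M - E0 \<Longrightarrow> k \<in> {1..K} \<Longrightarrow>
      L2_norm PX (\<lambda>x. m ({1..N} - I \<omega> k) (restrict (\<lambda>i. S i \<omega>) ({1..N} - I \<omega> k)) x - \<mu>0 x) \<le> ennreal tm"
    and te: "\<And>k x \<omega>. \<omega> \<in> space M - E0 \<Longrightarrow> k \<in> {1..K} \<Longrightarrow> x \<in> \<X> \<Longrightarrow>
      \<bar>p ({1..N} - I \<omega> k) (restrict (\<lambda>i. S i \<omega>) ({1..N} - I \<omega> k)) x - e x\<bar> \<le> te"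
  shows "dominated_off M (\<lambda>\<omega>. cf (dr_score m p) \<omega> - \<theta>0 - sample_mean N \<psi> (\<lambda>i. S i \<omega>)
        - of_bool (\<not> same_fun PX m0 \<mu>0) * cf (propensity_term p e m0 \<mu>0) \<omega>
        - of_bool (\<not> same_fun PX e \<pi>) * cf (outcome_term m e \<pi> \<mu>0) \<omega>) \<epsilon>
      (real K * sqrt (2 * \<kappa> * (2 * tm)\<^sup>2 / real N)
        + real K * sqrt ((4 * te)\<^sup>2 * (\<integral>\<omega>. (Y0 \<omega> - m0 (X \<omega>))\<^sup>2 \<partial>P) / real N) + 4 * te * tm)"
    and "dominated_off M (cf (propensity_term p e m0 \<mu>0)) \<epsilon> (4 * te * \<D>)"
    and "dominated_off M (cf (outcome_term m e \<pi> \<mu>0)) \<epsilon> (2 * \<kappa> * tm)"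
proof -
  let ?rem = "\<lambda>\<omega>. cf (dr_score m p) \<omega>
    - \<theta>0
    - sample_mean N \<psi> (\<lambda>i. S i \<omega>)
    - of_bool (\<not> same_fun PX m0 \<mu>0) * cf (propensity_term p e m0 \<mu>0) \<omega>
    - of_bool (\<not> same_fun PX e \<pi>) * cf (outcome_term m e \<pi> \<mu>0) \<omega>"
  let ?rate = "real K * sqrt (2 * \<kappa> * (2 * tm)\<^sup>2 / real N)
      + real K * sqrt ((4 * te)\<^sup>2 * (\<integral>\<omega>. (Y0 \<omega> - m0 (X \<omega>))\<^sup>2 \<partial>P) / real N) + 4 * te * tm"
  let ?N = "{\<omega> \<in> space M. \<not> (\<forall>i\<in>{1..N}. good_obs (S i \<omega>))}"
  let ?E = "E0 \<union> ?N"
  let ?W1 = "\<lambda>\<omega>. ennreal \<bar>cf (treatment_noise tm) \<omega>\<bar> + ennreal \<bar>cf (residual_noise te) \<omega>\<bar> + ennreal \<bar>cf (product_term tm te) \<omega>\<bar>"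
  let ?W2 = "\<lambda>\<omega>. ennreal \<bar>cf (trunc_propensity_term te) \<omega>\<bar>" and ?W3 = "\<lambda>\<omega>. ennreal \<bar>cf (trunc_outcome_term tm) \<omega>\<bar>"
  note [measurable] = cf_measurable[OF treatment_noise_measurable] cf_measurable[OF residual_noise_measurable] cf_measurable[OF product_term_measurable]
    cf_measurable[OF trunc_propensity_term_measurable] cf_measurable[OF trunc_outcome_term_measurable]
  have E: "?E \<subseteq> space M" using E0 by auto
  have "outer_measure_of M ?E \<le> outer_measure_of M E0 + outer_measure_of M ?N"
    using E0 by (intro outer_measure_of_Un_le) auto
  also have "outer_measure_of M ?N = 0"
    by (rule outer_measure_of_AE[OF AE_good_obs])
  finally have oE: "outer_measure_of M ?E \<le> ennreal \<epsilon>" using E0(2) by simp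
  have "(\<integral>\<^sup>+\<omega>. ?W1 \<omega> \<partial>M) = (\<integral>\<^sup>+\<omega>. ennreal \<bar>cf (treatment_noise tm) \<omega>\<bar> \<partial>M) + (\<integral>\<^sup>+\<omega>. ennreal \<bar>cf (residual_noise te) \<omega>\<bar> \<partial>M)
      + (\<integral>\<^sup>+\<omega>. ennreal \<bar>cf (product_term tm te) \<omega>\<bar> \<partial>M)"
    by (subst nn_integral_add, measurable, subst nn_integral_add, measurable)
  also have "\<dots> \<le> ennreal (real K * sqrt (2 * \<kappa> * (2 * tm)\<^sup>2 / real N))
      + ennreal (real K * sqrt ((4 * te)\<^sup>2 * (\<integral>\<omega>. (Y0 \<omega> - m0 (X \<omega>))\<^sup>2 \<partial>P) / real N)) + ennreal (4 * te * tm)"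
    using treatment_noise_le[OF tm0] residual_noise_le[OF te0] product_term_le[OF tm0 te0] by (intro add_mono)
  also have "\<dots> = ennreal ?rate"
    using tm0 te0 \<kappa>_pos by (subst ennreal_plus[symmetric], simp_all add: zero_le_mult_iff)+
  finally have W1: "(\<integral>\<^sup>+\<omega>. ?W1 \<omega> \<partial>M) \<le> ennreal ?rate" .
  have bounds: "ennreal \<bar>?rem \<omega>\<bar> \<le> ?W1 \<omega>
        \<and> ennreal \<bar>cf (propensity_term p e m0 \<mu>0) \<omega>\<bar> \<le> ?W2 \<omega>
        \<and> ennreal \<bar>cf (outcome_term m e \<pi> \<mu>0) \<omega>\<bar> \<le> ?W3 \<omega>" if "\<omega> \<in> space M - ?E" for \<omega>
  proof -
    have \<omega>: "\<omega> \<in> space M" "\<omega> \<in> space M - E0" and good: "\<forall>i\<in>{1..N}. good_obs (S i \<omega>)"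
      using that by auto
    have d: "cf (dr_score m p) \<omega> - \<theta>0 - sample_mean N \<psi> (\<lambda>i. S i \<omega>)
        = cf (treatment_noise tm) \<omega> + cf (residual_noise te) \<omega> - cf (product_term tm te) \<omega>
          + of_bool (\<not> same_fun PX m0 \<mu>0) * cf (trunc_propensity_term te) \<omega> + of_bool (\<not> same_fun PX e \<pi>) * cf (trunc_outcome_term tm) \<omega>"
      "cf (propensity_term p e m0 \<mu>0) \<omega> = cf (trunc_propensity_term te) \<omega>"
      "cf (outcome_term m e \<pi> \<mu>0) \<omega> = cf (trunc_outcome_term tm) \<omega>"
      by (rule estimator_decomposition[OF \<omega>(1) good tm[OF \<omega>(2)] te[OF \<omega>(2)]]; assumption)+
    have "\<bar>cf (treatment_noise tm) \<omega> + cf (residual_noise te) \<omega> - cf (product_term tm te) \<omega>\<bar> \<le> \<bar>cf (treatment_noise tm) \<omega>\<bar> + \<bar>cf (residual_noise te) \<omega>\<bar> + \<bar>cf (product_term tm te) \<omega>\<bar>"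
      by linarith
    then have "ennreal \<bar>cf (treatment_noise tm) \<omega> + cf (residual_noise te) \<omega> - cf (product_term tm te) \<omega>\<bar>
        \<le> ennreal (\<bar>cf (treatment_noise tm) \<omega>\<bar> + \<bar>cf (residual_noise te) \<omega>\<bar> + \<bar>cf (product_term tm te) \<omega>\<bar>)" by (rule ennreal_leI)
    also have "\<dots> = ?W1 \<omega>" by simp
    finally have le: "ennreal \<bar>cf (treatment_noise tm) \<omega> + cf (residual_noise te) \<omega> - cf (product_term tm te) \<omega>\<bar> \<le> ?W1 \<omega>" .
    \<comment> \<open>Off the exceptional set truncated and untruncated misspecification terms
      agree, so subtracting the latter leaves just the first three terms.\<close>
    have eq: "?rem \<omega>
        = cf (treatment_noise tm) \<omega> + cf (residual_noise te) \<omega> - cf (product_term tm te) \<omega>"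
      unfolding d(2,3) using d(1) by linarith
    show ?thesis unfolding eq unfolding d(2,3) using le by blast
  qed
  have W1m: "?W1 \<in> borel_measurable M" by measurable
  have W2m: "?W2 \<in> borel_measurable M" by (rule cf_measurable[OF trunc_propensity_term_measurable])
  have W3m: "?W3 \<in> borel_measurable M" by (rule cf_measurable[OF trunc_outcome_term_measurable])
  show "dominated_off M ?rem \<epsilon>
      ?rate"
    unfolding dominated_off_def using E oE W1m W1 bounds
    by (intro exI[of _ ?E] exI[of _ ?W1]) blast
  show "dominated_off M (cf (propensity_term p e m0 \<mu>0)) \<epsilon> (4 * te * \<D>)"
    unfolding dominated_off_def using E oE W2m trunc_propensity_term_le[OF te0] bounds
    by (intro exI[of _ ?E] exI[of _ ?W2]) blast
  show "dominated_off M (cf (outcome_term m e \<pi> \<mu>0)) \<epsilon> (2 * \<kappa> * tm)"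
    unfolding dominated_off_def using E oE W3m trunc_outcome_term_le[OF tm0] bounds
    by (intro exI[of _ ?E] exI[of _ ?W3]) blast
qed

section \<open>The sample mean of the influence function\<close>

lemma sample_mean_\<psi>_measurable: "(\<lambda>\<omega>. sample_mean N \<psi> (\<lambda>i. S i \<omega>)) \<in> borel_measurable M"
  unfolding sample_mean_def
  by (intro borel_measurable_times borel_measurable_const borel_measurable_sum
      measurable_compose[OF S_measurable \<psi>_measurable])

abbreviation "\<psi>_mean_value \<equiv> (\<integral>\<omega>. \<psi> (Z \<omega>) \<partial>P)"

text \<open>A plain mean is the case of an empty training part, so
  \<open>second_moment_train_test\<close> with \<open>J = {}\<close> applies to the centred
  function.\<close>

lemma sample_mean_\<psi>_sq:
  shows "integrable M (\<lambda>\<omega>. (sample_mean N \<psi> (\<lambda>i. S i \<omega>) - \<psi>_mean_value)\<^sup>2)"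
    and "(\<integral>\<omega>. (sample_mean N \<psi> (\<lambda>i. S i \<omega>) - \<psi>_mean_value)\<^sup>2 \<partial>M) \<le> \<psi>_sq_bound / real N"
proof -
  interpret law: prob_space law by (rule prob_space_law)
  let ?h = "\<lambda>w :: (nat \<Rightarrow> 'p obs) \<times> 'p obs. \<psi> (snd w) - \<psi>_mean_value"
  let ?U = "\<lambda>\<omega>. restrict (\<lambda>i. S i \<omega>) {1..N}"
  have \<psi>_law [measurable]: "\<psi> \<in> borel_measurable law"
    by (simp add: measurable_cong_sets[OF sets_law refl])
  have int_\<psi>: "integrable law \<psi>"
    unfolding law_def using \<psi>_int by (subst integrable_distr_eq) auto
  have mean: "(\<integral>z. \<psi> z - \<psi>_mean_value \<partial>law) = 0"
    using int_\<psi> integral_law[OF \<psi>_law] by (simp add: law.prob_space)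
  have sq_int: "integrable P (\<lambda>\<omega>. (\<psi> (Z \<omega>) - \<psi>_mean_value)\<^sup>2)"
    unfolding power2_diff using \<psi>_int \<psi>_sq by auto
  have v: "(\<integral>\<^sup>+z. ennreal ((\<psi> z - \<psi>_mean_value)\<^sup>2) \<partial>law) \<le> ennreal \<psi>_sq_bound"
  proof -
    have "(\<integral>\<^sup>+z. ennreal ((\<psi> z - \<psi>_mean_value)\<^sup>2) \<partial>law) = (\<integral>\<^sup>+\<omega>. ennreal ((\<psi> (Z \<omega>) - \<psi>_mean_value)\<^sup>2) \<partial>P)"
      by (rule nn_integral_law) measurable
    also have "\<dots> = ennreal (variance (\<lambda>\<omega>. \<psi> (Z \<omega>)))"
      using sq_int by (rule nn_integral_eq_integral) simp
    finally show ?thesis using \<psi>_variance_le by (simp add: ennreal_leI)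
  qed
  have h: "?h \<in> borel_measurable (iid {} law \<Otimes>\<^sub>M law)"
    by measurable
  note * = second_moment_train_test[OF prob_space_law finite_atLeastAtMost[of 1 N] empty_subsetI subset_refl _ h,
      of \<psi>_sq_bound, simplified, OF mean v \<psi>_sq_bound_nonneg]
  have U: "?U \<in> measurable M (PiM {1..N} (\<lambda>_. borel))"
    by (intro measurable_restrict S_measurable)
  have eq: "(sample_mean N \<psi> (\<lambda>i. S i \<omega>) - \<psi>_mean_value)\<^sup>2
      = (1 / (real N)\<^sup>2) * (\<Sum>i=1..N. \<psi> (?U \<omega> i) - \<psi>_mean_value)\<^sup>2" for \<omega>
  proof -
    have "sample_mean N \<psi> (\<lambda>i. S i \<omega>) - \<psi>_mean_value = (1 / real N) * (\<Sum>i=1..N. \<psi> (?U \<omega> i) - \<psi>_mean_value)"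
      using N by (simp add: sample_mean_def sum_subtractf field_simps)
    then show ?thesis by (simp add: power_mult_distrib power_divide)
  qed
  let ?F = "\<lambda>z. (\<Sum>i=1..N. \<psi> (z i) - \<psi>_mean_value)\<^sup>2"
  have F: "?F \<in> borel_measurable (PiM {1..N} (\<lambda>_. borel))" by measurable
  have iF: "integrable (distr M (PiM {1..N} (\<lambda>_. borel)) ?U) ?F"
    and lF: "(\<integral>z. ?F z \<partial>distr M (PiM {1..N} (\<lambda>_. borel)) ?U) \<le> real N * \<psi>_sq_bound"
    unfolding S_joint using * by simp_all
  have iM: "integrable M (\<lambda>\<omega>. ?F (?U \<omega>))"
    using iF integrable_distr_eq[OF U F] by simp
  show "integrable M (\<lambda>\<omega>. (sample_mean N \<psi> (\<lambda>i. S i \<omega>) - \<psi>_mean_value)\<^sup>2)"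
    unfolding eq using iM by (rule integrable_mult_right)
  have "(\<integral>\<omega>. (sample_mean N \<psi> (\<lambda>i. S i \<omega>) - \<psi>_mean_value)\<^sup>2 \<partial>M) = (1 / (real N)\<^sup>2) * (\<integral>\<omega>. ?F (?U \<omega>) \<partial>M)"
    unfolding eq by (rule integral_mult_right_zero)
  also have "(\<integral>\<omega>. ?F (?U \<omega>) \<partial>M) = (\<integral>z. ?F z \<partial>distr M (PiM {1..N} (\<lambda>_. borel)) ?U)"
    by (rule integral_distr[OF U F, symmetric])
  also have "(1 / (real N)\<^sup>2) * \<dots> \<le> (1 / (real N)\<^sup>2) * (real N * \<psi>_sq_bound)"
    using lF by (rule mult_left_mono) simp
  also have "\<dots> = \<psi>_sq_bound / real N" using N by (simp add: power2_eq_square)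
  finally show "(\<integral>\<omega>. (sample_mean N \<psi> (\<lambda>i. S i \<omega>) - \<psi>_mean_value)\<^sup>2 \<partial>M) \<le> \<psi>_sq_bound / real N" .
qed

lemma sample_mean_\<psi>_int: "integrable M (\<lambda>\<omega>. sample_mean N \<psi> (\<lambda>i. S i \<omega>))"
proof -
  have "integrable M (\<lambda>\<omega>. sample_mean N \<psi> (\<lambda>i. S i \<omega>) - \<psi>_mean_value)"
    by (rule M.square_integrable_imp_integrable[OF _ sample_mean_\<psi>_sq(1)])
       (intro borel_measurable_diff sample_mean_\<psi>_measurable borel_measurable_const)
  from Bochner_Integration.integrable_add[OF this, of "\<lambda>_. \<psi>_mean_value"] show ?thesis by simp
qed

lemma sample_mean_\<psi>_square_integrable: "square_integrable M (\<lambda>\<omega>. sample_mean N \<psi> (\<lambda>i. S i \<omega>))"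
  unfolding square_integrable_def
proof
  have "integrable M (\<lambda>\<omega>. (sample_mean N \<psi> (\<lambda>i. S i \<omega>) - \<psi>_mean_value)\<^sup>2
      + (2 * \<psi>_mean_value) * sample_mean N \<psi> (\<lambda>i. S i \<omega>) - \<psi>_mean_value\<^sup>2)"
    using sample_mean_\<psi>_sq(1) sample_mean_\<psi>_int by auto
  then show "integrable M (\<lambda>\<omega>. (sample_mean N \<psi> (\<lambda>i. S i \<omega>))\<^sup>2)"
    by (simp add: power2_diff algebra_simps)
qed (rule sample_mean_\<psi>_measurable)

text \<open>The variance is the smallest mean squared deviation over all centres, so the expectation
  under \<open>M\<close> does not have to be identified with
  \<open>\<psi>_mean_value\<close>.\<close>

lemma sample_mean_\<psi>_variance: "M.variance (\<lambda>\<omega>. sample_mean N \<psi> (\<lambda>i. S i \<omega>)) \<le> \<psi>_sq_bound / real N"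
proof -
  let ?s = "\<lambda>\<omega>. sample_mean N \<psi> (\<lambda>i. S i \<omega>)"
  have "M.variance ?s = (\<integral>\<omega>. (?s \<omega> - \<psi>_mean_value)\<^sup>2 \<partial>M) - (M.expectation ?s - \<psi>_mean_value)\<^sup>2"
  proof -
    have sq: "integrable M (\<lambda>\<omega>. (?s \<omega>)\<^sup>2)"
      using sample_mean_\<psi>_square_integrable by (simp add: square_integrable_def)
    have *: "(\<integral>\<omega>. (?s \<omega> - a)\<^sup>2 \<partial>M) = (\<integral>\<omega>. (?s \<omega>)\<^sup>2 \<partial>M) + a\<^sup>2 - 2 * M.expectation ?s * a" for a
      unfolding power2_diff using sq sample_mean_\<psi>_int by (simp add: M.prob_space)
    show ?thesis unfolding * by (simp add: power2_eq_square algebra_simps)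
  qed
  also have "\<dots> \<le> (\<integral>\<omega>. (?s \<omega> - \<psi>_mean_value)\<^sup>2 \<partial>M)" by simp
  also have "\<dots> \<le> \<psi>_sq_bound / real N" by (rule sample_mean_\<psi>_sq(2))
  finally show ?thesis .
qed

lemma sample_mean_\<psi>_deviation:
  "(\<integral>\<^sup>+\<omega>. ennreal \<bar>sample_mean N \<psi> (\<lambda>i. S i \<omega>) - \<psi>_mean_value\<bar> \<partial>M) \<le> ennreal (sqrt (\<psi>_sq_bound / real N))"
  by (rule M.nn_integral_abs_le_sqrt[OF sample_mean_\<psi>_sq(1) _ sample_mean_\<psi>_sq(2)])
     (intro borel_measurable_diff sample_mean_\<psi>_measurable borel_measurable_const)

end

section \<open>Asymptotic expansion\<close>

text \<open>Gives all folds one common level \<open>T'\<close> by a union bound. The summands 1 in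
  \<epsilon>' and in \<open>T'\<close> keep the denominator and the level positive when
  \<open>A\<close> is empty.\<close>

lemma enn_Op_UN:
  assumes A: "finite A" and V: "\<And>k. k \<in> A \<Longrightarrow> enn_Op M (V k) a" and a: "\<And>N. 0 \<le> a N" and \<epsilon>: "0 < \<epsilon>"
  shows "\<exists>T>0. \<forall>\<^sub>F N in sequentially.
    outer_measure_of (M N) (\<Union>k\<in>A. {\<omega> \<in> space (M N). V k N \<omega> > ennreal (T * a N)}) \<le> ennreal \<epsilon>"
proof -
  define \<epsilon>' where "\<epsilon>' = \<epsilon> / (real (card A) + 1)"
  have \<epsilon>': "0 < \<epsilon>'" using \<epsilon> by (simp add: \<epsilon>'_def add_nonneg_pos)
  have "\<forall>k\<in>A. \<exists>T>0. \<forall>\<^sub>F N in sequentially.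
      outer_measure_of (M N) {\<omega> \<in> space (M N). V k N \<omega> > ennreal (T * a N)} \<le> ennreal \<epsilon>'"
    using V \<epsilon>' unfolding enn_Op_def by blast
  from bchoice[OF this] obtain T where T': "\<forall>k\<in>A. 0 < T k \<and> (\<forall>\<^sub>F N in sequentially.
      outer_measure_of (M N) {\<omega> \<in> space (M N). V k N \<omega> > ennreal (T k * a N)} \<le> ennreal \<epsilon>')"
    by blast
  then have T: "0 < T k" "\<forall>\<^sub>F N in sequentially.
      outer_measure_of (M N) {\<omega> \<in> space (M N). V k N \<omega> > ennreal (T k * a N)} \<le> ennreal \<epsilon>'"
    if "k \<in> A" for k
    using that by blast+
  define T' where "T' = 1 + (\<Sum>k\<in>A. T k)"
  have T'0: "0 < T'" unfolding T'_def using T(1) by (intro add_pos_nonneg sum_nonneg) (auto intro: less_imp_le)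
  have le: "T k \<le> T'" if "k \<in> A" for k
    unfolding T'_def using member_le_sum[of k A T] that A T(1) by (force intro: less_imp_le)
  have "\<forall>\<^sub>F N in sequentially. \<forall>k\<in>A.
      outer_measure_of (M N) {\<omega> \<in> space (M N). V k N \<omega> > ennreal (T k * a N)} \<le> ennreal \<epsilon>'"
    using A T(2) by (intro eventually_ball_finite) auto
  then have "\<forall>\<^sub>F N in sequentially.
      outer_measure_of (M N) (\<Union>k\<in>A. {\<omega> \<in> space (M N). V k N \<omega> > ennreal (T' * a N)}) \<le> ennreal \<epsilon>"
  proof eventually_elim
    case (elim N)
    have "outer_measure_of (M N) (\<Union>k\<in>A. {\<omega> \<in> space (M N). V k N \<omega> > ennreal (T' * a N)})
        \<le> (\<Sum>k\<in>A. outer_measure_of (M N) {\<omega> \<in> space (M N). V k N \<omega> > ennreal (T' * a N)})"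
      using A by (intro outer_measure_of_UN_le) auto
    also have "\<dots> \<le> (\<Sum>k\<in>A. ennreal \<epsilon>')"
    proof (rule sum_mono)
      fix k assume k: "k \<in> A"
      have "ennreal (T k * a N) \<le> ennreal (T' * a N)"
        using le[OF k] a by (intro ennreal_leI mult_right_mono)
      then have "{\<omega> \<in> space (M N). V k N \<omega> > ennreal (T' * a N)} \<subseteq> {\<omega> \<in> space (M N). V k N \<omega> > ennreal (T k * a N)}"
        by (auto intro: le_less_trans)
      from order.trans[OF outer_measure_of_mono[OF this]] elim k
      show "outer_measure_of (M N) {\<omega> \<in> space (M N). V k N \<omega> > ennreal (T' * a N)} \<le> ennreal \<epsilon>'" by blast
    qed
    also have "\<dots> = ennreal (real (card A) * \<epsilon>')"
      using \<epsilon>' by (simp add: ennreal_mult ennreal_of_nat_eq_real_of_nat)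
    also have "\<dots> \<le> ennreal \<epsilon>"
      using \<epsilon> by (intro ennreal_leI) (simp add: \<epsilon>'_def field_simps)
    finally show ?case .
  qed
  then show ?thesis using T'0 by blast
qed

lemma dominated_off_mono: "dominated_off M V \<epsilon> b \<Longrightarrow> b \<le> b' \<Longrightarrow> dominated_off M V \<epsilon> b'"
  unfolding dominated_off_def by (meson ennreal_leI order.trans)

lemma powr_minus_half:
  assumes "0 < (n :: real)"
  shows "n powr (-1/2) = 1 / sqrt n"
proof -
  have "n powr (-1/2) = n powr (- (1/2))" by simp
  also have "\<dots> = inverse (n powr (1/2))" by (rule powr_minus)
  also have "n powr (1/2) = sqrt n" by (rule powr_half_sqrt) (use assms in simp)
  finally show ?thesis by (simp add: inverse_eq_divide)
qed

text \<open>Here \<open>p\<close>, \<open>r\<close>, \<open>r'\<close> are \<open>pb N\<close>,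
  \<open>r\<mu> N\<close>, \<open>re N\<close>, while \<open>T * r\<close> and
  \<open>T' * r' * p\<close> are the truncation levels. The three summands are exactly a constant
  times the matching rate; the nonnegative cross terms are added to factor the right-hand
  side.\<close>

lemma remainder_rate:
  fixes k C T T' V n p r r' :: real
  assumes "0 \<le> k" "0 \<le> C" "0 \<le> T" "0 \<le> T'" "0 \<le> V" "0 < n" "0 \<le> p" "0 \<le> r" "0 \<le> r'"
  shows "k * sqrt (2 * (C * p) * (2 * (T * r))\<^sup>2 / n) + k * sqrt ((4 * (T' * r' * p))\<^sup>2 * V / n) + 4 * (T' * r' * p) * (T * r)
    \<le> (k * sqrt (2 * C) * (2 * T) + k * (4 * T' * sqrt V) + 4 * T' * T)
      * (n powr (-1/2) * sqrt p * r + n powr (-1/2) * p * r' + p * r' * r)"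
    (is "_ \<le> (?a + ?b + ?c) * (?x + ?y + ?z)")
proof -
  have n: "n powr (-1/2) = 1 / sqrt n"
    using assms by (intro powr_minus_half)
  have 1: "k * sqrt (2 * (C * p) * (2 * (T * r))\<^sup>2 / n) = ?a * ?x"
    unfolding n real_sqrt_divide real_sqrt_mult real_sqrt_abs using assms by (simp add: abs_mult)
  have 2: "k * sqrt ((4 * (T' * r' * p))\<^sup>2 * V / n) = ?b * ?y"
    unfolding n real_sqrt_divide real_sqrt_mult real_sqrt_abs using assms by (simp add: abs_mult)
  have 3: "4 * (T' * r' * p) * (T * r) = ?c * ?z" by simp
  have nn: "0 \<le> ?a" "0 \<le> ?b" "0 \<le> ?c" "0 \<le> ?x" "0 \<le> ?y" "0 \<le> ?z" using assms by auto
  have "?a * ?x + ?b * ?y + ?c * ?z \<le> (?a + ?b + ?c) * ?x + (?a + ?b + ?c) * ?y + (?a + ?b + ?c) * ?z"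
    using nn by (intro add_mono mult_right_mono) auto
  then show ?thesis unfolding 1 2 3 by (simp only: distrib_left)
qed

lemma smallo_mult_tendsto_0:
  fixes x b :: "nat \<Rightarrow> real"
  assumes "b \<longlonglongrightarrow> 0"
  shows "(\<lambda>N. x N * b N) \<in> o(x)"
proof -
  have "b \<in> o(\<lambda>_. 1)" using assms by (intro smalloI_tendsto) auto
  from landau_o.big_small_mult[OF landau_o.big_refl[of x] this] show ?thesis by simp
qed

theorem theorem5p1:
  fixes P :: "'a measure"
    and Y0 Y1 :: "'a \<Rightarrow> real" and X :: "'a \<Rightarrow> real ^ 'p::finite" and R :: "nat \<Rightarrow> 'a \<Rightarrow> real"
    and Z :: "nat \<Rightarrow> 'a \<Rightarrow> 'p obs"
    and M :: "nat \<Rightarrow> 'w measure" and S :: "nat \<Rightarrow> nat \<Rightarrow> 'w \<Rightarrow> 'p obs"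
    and K :: nat and I :: "nat \<Rightarrow> 'w \<Rightarrow> nat \<Rightarrow> nat set"
    and mhat pihat :: "'p learner"
    and m0 m1 \<mu>0 :: "real ^ 'p \<Rightarrow> real" and \<pi> e :: "nat \<Rightarrow> real ^ 'p \<Rightarrow> real"
    and PX :: "(real ^ 'p) measure" and \<X> :: "(real ^ 'p) set"
    and \<theta>0 :: real and pb r\<mu> re :: "nat \<Rightarrow> real"
    and v w :: "real ^ 'p \<Rightarrow> real" and \<sigma>1 \<sigma>2 B B' c C C' :: real
    and \<theta>hat mean_psi :: "nat \<Rightarrow> 'w \<Rightarrow> real" and \<psi> :: "nat \<Rightarrow> 'p obs \<Rightarrow> real"
  \<comment> \<open>population\<close>
  assumes "prob_space P"
    and "Y0 \<in> borel_measurable P" and "Y1 \<in> borel_measurable P" and "X \<in> borel_measurable P"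
    and "\<And>N. R N \<in> borel_measurable P" and "\<And>N \<omega>. \<omega> \<in> space P \<Longrightarrow> R N \<omega> \<in> {0, 1}"
    and Z: "\<And>N. Z N = observation (R N) Y0 Y1 X"
    and PX: "PX = distr P borel X" and \<X>: "\<X> = measure_support PX"
    and \<theta>0: "\<theta>0 = (\<integral>\<omega>. Y0 \<omega> \<partial>P)" and pb: "\<And>N. pb N = treat_prob P (R N)"
    and m0: "regression_fun P X Y0 m0" and m1: "regression_fun P X Y1 m1"
    and \<pi>: "\<And>N. regression_fun P X (\<lambda>\<omega>. of_bool (R N \<omega> = 1)) (\<pi> N)"
    and unconfoundedness: "\<And>N. cond_indep_given P X (\<lambda>\<omega>. (Y0 \<omega>, Y1 \<omega>)) (R N)"
    and "\<mu>0 \<in> borel_measurable borel" and "\<And>N. e N \<in> borel_measurable borel"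
  \<comment> \<open>Basic Assumption; \<open>v x = E[(Y(0) - m0(X))^2 | X = x]\<close>, \<open>w x = E[(Y(0) - \<mu>0(X))^2 | X = x]\<close>\<close>
    and "\<And>N. integrable P (\<lambda>\<omega>. (norm (Z N \<omega>))\<^sup>2)"
    and "\<And>N. (\<integral>\<omega>. (norm (Z N \<omega>))\<^sup>2 \<partial>P) \<le> B"
    and "integrable P (\<lambda>\<omega>. (Y0 \<omega>)\<^sup>2)"
    and "pos_definite (cov_matrix P X)"
    and "0 < \<sigma>1" and "0 < \<sigma>2"
    and "regression_fun P X (\<lambda>\<omega>. (Y0 \<omega> - m0 (X \<omega>))\<^sup>2) v" and "\<And>x. x \<in> \<X> \<Longrightarrow> v x \<ge> \<sigma>1\<^sup>2"
    and "regression_fun P X (\<lambda>\<omega>. (Y0 \<omega> - \<mu>0 (X \<omega>))\<^sup>2) w" and "\<And>x. x \<in> \<X> \<Longrightarrow> w x \<le> \<sigma>2\<^sup>2"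
    and "prob_space.variance P Y0 \<le> \<sigma>2\<^sup>2"
  \<comment> \<open>i.i.d. sample, random folds, cross-fitted estimator\<close>
    and "\<And>N. prob_space (M N)"
    and "\<And>N. prob_space.indep_vars (M N) (\<lambda>_. borel) (S N) {1..N}"
    and "\<And>N i. i \<in> {1..N} \<Longrightarrow> distr (M N) borel (S N i) = distr P borel (Z N)"
    and "K \<ge> 2" and "\<And>N \<omega>. \<omega> \<in> space (M N) \<Longrightarrow> folds K N (I N \<omega>)"
    and "\<And>N. indep_elements (M N)
           (PiM {1..N} (\<lambda>_. borel)) (\<lambda>\<omega>. restrict (\<lambda>i. S N i \<omega>) {1..N})
           (count_space UNIV) (\<lambda>\<omega>. restrict (I N \<omega>) {1..K})"
    and "measurable_learner mhat" and "measurable_learner pihat"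
    and \<theta>hat: "\<And>N \<omega>. \<theta>hat N \<omega> = dr_estimator K mhat pihat N (I N \<omega>) (\<lambda>i. S N i \<omega>)"
    and \<psi>: "\<And>N. \<psi> N = psi0 \<mu>0 (e N) \<theta>0"
    and mean_psi: "\<And>N \<omega>. mean_psi N \<omega> = sample_mean N (\<psi> N) (\<lambda>i. S N i \<omega>)"
  \<comment> \<open>asymptotic assumptions\<close>
    and "pb \<longlonglongrightarrow> 0" and "filterlim (\<lambda>N. real N * pb N) at_top sequentially"
    and "c > 0" and "C > 0"
    and "\<And>N x. x \<in> \<X> \<Longrightarrow> c * pb N < \<pi> N x \<and> \<pi> N x < C * pb N"
    and "\<And>N x. x \<in> \<X> \<Longrightarrow> c * pb N < e N x \<and> e N x < C * pb N"
    and "\<And>N. L2_norm P (\<lambda>\<omega>. residual m0 m1 (Z N \<omega>)) \<le> ennreal B'"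
    and "L2_norm PX (\<lambda>x. m0 x - \<mu>0 x) < ennreal C'"
    and "square_integrable P (\<lambda>\<omega>. m0 (X \<omega>))"
    and "\<And>N. r\<mu> N > 0" and "r\<mu> \<longlonglongrightarrow> 0" and "\<And>N. re N > 0" and "re \<longlonglongrightarrow> 0"
    and "\<And>k. k \<in> {1..K} \<Longrightarrow>
           enn_Op M (\<lambda>N \<omega>. L2_norm PX (\<lambda>x. crossfit mhat N (I N \<omega>) (\<lambda>i. S N i \<omega>) k x - \<mu>0 x)) r\<mu>"
    and "\<And>k. k \<in> {1..K} \<Longrightarrow>
           enn_Op M (\<lambda>N \<omega>. SUP x\<in>\<X>.
             ennreal \<bar>(crossfit pihat N (I N \<omega>) (\<lambda>i. S N i \<omega>) k x - e N x) / pb N\<bar>) re"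
  shows
    "(\<exists>T1 T2 T3.
        Op M T1 (\<lambda>N. real N powr (-1/2) * sqrt (pb N) * r\<mu> N
                     + real N powr (-1/2) * pb N * re N + pb N * re N * r\<mu> N) \<and>
        Op M T2 (\<lambda>N. pb N * re N) \<and>
        Op M T3 (\<lambda>N. pb N * r\<mu> N) \<and>
        (\<forall>N. \<forall>\<omega>\<in>space (M N).
           \<theta>hat N \<omega> - \<theta>0 = mean_psi N \<omega> + T1 N \<omega>
             + of_bool (\<not> same_fun PX m0 \<mu>0) * T2 N \<omega>
             + of_bool (\<not> same_fun PX (e N) (\<pi> N)) * T3 N \<omega>))
     \<and> (\<forall>\<^sub>F N in sequentially. AE \<omega> in P.
          \<psi> N (Z N \<omega>) =
            (e N (X \<omega>) - R N \<omega>) / (1 - e N (X \<omega>)) * (m0 (X \<omega>) - \<mu>0 (X \<omega>)) + m0 (X \<omega>) - \<theta>0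
            + residual m0 m1 (Z N \<omega>) * (1 - R N \<omega>) / (1 - e N (X \<omega>)))
     \<and> (\<forall>\<^sub>F N in sequentially. square_integrable P (\<lambda>\<omega>. \<psi> N (Z N \<omega>)))
     \<and> (\<lambda>N. \<integral>\<omega>. \<psi> N (Z N \<omega>) \<partial>P)
          \<in> O(\<lambda>N. of_bool (\<not> same_fun PX (e N) (\<pi> N) \<and> \<not> same_fun PX \<mu>0 m0) * pb N)
     \<and> (\<lambda>N. prob_space.variance P (\<lambda>\<omega>. \<psi> N (Z N \<omega>))) \<in> O(\<lambda>_. 1)
     \<and> (\<forall>\<^sub>F N in sequentially. square_integrable (M N) (mean_psi N))
     \<and> (\<lambda>N. prob_space.variance (M N) (mean_psi N)) \<in> O(\<lambda>N. 1 / real N)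
     \<and> ((\<lambda>N. pb N * re N * r\<mu> N) \<in> o(\<lambda>N. real N powr (-1/2)) \<and>
        (\<not> same_fun PX m0 \<mu>0 \<longrightarrow> (\<lambda>N. pb N * re N) \<in> o(\<lambda>N. real N powr (-1/2))) \<and>
        (\<lambda>N. of_bool (\<not> same_fun PX (e N) (\<pi> N)) * (pb N * r\<mu> N)) \<in> o(\<lambda>N. real N powr (-1/2)) \<and>
        (same_fun PX m0 \<mu>0 \<or> (\<forall>\<^sub>F N in sequentially. same_fun PX (e N) (\<pi> N)))
        \<longrightarrow>
        op_small M (\<lambda>N \<omega>. \<theta>hat N \<omega> - \<theta>0 - mean_psi N \<omega>) (\<lambda>N. real N powr (-1/2)) \<and>
        (\<forall>\<^sub>F N in sequentially. (\<integral>\<omega>. \<psi> N (Z N \<omega>) \<partial>P) = 0))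
     \<and> (\<not> same_fun PX m0 \<mu>0 \<and> (\<exists>\<^sub>F N in sequentially. \<not> same_fun PX (e N) (\<pi> N))
        \<longrightarrow>
        Op M (\<lambda>N \<omega>. \<theta>hat N \<omega> - \<theta>0) (\<lambda>N. pb N + real N powr (-1/2)))"
proof -
  note P = assms(1) and Y0 = assms(2) and Y1 = assms(3) and X = assms(4) and R = assms(5) and R01 = assms(6)
    and \<mu>0 = assms(16) and e = assms(17) and v = assms(24) and M = assms(29) and S = assms(30)
    and S_distr = assms(31) and folds = assms(33) and SI = assms(34) and mhat = assms(35) and pihat = assms(36)
    and pb0 = assms(40) and C = assms(43) and \<pi>_bounds = assms(44) and e_bounds = assms(45)
    and misspec = assms(47) and m0_sq = assms(48) and r\<mu> = assms(49) and r\<mu>0 = assms(50)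
    and re = assms(51) and re0 = assms(52) and mhat_Op = assms(53) and pihat_Op = assms(54)
  interpret prob_space P by (rule P)
  let ?a1 = "\<lambda>N. real N powr (-1/2) * sqrt (pb N) * r\<mu> N + real N powr (-1/2) * pb N * re N + pb N * re N * r\<mu> N"
  let ?V = "\<integral>\<omega>. (Y0 \<omega> - m0 (X \<omega>))\<^sup>2 \<partial>P"
  \<comment> \<open>The value of \<open>\<psi>_sq_bound\<close> written outside the locale, where it
    is visibly the same for all \<open>N\<close>.\<close>
  define \<beta> where "\<beta> = 12 * C'\<^sup>2 + 3 * (\<integral>\<omega>. (m0 (X \<omega>) - \<theta>0)\<^sup>2 \<partial>P) + 12 * ?V"
  have V0: "0 \<le> ?V" by simp
  have \<beta>0: "0 \<le> \<beta>" by (simp add: \<beta>_def)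
  have C'0: "0 \<le> C'"
  proof (rule ccontr)
    assume "\<not> 0 \<le> C'"
    then have "ennreal C' = 0" by (simp add: ennreal_neg)
    with misspec show False by simp
  qed
  have X_supp: "AE x in PX. x \<in> \<X>"
    unfolding \<X> by (rule AE_in_measure_support) (simp add: PX)
  \<comment> \<open>A point of the support is wanted because the strict bounds on \<pi> at it
    exclude \<open>pb N = 0\<close>.\<close>
  have "\<X> \<noteq> {}"
  proof
    assume "\<X> = {}"
    with X_supp have "AE x in PX. False" by simp
    moreover have "prob_space PX" unfolding PX using X by (rule prob_space_distr)
    ultimately show False by (simp add: prob_space.AE_False)
  qed
  then obtain x0 where x0: "x0 \<in> \<X>" by blast
  have pb_pos: "0 < pb N" for N
  proof -
    have "0 \<le> pb N" unfolding pb treat_prob_def by simp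
    moreover have "pb N \<noteq> 0" using \<pi>_bounds[OF x0, of N] by auto
    ultimately show ?thesis by simp
  qed
  \<comment> \<open>Rare treatment enters here: it supplies the condition \<kappa> \<le> 1/4 of the
    locales for all large \<open>N\<close>.\<close>
  have Cpb: "\<forall>\<^sub>F N in sequentially. C * pb N \<le> 1 / 4"
  proof -
    have "(\<lambda>N. C * pb N) \<longlonglongrightarrow> C * 0" by (intro tendsto_intros pb0)
    then have "\<forall>\<^sub>F N in sequentially. C * pb N < 1 / 4" by (rule order_tendstoD) simp
    then show ?thesis by eventually_elim simp
  qed
  have pos_bounds: "0 < \<pi> N x \<and> \<pi> N x < C * pb N" "0 < e N x \<and> e N x < C * pb N" if "x \<in> \<X>" for N x
  proof -
    have "0 < c * pb N" using \<open>c > 0\<close> pb_pos by simp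
    then show "0 < \<pi> N x \<and> \<pi> N x < C * pb N" "0 < e N x \<and> e N x < C * pb N"
      using \<pi>_bounds[OF that, of N] e_bounds[OF that, of N] by (auto intro: less_trans)
  qed
  have AE_X: "AE \<omega> in P. X \<omega> \<in> \<X>"
    using X_supp X \<X> unfolding PX by (subst (asm) AE_distr_iff) (auto intro!: borel_closed closed_measure_support)
  have nuis: "dr_nuisance P Y0 Y1 (R N) X m0 (\<pi> N) (C * pb N) \<mu>0 (e N) C'" if "C * pb N \<le> 1 / 4" for N
  proof (intro dr_nuisance.intro dr_population.intro dr_population_axioms.intro dr_nuisance_axioms.intro)
    show "AE \<omega> in P. \<pi> N (X \<omega>) \<le> C * pb N"
      using AE_X by eventually_elim (rule less_imp_le, rule pos_bounds(1)[THEN conjunct2])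
    show "integrable P (\<lambda>\<omega>. (Y0 \<omega> - m0 (X \<omega>))\<^sup>2)"
      using v by (simp add: regression_fun_def)
    show "L2_norm (distr P borel X) (\<lambda>x. m0 x - \<mu>0 x) \<le> ennreal C'"
      using misspec by (simp add: PX)
    show "integrable P (\<lambda>\<omega>. (m0 (X \<omega>))\<^sup>2)"
      using m0_sq by (simp add: square_integrable_def)
    show "0 < \<pi> N x \<and> \<pi> N x < C * pb N" "0 < e N x \<and> e N x < C * pb N"
      if "x \<in> measure_support (distr P borel X)" for x
      using that unfolding PX[symmetric] \<X>[symmetric] by (rule pos_bounds)+
    show "0 < C * pb N" using C pb_pos by simp
  qed (fact P Y0 Y1 X R R01 m0 \<pi> unconfoundedness \<mu>0 e that C'0)+
  have samp: "dr_sample P Y0 Y1 (R N) X m0 (\<pi> N) (C * pb N) \<mu>0 (e N) C' (M N) (S N) (I N) N K (mhat N) (pihat N)"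
    if \<kappa>: "C * pb N \<le> 1 / 4" and N: "0 < N" for N
  proof -
    interpret D: dr_nuisance P Y0 Y1 "R N" X m0 "\<pi> N" "C * pb N" \<mu>0 "e N" C'
      using \<kappa> by (rule nuis)
    show ?thesis
    proof (intro dr_sample.intro dr_sample_axioms.intro nuis \<kappa>)
      show "distr (M N) borel (S N i) = D.law" if "i \<in> {1..N}" for i
        using S_distr[OF that] by (simp add: D.law_def D.Z_def Z)
      show "(\<lambda>(t, x). mhat N J t x) \<in> borel_measurable (PiM J (\<lambda>_. borel) \<Otimes>\<^sub>M borel)"
        "(\<lambda>(t, x). pihat N J t x) \<in> borel_measurable (PiM J (\<lambda>_. borel) \<Otimes>\<^sub>M borel)"
        if "J \<subseteq> {1..N}" for J
        using mhat pihat that unfolding measurable_learner_def by blast+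
    qed (fact M S folds SI N)+
  qed
  have good: "\<forall>\<^sub>F N in sequentially. C * pb N \<le> 1 / 4 \<and> 0 < N"
    using Cpb eventually_gt_at_top[of 0] by eventually_elim simp

  \<comment> \<open>Facts on the influence function and its sample mean at one sample size\<close>
  have psi_facts: "AE \<omega> in P. \<psi> N (Z N \<omega>) =
          (e N (X \<omega>) - R N \<omega>) / (1 - e N (X \<omega>)) * (m0 (X \<omega>) - \<mu>0 (X \<omega>)) + m0 (X \<omega>) - \<theta>0
          + residual m0 m1 (Z N \<omega>) * (1 - R N \<omega>) / (1 - e N (X \<omega>))" (is ?A)
      "square_integrable P (\<lambda>\<omega>. \<psi> N (Z N \<omega>))" (is ?SI)
      "\<bar>\<integral>\<omega>. \<psi> N (Z N \<omega>) \<partial>P\<bar> \<le> 2 * (C * pb N) * C'" (is ?Mean)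
      "same_fun PX (e N) (\<pi> N) \<or> same_fun PX \<mu>0 m0 \<Longrightarrow> (\<integral>\<omega>. \<psi> N (Z N \<omega>) \<partial>P) = 0" (is "?Spec \<Longrightarrow> ?Zero")
      "variance (\<lambda>\<omega>. \<psi> N (Z N \<omega>)) \<le> \<beta>" (is ?Var)
    if \<kappa>: "C * pb N \<le> 1 / 4" for N
  proof -
    interpret D: dr_nuisance P Y0 Y1 "R N" X m0 "\<pi> N" "C * pb N" \<mu>0 "e N" C'
      using \<kappa> by (rule nuis)
    have \<theta>: "D.\<theta>0 = \<theta>0" by (simp add: D.\<theta>0_def \<theta>0)
    have Z': "D.Z = Z N" by (simp add: D.Z_def Z)
    have \<psi>': "\<psi> N = psi0 \<mu>0 (e N) D.\<theta>0" by (simp add: \<psi> \<theta>)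
    show ?A unfolding \<psi>' Z'[symmetric] \<theta>[symmetric] by (rule D.AE_\<psi>)
    show ?SI unfolding square_integrable_def \<psi>' Z'[symmetric]
      using D.\<psi>_sq by (auto intro: measurable_compose[OF D.Z_measurable D.\<psi>_measurable])
    show ?Mean unfolding \<psi>' Z'[symmetric] by (rule D.abs_\<psi>_mean_le)
    show ?Zero if ?Spec unfolding \<psi>' Z'[symmetric] using that by (intro D.\<psi>_mean_zero) (simp add: PX)
    show ?Var unfolding \<psi>' Z'[symmetric] using D.\<psi>_variance_le by (simp only: D.\<psi>_sq_bound_def \<theta> \<beta>_def)
  qed
  have mean_psi_eq: "mean_psi N = (\<lambda>\<omega>. sample_mean N (\<psi> N) (\<lambda>i. S N i \<omega>))" for N
    by (rule ext) (rule mean_psi)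
  have mean_facts: "square_integrable (M N) (mean_psi N)" (is ?SI)
      "prob_space.variance (M N) (mean_psi N) \<le> \<beta> / real N" (is ?Var)
      "mean_psi N \<in> borel_measurable (M N)" (is ?Me)
      "(\<integral>\<^sup>+\<omega>. ennreal \<bar>mean_psi N \<omega> - (\<integral>\<omega>. \<psi> N (Z N \<omega>) \<partial>P)\<bar> \<partial>M N) \<le> ennreal (sqrt (\<beta> / real N))" (is ?Dev)
    if \<kappa>: "C * pb N \<le> 1 / 4" and N: "0 < N" for N
  proof -
    interpret D: dr_sample P Y0 Y1 "R N" X m0 "\<pi> N" "C * pb N" \<mu>0 "e N" C' "M N" "S N" "I N" N K "mhat N" "pihat N"
      using \<kappa> N by (rule samp)
    have \<theta>: "D.\<theta>0 = \<theta>0" by (simp add: D.\<theta>0_def \<theta>0)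
    have Z': "D.Z = Z N" by (simp add: D.Z_def Z)
    have \<psi>': "\<psi> N = psi0 \<mu>0 (e N) D.\<theta>0" by (simp add: \<psi> \<theta>)
    have B: "D.\<psi>_sq_bound = \<beta>" by (simp only: D.\<psi>_sq_bound_def \<theta> \<beta>_def)
    show ?SI unfolding mean_psi_eq \<psi>' by (rule D.sample_mean_\<psi>_square_integrable)
    show ?Var unfolding mean_psi_eq \<psi>' B[symmetric] by (rule D.sample_mean_\<psi>_variance)
    show ?Me unfolding mean_psi_eq \<psi>' by (rule D.sample_mean_\<psi>_measurable)
    show ?Dev unfolding mean_psi_eq \<psi>' Z'[symmetric] B[symmetric] by (rule D.sample_mean_\<psi>_deviation)
  qed
  define T2 where "T2 N \<omega> = crossfit_mean N K (I N \<omega>) (\<lambda>i. S N i \<omega>) (propensity_term (pihat N) (e N) m0 \<mu>0)" for N \<omega>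
  define T3 where "T3 N \<omega> = crossfit_mean N K (I N \<omega>) (\<lambda>i. S N i \<omega>) (outcome_term (mhat N) (e N) (\<pi> N) \<mu>0)" for N \<omega>
  \<comment> \<open>Defined by subtraction, so that the expansion is an identity for every
    \<open>N\<close> and every outcome, even where the locale conditions fail; only the order of
    \<open>T1\<close> needs large \<open>N\<close>.\<close>
  define T1 where "T1 N \<omega> = \<theta>hat N \<omega> - \<theta>0 - mean_psi N \<omega>
      - of_bool (\<not> same_fun PX m0 \<mu>0) * T2 N \<omega> - of_bool (\<not> same_fun PX (e N) (\<pi> N)) * T3 N \<omega>" for N \<omega>
  have decomp: "\<theta>hat N \<omega> - \<theta>0 = mean_psi N \<omega> + T1 N \<omega> + of_bool (\<not> same_fun PX m0 \<mu>0) * T2 N \<omega>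
      + of_bool (\<not> same_fun PX (e N) (\<pi> N)) * T3 N \<omega>" for N \<omega>
    by (simp add: T1_def)
  let ?dom = "\<lambda>\<epsilon> D1 D2 D3 N. dominated_off (M N) (T1 N) \<epsilon> (D1 * ?a1 N)
    \<and> dominated_off (M N) (T2 N) \<epsilon> (D2 * (pb N * re N)) \<and> dominated_off (M N) (T3 N) \<epsilon> (D3 * (pb N * r\<mu> N))"
  \<comment> \<open>One exceptional event and one pair of truncation levels per \<epsilon> serve all
    three remainders.\<close>
  have main: "\<exists>D1\<ge>0. \<exists>D2\<ge>0. \<exists>D3\<ge>0. \<forall>\<^sub>F N in sequentially. ?dom \<epsilon> D1 D2 D3 N"
    if \<epsilon>: "0 < \<epsilon>" for \<epsilon> :: real
  proof -
    let ?m = "\<lambda>k N \<omega>. L2_norm PX (\<lambda>x. crossfit mhat N (I N \<omega>) (\<lambda>i. S N i \<omega>) k x - \<mu>0 x)"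
    let ?p = "\<lambda>k N \<omega>. SUP x\<in>\<X>. ennreal \<bar>(crossfit pihat N (I N \<omega>) (\<lambda>i. S N i \<omega>) k x - e N x) / pb N\<bar>"
    obtain Tm where Tm: "0 < Tm" "\<forall>\<^sub>F N in sequentially.
        outer_measure_of (M N) (\<Union>k\<in>{1..K}. {\<omega> \<in> space (M N). ?m k N \<omega> > ennreal (Tm * r\<mu> N)}) \<le> ennreal (\<epsilon> / 2)"
      using enn_Op_UN[of "{1..K}" M ?m r\<mu> "\<epsilon> / 2"] mhat_Op r\<mu> \<epsilon> by (auto intro: less_imp_le)
    obtain Te where Te: "0 < Te" "\<forall>\<^sub>F N in sequentially.
        outer_measure_of (M N) (\<Union>k\<in>{1..K}. {\<omega> \<in> space (M N). ?p k N \<omega> > ennreal (Te * re N)}) \<le> ennreal (\<epsilon> / 2)"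
      using enn_Op_UN[of "{1..K}" M ?p re "\<epsilon> / 2"] pihat_Op re \<epsilon> by (auto intro: less_imp_le)
    \<comment> \<open>Required by \<open>\<eta>_abs_le\<close>; \<open>Te\<close> depends on
      \<epsilon> but not on \<open>N\<close>.\<close>
    have te_small: "\<forall>\<^sub>F N in sequentially. Te * re N * pb N \<le> 1 / 4"
    proof -
      have "(\<lambda>N. Te * re N * pb N) \<longlonglongrightarrow> Te * 0 * 0" by (intro tendsto_intros re0 pb0)
      then have "\<forall>\<^sub>F N in sequentially. Te * re N * pb N < 1 / 4" by (rule order_tendstoD) simp
      then show ?thesis by eventually_elim simp
    qed
    \<comment> \<open>The constant delivered by \<open>remainder_rate\<close>.\<close>
    define D1 where "D1 = real K * sqrt (2 * C) * (2 * Tm) + real K * (4 * Te * sqrt ?V) + 4 * Te * Tm"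
    have "\<forall>\<^sub>F N in sequentially. ?dom \<epsilon> D1 (4 * Te * C') (2 * C * Tm) N"
      using good Tm(2) Te(2) te_small
    proof eventually_elim
      case (elim N)
      then have \<kappa>: "C * pb N \<le> 1 / 4" and N: "0 < N" by auto
      interpret D: dr_sample P Y0 Y1 "R N" X m0 "\<pi> N" "C * pb N" \<mu>0 "e N" C' "M N" "S N" "I N" N K "mhat N" "pihat N"
        using \<kappa> N by (rule samp)
      have \<theta>: "D.\<theta>0 = \<theta>0" by (simp add: D.\<theta>0_def \<theta>0)
      have \<psi>': "psi0 \<mu>0 (e N) D.\<theta>0 = \<psi> N" by (simp add: \<psi> \<theta>)
      let ?E1 = "\<Union>k\<in>{1..K}. {\<omega> \<in> space (M N). ?m k N \<omega> > ennreal (Tm * r\<mu> N)}"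
      let ?E2 = "\<Union>k\<in>{1..K}. {\<omega> \<in> space (M N). ?p k N \<omega> > ennreal (Te * re N)}"
      \<comment> \<open>The propensity level carries the factor \<open>pb N\<close> because the
        assumed error is divided by \<open>pb N\<close>.\<close>
      let ?tm = "Tm * r\<mu> N" and ?te = "Te * re N * pb N"
      have E: "?E1 \<union> ?E2 \<subseteq> space (M N)" by auto
      have "outer_measure_of (M N) (?E1 \<union> ?E2) \<le> outer_measure_of (M N) ?E1 + outer_measure_of (M N) ?E2"
        by (intro outer_measure_of_Un_le) auto
      also have "\<dots> \<le> ennreal (\<epsilon> / 2) + ennreal (\<epsilon> / 2)" using elim by (intro add_mono) auto
      also have "\<dots> = ennreal \<epsilon>" using \<epsilon> by (simp add: ennreal_plus[symmetric] del: ennreal_plus)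
      finally have oE: "outer_measure_of (M N) (?E1 \<union> ?E2) \<le> ennreal \<epsilon>" .
      have tm: "L2_norm D.PX (\<lambda>x. mhat N ({1..N} - I N \<omega> k) (restrict (\<lambda>i. S N i \<omega>) ({1..N} - I N \<omega> k)) x - \<mu>0 x) \<le> ennreal ?tm"
        if "\<omega> \<in> space (M N) - (?E1 \<union> ?E2)" "k \<in> {1..K}" for k \<omega>
        using that unfolding crossfit_def PX by (auto simp: not_less)
      have te: "\<bar>pihat N ({1..N} - I N \<omega> k) (restrict (\<lambda>i. S N i \<omega>) ({1..N} - I N \<omega> k)) x - e N x\<bar> \<le> ?te"
        if \<omega>: "\<omega> \<in> space (M N) - (?E1 \<union> ?E2)" and k: "k \<in> {1..K}" and x: "x \<in> D.\<X>" for k x \<omega>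
      proof -
        have x': "x \<in> \<X>" using x by (simp add: \<X> PX)
        let ?d = "\<bar>(crossfit pihat N (I N \<omega>) (\<lambda>i. S N i \<omega>) k x - e N x) / pb N\<bar>"
        have "ennreal ?d \<le> ?p k N \<omega>" using x' by (rule SUP_upper)
        also have "\<dots> \<le> ennreal (Te * re N)" using \<omega> k by (auto simp: not_less)
        finally have "?d \<le> Te * re N" using Te(1) re[of N] by (simp add: ennreal_le_iff)
        then show ?thesis
          using pb_pos[of N] by (simp add: crossfit_def abs_divide pos_divide_le_eq)
      qed
      have tm0: "0 \<le> ?tm" using Tm(1) r\<mu>[of N] by simp
      have te0: "0 \<le> ?te" using Te(1) re[of N] pb_pos[of N] by simp
      note bounds = D.remainder_bounds[OF E oE tm0 te0 elim(4) tm te]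
      have T1_eq: "T1 N = (\<lambda>\<omega>. crossfit_mean N K (I N \<omega>) (\<lambda>i. S N i \<omega>) (dr_score (mhat N) (pihat N)) - D.\<theta>0 - sample_mean N (psi0 \<mu>0 (e N) D.\<theta>0) (\<lambda>i. S N i \<omega>)
            - of_bool (\<not> same_fun D.PX m0 \<mu>0) * crossfit_mean N K (I N \<omega>) (\<lambda>i. S N i \<omega>) (propensity_term (pihat N) (e N) m0 \<mu>0)
            - of_bool (\<not> same_fun D.PX (e N) (\<pi> N)) * crossfit_mean N K (I N \<omega>) (\<lambda>i. S N i \<omega>) (outcome_term (mhat N) (e N) (\<pi> N) \<mu>0))"
        unfolding T1_def[abs_def] T2_def T3_def \<theta>hat dr_estimator_eq mean_psi \<psi> \<theta> PX ..
      have "dominated_off (M N) (T1 N) \<epsilon> (real K * sqrt (2 * (C * pb N) * (2 * ?tm)\<^sup>2 / real N)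
          + real K * sqrt ((4 * ?te)\<^sup>2 * ?V / real N) + 4 * ?te * ?tm)"
        unfolding T1_eq by (rule bounds(1); assumption)
      moreover have "real K * sqrt (2 * (C * pb N) * (2 * ?tm)\<^sup>2 / real N)
          + real K * sqrt ((4 * ?te)\<^sup>2 * ?V / real N) + 4 * ?te * ?tm \<le> D1 * ?a1 N"
        unfolding D1_def
        by (rule remainder_rate) (use C Tm(1) Te(1) N V0 pb_pos[of N] r\<mu>[of N] re[of N] in simp_all)
      ultimately have 1: "dominated_off (M N) (T1 N) \<epsilon> (D1 * ?a1 N)"
        by (rule dominated_off_mono)
      have "dominated_off (M N) (T2 N) \<epsilon> (4 * ?te * C')"
        unfolding T2_def[abs_def] by (rule bounds(2); assumption)
      also have "4 * ?te * C' = (4 * Te * C') * (pb N * re N)" by simp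
      finally have 2: "dominated_off (M N) (T2 N) \<epsilon> ((4 * Te * C') * (pb N * re N))" .
      have "dominated_off (M N) (T3 N) \<epsilon> (2 * (C * pb N) * ?tm)"
        unfolding T3_def[abs_def] by (rule bounds(3); assumption)
      also have "2 * (C * pb N) * ?tm = (2 * C * Tm) * (pb N * r\<mu> N)" by simp
      finally have 3: "dominated_off (M N) (T3 N) \<epsilon> ((2 * C * Tm) * (pb N * r\<mu> N))" .
      from 1 2 3 show ?case by blast
    qed
    moreover have "0 \<le> D1" "0 \<le> 4 * Te * C'" "0 \<le> 2 * C * Tm"
      using Tm(1) Te(1) C C'0 by (auto simp: D1_def)
    ultimately show ?thesis by blast
  qed
  have N_pos: "\<forall>\<^sub>F N in sequentially. 0 < real N powr (-1/2)"
    using eventually_gt_at_top[of 0] by eventually_elim simp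
  have a1_pos: "\<forall>\<^sub>F N in sequentially. 0 < ?a1 N"
    using N_pos by eventually_elim (use pb_pos r\<mu> re in \<open>auto intro!: add_pos_pos mult_pos_pos\<close>)
  have T1: "Op M T1 ?a1"
  proof (rule Op_first_moment)
    show "\<forall>\<^sub>F N in sequentially. 0 < ?a1 N" by (rule a1_pos)
    fix \<epsilon> :: real assume "\<epsilon> > 0"
    from main[OF this] obtain D1 D2 D3 where "0 \<le> D1" and ev: "\<forall>\<^sub>F N in sequentially. ?dom \<epsilon> D1 D2 D3 N"
      by blast
    from ev have "\<forall>\<^sub>F N in sequentially. dominated_off (M N) (T1 N) \<epsilon> (D1 * ?a1 N)"
      by eventually_elim blast
    then show "\<exists>D\<ge>0. \<forall>\<^sub>F N in sequentially. dominated_off (M N) (T1 N) \<epsilon> (D * ?a1 N)"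
      using \<open>0 \<le> D1\<close> by blast
  qed
  have T2: "Op M T2 (\<lambda>N. pb N * re N)"
  proof (rule Op_first_moment)
    show "\<forall>\<^sub>F N in sequentially. 0 < pb N * re N" using pb_pos re by (intro always_eventually) auto
    fix \<epsilon> :: real assume "\<epsilon> > 0"
    from main[OF this] obtain D1 D2 D3 where "0 \<le> D2" and ev: "\<forall>\<^sub>F N in sequentially. ?dom \<epsilon> D1 D2 D3 N"
      by blast
    from ev have "\<forall>\<^sub>F N in sequentially. dominated_off (M N) (T2 N) \<epsilon> (D2 * (pb N * re N))"
      by eventually_elim blast
    then show "\<exists>D\<ge>0. \<forall>\<^sub>F N in sequentially. dominated_off (M N) (T2 N) \<epsilon> (D * (pb N * re N))"
      using \<open>0 \<le> D2\<close> by blast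
  qed
  have T3: "Op M T3 (\<lambda>N. pb N * r\<mu> N)"
  proof (rule Op_first_moment)
    show "\<forall>\<^sub>F N in sequentially. 0 < pb N * r\<mu> N" using pb_pos r\<mu> by (intro always_eventually) auto
    fix \<epsilon> :: real assume "\<epsilon> > 0"
    from main[OF this] obtain D1 D2 D3 where "0 \<le> D3" and ev: "\<forall>\<^sub>F N in sequentially. ?dom \<epsilon> D1 D2 D3 N"
      by blast
    from ev have "\<forall>\<^sub>F N in sequentially. dominated_off (M N) (T3 N) \<epsilon> (D3 * (pb N * r\<mu> N))"
      by eventually_elim blast
    then show "\<exists>D\<ge>0. \<forall>\<^sub>F N in sequentially. dominated_off (M N) (T3 N) \<epsilon> (D * (pb N * r\<mu> N))"
      using \<open>0 \<le> D3\<close> by blast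
  qed

  \<comment> \<open>Orders of the mean and the variances\<close>
  let ?E\<psi> = "\<lambda>N. \<integral>\<omega>. \<psi> N (Z N \<omega>) \<partial>P"
  have same_comm: "same_fun PX \<mu>0 m0 \<longleftrightarrow> same_fun PX m0 \<mu>0"
    unfolding same_fun_def by (simp add: eq_commute)
  have mean_O: "?E\<psi> \<in> O(\<lambda>N. of_bool (\<not> same_fun PX (e N) (\<pi> N) \<and> \<not> same_fun PX \<mu>0 m0) * pb N)"
  proof (rule bigoI[of _ "2 * C * C'"])
    show "\<forall>\<^sub>F N in sequentially. norm (?E\<psi> N)
        \<le> 2 * C * C' * norm (of_bool (\<not> same_fun PX (e N) (\<pi> N) \<and> \<not> same_fun PX \<mu>0 m0) * pb N)"
      using Cpb
    proof eventually_elim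
      case (elim N)
      show ?case
      proof (cases "same_fun PX (e N) (\<pi> N) \<or> same_fun PX \<mu>0 m0")
        case True
        then show ?thesis using psi_facts(4)[OF elim True] by auto
      next
        case False
        then show ?thesis using psi_facts(3)[OF elim] pb_pos[of N] by (simp add: mult_ac)
      qed
    qed
  qed
  have var_O: "(\<lambda>N. variance (\<lambda>\<omega>. \<psi> N (Z N \<omega>))) \<in> O(\<lambda>_. 1)"
  proof (rule bigoI[of _ \<beta>])
    show "\<forall>\<^sub>F N in sequentially. norm (variance (\<lambda>\<omega>. \<psi> N (Z N \<omega>))) \<le> \<beta> * norm (1 :: real)"
      using Cpb
    proof eventually_elim
      case (elim N)
      show ?case
        unfolding real_norm_def abs_of_nonneg[OF variance_positive] abs_one mult_1_right
        by (rule psi_facts(5)[OF elim])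
    qed
  qed
  have mean_var_O: "(\<lambda>N. prob_space.variance (M N) (mean_psi N)) \<in> O(\<lambda>N. 1 / real N)"
  proof (rule bigoI[of _ \<beta>])
    show "\<forall>\<^sub>F N in sequentially. norm (prob_space.variance (M N) (mean_psi N)) \<le> \<beta> * norm (1 / real N)"
      using good
    proof eventually_elim
      case (elim N)
      then have "0 \<le> 1 / real N" by simp
      then show ?case
        unfolding real_norm_def abs_of_nonneg[OF prob_space.variance_positive[OF M]] abs_of_nonneg[OF \<open>0 \<le> 1 / real N\<close>]
          times_divide_eq_right mult_1_right
        using elim by (intro mean_facts(2)) auto
    qed
  qed

  \<comment> \<open>Root-N expansion, and the rate under double misspecification\<close>
  let ?s = "\<lambda>N. real N powr (-1/2)"
  have small: "op_small M (\<lambda>N \<omega>. \<theta>hat N \<omega> - \<theta>0 - mean_psi N \<omega>) ?s \<and> (\<forall>\<^sub>F N in sequentially. ?E\<psi> N = 0)"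
    if o1: "(\<lambda>N. pb N * re N * r\<mu> N) \<in> o(?s)"
      and o2: "\<not> same_fun PX m0 \<mu>0 \<longrightarrow> (\<lambda>N. pb N * re N) \<in> o(?s)"
      and o3: "(\<lambda>N. of_bool (\<not> same_fun PX (e N) (\<pi> N)) * (pb N * r\<mu> N)) \<in> o(?s)"
      and spec: "same_fun PX m0 \<mu>0 \<or> (\<forall>\<^sub>F N in sequentially. same_fun PX (e N) (\<pi> N))"
  proof
    \<comment> \<open>The first two parts of the rate of \<open>T1\<close> are the root-N rate times
      null sequences, hence negligible automatically; \<open>o1\<close> takes care of the
      third.\<close>
    have l1: "(\<lambda>N. sqrt (pb N) * r\<mu> N) \<longlonglongrightarrow> 0"
      using tendsto_mult[OF tendsto_real_sqrt[OF pb0] r\<mu>0] by simp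
    have l2: "(\<lambda>N. pb N * re N) \<longlonglongrightarrow> 0"
      using tendsto_mult[OF pb0 re0] by simp
    have "(\<lambda>N. ?s N * (sqrt (pb N) * r\<mu> N) + ?s N * (pb N * re N) + pb N * re N * r\<mu> N) \<in> o(?s)"
      by (intro sum_in_smallo smallo_mult_tendsto_0[OF l1] smallo_mult_tendsto_0[OF l2] o1)
    then have "?a1 \<in> o(?s)" by (simp add: mult.assoc)
    from Op_imp_op_small[OF T1 this N_pos] have s1: "op_small M T1 ?s" .
    have "(\<lambda>N. \<bar>of_bool (\<not> same_fun PX m0 \<mu>0)\<bar> * (pb N * re N)) \<in> o(?s)"
      using o2 by (cases "same_fun PX m0 \<mu>0") auto
    from Op_imp_op_small[OF Op_cmult[OF T2] this N_pos]
    have s2: "op_small M (\<lambda>N \<omega>. of_bool (\<not> same_fun PX m0 \<mu>0) * T2 N \<omega>) ?s" .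
    have "(\<lambda>N. \<bar>of_bool (\<not> same_fun PX (e N) (\<pi> N))\<bar> * (pb N * r\<mu> N)) \<in> o(?s)"
      using o3 by simp
    from Op_imp_op_small[OF Op_cmult[OF T3] this N_pos]
    have s3: "op_small M (\<lambda>N \<omega>. of_bool (\<not> same_fun PX (e N) (\<pi> N)) * T3 N \<omega>) ?s" .
    show "op_small M (\<lambda>N \<omega>. \<theta>hat N \<omega> - \<theta>0 - mean_psi N \<omega>) ?s"
      using op_small_add[OF op_small_add[OF s1 s2] s3] by (simp add: decomp add.assoc)
    show "\<forall>\<^sub>F N in sequentially. ?E\<psi> N = 0"
      using spec
    proof
      assume "same_fun PX m0 \<mu>0"
      then have same: "same_fun PX \<mu>0 m0" by (simp only: same_comm)
      show ?thesis using Cpb by eventually_elim (rule psi_facts(4), use same in auto)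
    next
      assume "\<forall>\<^sub>F N in sequentially. same_fun PX (e N) (\<pi> N)"
      then show ?thesis using Cpb by eventually_elim (rule psi_facts(4), auto)
    qed
  qed
  \<comment> \<open>The mean of \<psi> is of order \<open>pb N\<close>, the deviation of
    \<open>mean_psi\<close> from it of order root-N, and in the rates of \<open>T1\<close>,
    \<open>T2\<close>, \<open>T3\<close> the extra factors \<open>pb N\<close>, \<open>re N\<close>,
    \<open>r\<mu> N\<close> are eventually below 1.\<close>
  have both: "Op M (\<lambda>N \<omega>. \<theta>hat N \<omega> - \<theta>0) (\<lambda>N. pb N + ?s N)"
  proof -
    let ?r = "\<lambda>N. pb N + ?s N"
    have r_pos: "0 \<le> ?s N" for N by simp
    have d: "Op M (\<lambda>N \<omega>. mean_psi N \<omega> - ?E\<psi> N) ?s"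
    proof (rule Op_first_moment[OF N_pos])
      fix \<epsilon> :: real assume "\<epsilon> > 0"
      have "\<forall>\<^sub>F N in sequentially. dominated_off (M N) (\<lambda>\<omega>. mean_psi N \<omega> - ?E\<psi> N) \<epsilon> (sqrt \<beta> * ?s N)"
        using good
      proof eventually_elim
        case (elim N)
        then have N: "0 < N" and \<kappa>: "C * pb N \<le> 1 / 4" by auto
        have [measurable]: "mean_psi N \<in> borel_measurable (M N)" by (rule mean_facts(3)[OF \<kappa> N])
        have "sqrt (\<beta> / real N) = sqrt \<beta> * ?s N"
          using powr_minus_half[of "real N"] N by (simp only: real_sqrt_divide times_divide_eq_right mult_1_right of_nat_0_less_iff)
        with mean_facts(4)[OF \<kappa> N] have "(\<integral>\<^sup>+\<omega>. ennreal \<bar>mean_psi N \<omega> - ?E\<psi> N\<bar> \<partial>M N) \<le> ennreal (sqrt \<beta> * ?s N)"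
          by (simp only:)
        then show ?case
          unfolding dominated_off_def
          by (intro exI[of _ "{}"] exI[of _ "\<lambda>\<omega>. ennreal \<bar>mean_psi N \<omega> - ?E\<psi> N\<bar>"]) simp
      qed
      then show "\<exists>D\<ge>0. \<forall>\<^sub>F N in sequentially. dominated_off (M N) (\<lambda>\<omega>. mean_psi N \<omega> - ?E\<psi> N) \<epsilon> (D * ?s N)"
        using \<beta>0 by (intro exI[of _ "sqrt \<beta>"]) simp
    qed
    have ev1: "\<forall>\<^sub>F N in sequentially. pb N < 1 \<and> re N < 1 \<and> r\<mu> N < 1"
      by (intro eventually_conj order_tendstoD(2)[OF pb0] order_tendstoD(2)[OF re0] order_tendstoD(2)[OF r\<mu>0]) simp_all
    have o1: "Op M (\<lambda>N \<omega>. mean_psi N \<omega> - ?E\<psi> N) ?r"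
      by (rule Op_mono[OF d, of 1]) (use pb_pos in \<open>auto intro!: always_eventually less_imp_le\<close>)
    have o2: "Op M (\<lambda>N _. ?E\<psi> N) ?r"
    \<comment> \<open>The \<open>+ 1\<close> yields a positive constant from
      \<open>0 \<le> C'\<close> alone.\<close>
    proof (rule Op_deterministic[of "2 * C * C' + 1"])
      show "\<forall>\<^sub>F N in sequentially. \<bar>?E\<psi> N\<bar> \<le> (2 * C * C' + 1) * ?r N"
        using Cpb
      proof eventually_elim
        case (elim N)
        have "\<bar>?E\<psi> N\<bar> \<le> (2 * C * C') * pb N" using psi_facts(3)[OF elim] by (simp add: mult_ac)
        also have "\<dots> \<le> (2 * C * C' + 1) * ?r N"
          using C C'0 pb_pos[of N] r_pos[of N] by (intro mult_mono) auto
        finally show ?case .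
      qed
    qed (use C C'0 in \<open>auto intro: add_nonneg_pos\<close>)
    have o3: "Op M T1 ?r"
    proof (rule Op_mono[OF T1, of 2])
      show "\<forall>\<^sub>F N in sequentially. ?a1 N \<le> 2 * ?r N"
        using ev1
      proof eventually_elim
        case (elim N)
        have p: "0 < pb N" "0 < re N" "0 < r\<mu> N" using pb_pos re r\<mu> by auto
        \<comment> \<open>Two of the three parts are absorbed by the root-N rate and one by
          \<open>pb N\<close>, hence the constant 2.\<close>
        have "?s N * sqrt (pb N) * r\<mu> N \<le> ?s N * 1 * 1" "?s N * pb N * re N \<le> ?s N * 1 * 1"
          "pb N * re N * r\<mu> N \<le> pb N * 1 * 1"
          using elim p by (intro mult_mono; auto)+
        note le = this[unfolded mult_1_right]
        have "x + y + z \<le> 2 * (q + s)" if "x \<le> s" "y \<le> s" "z \<le> q" "0 < q" for x y z q s :: real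
          using that by simp
        from this[OF le p(1)] show ?case .
      qed
    qed auto
    have o4: "Op M (\<lambda>N \<omega>. of_bool (\<not> same_fun PX m0 \<mu>0) * T2 N \<omega>) ?r"
    proof (rule Op_mono[OF T2, of 1])
      show "\<forall>\<^sub>F N in sequentially. pb N * re N \<le> 1 * ?r N"
        using ev1
      proof eventually_elim
        case (elim N)
        have "pb N * re N \<le> pb N * 1" using elim pb_pos[of N] by (intro mult_left_mono) auto
        also have "\<dots> \<le> 1 * ?r N" by simp
        finally show ?case .
      qed
    qed (simp_all add: of_bool_def)
    have o5: "Op M (\<lambda>N \<omega>. of_bool (\<not> same_fun PX (e N) (\<pi> N)) * T3 N \<omega>) ?r"
    proof (rule Op_mono[OF T3, of 1])
      show "\<forall>\<^sub>F N in sequentially. pb N * r\<mu> N \<le> 1 * ?r N"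
        using ev1
      proof eventually_elim
        case (elim N)
        have "pb N * r\<mu> N \<le> pb N * 1" using elim pb_pos[of N] by (intro mult_left_mono) auto
        also have "\<dots> \<le> 1 * ?r N" by simp
        finally show ?case .
      qed
    qed (simp_all add: of_bool_def)
    have "Op M (\<lambda>N \<omega>. (mean_psi N \<omega> - ?E\<psi> N) + ?E\<psi> N + T1 N \<omega> + of_bool (\<not> same_fun PX m0 \<mu>0) * T2 N \<omega>
        + of_bool (\<not> same_fun PX (e N) (\<pi> N)) * T3 N \<omega>) ?r"
      by (rule Op_add[OF Op_add[OF Op_add[OF Op_add[OF o1 o2] o3] o4] o5])
    then show ?thesis by (simp only: decomp diff_add_cancel)
  qed
  show ?thesis
  proof (intro conjI)
    show "\<exists>T1 T2 T3.
        Op M T1 ?a1 \<and> Op M T2 (\<lambda>N. pb N * re N) \<and> Op M T3 (\<lambda>N. pb N * r\<mu> N) \<and>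
        (\<forall>N. \<forall>\<omega>\<in>space (M N).
           \<theta>hat N \<omega> - \<theta>0 = mean_psi N \<omega> + T1 N \<omega>
             + of_bool (\<not> same_fun PX m0 \<mu>0) * T2 N \<omega>
             + of_bool (\<not> same_fun PX (e N) (\<pi> N)) * T3 N \<omega>)"
      by (rule exI[of _ T1], rule exI[of _ T2], rule exI[of _ T3]) (intro conjI T1 T2 T3 allI ballI decomp)
    show "\<forall>\<^sub>F N in sequentially. AE \<omega> in P.
          \<psi> N (Z N \<omega>) =
            (e N (X \<omega>) - R N \<omega>) / (1 - e N (X \<omega>)) * (m0 (X \<omega>) - \<mu>0 (X \<omega>)) + m0 (X \<omega>) - \<theta>0
            + residual m0 m1 (Z N \<omega>) * (1 - R N \<omega>) / (1 - e N (X \<omega>))"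
      using Cpb by eventually_elim (rule psi_facts(1))
    show "\<forall>\<^sub>F N in sequentially. square_integrable P (\<lambda>\<omega>. \<psi> N (Z N \<omega>))"
      using Cpb by eventually_elim (rule psi_facts(2))
    show "\<forall>\<^sub>F N in sequentially. square_integrable (M N) (mean_psi N)"
      using good by eventually_elim (rule mean_facts(1), auto)
    show "(\<lambda>N. pb N * re N * r\<mu> N) \<in> o(?s) \<and>
        (\<not> same_fun PX m0 \<mu>0 \<longrightarrow> (\<lambda>N. pb N * re N) \<in> o(?s)) \<and>
        (\<lambda>N. of_bool (\<not> same_fun PX (e N) (\<pi> N)) * (pb N * r\<mu> N)) \<in> o(?s) \<and>
        (same_fun PX m0 \<mu>0 \<or> (\<forall>\<^sub>F N in sequentially. same_fun PX (e N) (\<pi> N)))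
        \<longrightarrow> op_small M (\<lambda>N \<omega>. \<theta>hat N \<omega> - \<theta>0 - mean_psi N \<omega>) ?s \<and> (\<forall>\<^sub>F N in sequentially. ?E\<psi> N = 0)"
      using small by blast
    show "\<not> same_fun PX m0 \<mu>0 \<and> (\<exists>\<^sub>F N in sequentially. \<not> same_fun PX (e N) (\<pi> N))
        \<longrightarrow> Op M (\<lambda>N \<omega>. \<theta>hat N \<omega> - \<theta>0) (\<lambda>N. pb N + ?s N)"
      using both by blast
  qed (rule mean_O var_O mean_var_O)+
qed

end
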